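(* Let $2<p<6$ and $2<q<4$. Let $\mathcal{G}$ be a non-compact metric graph with at least one vertex of degree $2$. Then there exists $\widetilde{\mu}_{p,q}>0$, depending on $p,q,\mathcal{G}$, such that ground states of $F_{p,q}$ at mass $\mu$ on $\mathcal{G}$ exist for every $\mu\ge\widetilde{\mu}_{p,q}$.
   Context: A metric graph $\mathcal{G}=(V,E)$ is connected, has finite vertex set $V$ and finite edge set $E$ (loops and multiple edges allowed); each bounded edge is identified with a compact interval of positive length, each unbounded edge (half-line) with $[0,+\infty)$, whose origin is a vertex (points at infinity are not vertices). $\mathcal{G}$ is non-compact if it has at least one half-line. The degree of a vertex is the number of edge-ends at it (a loop counts twice). $H^1(\mathcal{G})$ is the space of continuous functions on $\mathcal{G}$ with $\int_{\mathcal G}(|u'|^2+|u|^2)\,dx<\infty$ (weak derivative on each edge), and $H^1_\mu(\mathcal{G})=\{u\in H^1(\mathcal{G}):\|u\|_{L^2(\mathcal{G})}^2=\mu\}$ for $\mu>0$. $F_{p,q}(u,\mathcal{G})=\frac12\int_{\mathcal{G}}|u'|^2dx-\frac1p\int_{\mathcal{G}}|u|^pdx-\frac1q\sum_{v\in V}|u(v)|^q$. A ground state of $F_{p,q}$ at mass $\mu$ on $\mathcal{G}$ is a function $u\in H^1_\mu(\mathcal{G})$ with $F_{p,q}(u,\mathcal{G})=\inf_{w\in H^1_\mu(\mathcal{G})}F_{p,q}(w,\mathcal{G})$. *)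

theory Defs
  imports "HOL-Analysis.Analysis"
begin

section \<open>Metric graphs\<close>

text \<open>
  Every edge carries an orientation, i.e. an identification with $[0,\ell_e]$, where $t = 0$ is the
  tail and $t = \ell_e$ the head. A half-line is an edge of length $\infty$; its origin is
  its tail, and its head field is meaningless and never used.
\<close>

record ('v, 'e) mgraph =
  verts :: "'v set"
  edges :: "'e set"
  tail  :: "'e \<Rightarrow> 'v"
  head  :: "'e \<Rightarrow> 'v"
  len   :: "'e \<Rightarrow> ereal"

definition bounded_edges :: "('v, 'e) mgraph \<Rightarrow> 'e set" where
  "bounded_edges G = {e \<in> edges G. len G e < \<infinity>}"

definition half_lines :: "('v, 'e) mgraph \<Rightarrow> 'e set" where
  "half_lines G = {e \<in> edges G. len G e = \<infinity>}"

definition adj :: "('v, 'e) mgraph \<Rightarrow> ('v \<times> 'v) set" where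
  "adj G = {(tail G e, head G e) | e. e \<in> bounded_edges G}"

locale metric_graph =
  fixes G :: "('v, 'e) mgraph"
  assumes finite_verts: "finite (verts G)"
    and finite_edges: "finite (edges G)"
    and verts_nonempty: "verts G \<noteq> {}"
    and tail_in_verts: "\<And>e. e \<in> edges G \<Longrightarrow> tail G e \<in> verts G"
    and head_in_verts: "\<And>e. e \<in> bounded_edges G \<Longrightarrow> head G e \<in> verts G"
    and len_pos: "\<And>e. e \<in> edges G \<Longrightarrow> 0 < len G e"
    and connected: "\<And>v w. v \<in> verts G \<Longrightarrow> w \<in> verts G \<Longrightarrow> (v, w) \<in> (adj G \<union> (adj G)\<inverse>)\<^sup>*"

definition noncompact_graph :: "('v, 'e) mgraph \<Rightarrow> bool" where
  "noncompact_graph G \<longleftrightarrow> half_lines G \<noteq> {}"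

text \<open>A loop contributes to both summands.\<close>

definition vertex_degree :: "('v, 'e) mgraph \<Rightarrow> 'v \<Rightarrow> nat" where
  "vertex_degree G v = card {e \<in> edges G. tail G e = v} + card {e \<in> bounded_edges G. head G e = v}"

section \<open>Functions on a metric graph\<close>

text \<open>
  A point of the graph is a vertex or an interior point of an edge (at the given coordinate).
  Functions on the graph are functions on this type; their values at those elements of the type
  that are not points of the graph are irrelevant.
\<close>

datatype ('v, 'e) point = Vertex 'v | Interior 'e real

definition edge_interval :: "('v, 'e) mgraph \<Rightarrow> 'e \<Rightarrow> real set" where
  "edge_interval G e = {t. 0 \<le> t \<and> ereal t \<le> len G e}"

definition open_edge_interval :: "('v, 'e) mgraph \<Rightarrow> 'e \<Rightarrow> real set" where
  "open_edge_interval G e = {t. 0 < t \<and> ereal t < len G e}"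

definition edge_point :: "('v, 'e) mgraph \<Rightarrow> 'e \<Rightarrow> real \<Rightarrow> ('v, 'e) point" where
  "edge_point G e t =
     (if t = 0 then Vertex (tail G e)
      else if ereal t = len G e then Vertex (head G e)
      else Interior e t)"

definition on_edge ::
  "('v, 'e) mgraph \<Rightarrow> (('v, 'e) point \<Rightarrow> real) \<Rightarrow> 'e \<Rightarrow> real \<Rightarrow> real" where
  "on_edge G u e t = u (edge_point G e t)"

text \<open>
  The graph is the quotient of the disjoint union of the closed edges that glues the edge-ends at
  each vertex, so continuity on the graph is continuity along every closed edge; agreement of the
  edges at a common vertex is built into \<^const>\<open>edge_point\<close>.
\<close>

definition graph_continuous :: "('v, 'e) mgraph \<Rightarrow> (('v, 'e) point \<Rightarrow> real) \<Rightarrow> bool" where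
  "graph_continuous G u \<longleftrightarrow> (\<forall>e \<in> edges G. continuous_on (edge_interval G e) (on_edge G u e))"

definition graph_integrable :: "('v, 'e) mgraph \<Rightarrow> ('e \<Rightarrow> real \<Rightarrow> real) \<Rightarrow> bool" where
  "graph_integrable G f \<longleftrightarrow> (\<forall>e \<in> edges G. set_integrable lborel (open_edge_interval G e) (f e))"

definition graph_integral :: "('v, 'e) mgraph \<Rightarrow> ('e \<Rightarrow> real \<Rightarrow> real) \<Rightarrow> real" where
  "graph_integral G f = (\<Sum>e \<in> edges G. LINT t:open_edge_interval G e|lborel. f e t)"

section \<open>Weak derivatives and Sobolev spaces\<close>

definition locally_integrable_on :: "(real \<Rightarrow> real) \<Rightarrow> real set \<Rightarrow> bool" where
  "locally_integrable_on f I \<longleftrightarrow> (\<forall>K. compact K \<and> K \<subseteq> I \<longrightarrow> set_integrable lborel K f)"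

text \<open>The test functions are those in $C^1_c(I)$, \<^term>\<open>I\<close> being an open interval.\<close>

definition C1c :: "real set \<Rightarrow> (real \<Rightarrow> real) set" where
  "C1c I = {\<phi>. \<phi> C1_differentiable_on UNIV \<and>
               compact (closure {t. \<phi> t \<noteq> 0}) \<and> closure {t. \<phi> t \<noteq> 0} \<subseteq> I}"

definition has_weak_deriv_on :: "(real \<Rightarrow> real) \<Rightarrow> (real \<Rightarrow> real) \<Rightarrow> real set \<Rightarrow> bool" where
  "has_weak_deriv_on f g I \<longleftrightarrow>
     locally_integrable_on f I \<and> locally_integrable_on g I \<and>
     (\<forall>\<phi> \<in> C1c I. (LINT t:I|lborel. f t * deriv \<phi> t) = - (LINT t:I|lborel. g t * \<phi> t))"

definition weakly_differentiable_on :: "(real \<Rightarrow> real) \<Rightarrow> real set \<Rightarrow> bool" where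
  "weakly_differentiable_on f I \<longleftrightarrow> (\<exists>g. has_weak_deriv_on f g I)"

text \<open>
  A weak derivative is unique up to a null set, so the choice below affects neither
  square-integrability nor any integral.
\<close>

definition weak_deriv :: "(real \<Rightarrow> real) \<Rightarrow> real set \<Rightarrow> real \<Rightarrow> real" where
  "weak_deriv f I = (SOME g. has_weak_deriv_on f g I)"

definition graph_deriv ::
  "('v, 'e) mgraph \<Rightarrow> (('v, 'e) point \<Rightarrow> real) \<Rightarrow> 'e \<Rightarrow> real \<Rightarrow> real" where
  "graph_deriv G u e = weak_deriv (on_edge G u e) (open_edge_interval G e)"

definition H1 :: "('v, 'e) mgraph \<Rightarrow> (('v, 'e) point \<Rightarrow> real) set" where
  "H1 G = {u. graph_continuous G u \<and>
              (\<forall>e \<in> edges G. weakly_differentiable_on (on_edge G u e) (open_edge_interval G e)) \<and>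
              graph_integrable G (\<lambda>e t. \<bar>graph_deriv G u e t\<bar>\<^sup>2) \<and>
              graph_integrable G (\<lambda>e t. \<bar>on_edge G u e t\<bar>\<^sup>2)}"

definition H1_mass :: "('v, 'e) mgraph \<Rightarrow> real \<Rightarrow> (('v, 'e) point \<Rightarrow> real) set" where
  "H1_mass G \<mu> = {u \<in> H1 G. graph_integral G (\<lambda>e t. \<bar>on_edge G u e t\<bar>\<^sup>2) = \<mu>}"

section \<open>The energy and its ground states\<close>

definition energy :: "real \<Rightarrow> real \<Rightarrow> (('v, 'e) point \<Rightarrow> real) \<Rightarrow> ('v, 'e) mgraph \<Rightarrow> real" where
  "energy p q u G =
     1 / 2 * graph_integral G (\<lambda>e t. \<bar>graph_deriv G u e t\<bar>\<^sup>2)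
     - 1 / p * graph_integral G (\<lambda>e t. \<bar>on_edge G u e t\<bar> powr p)
     - 1 / q * (\<Sum>v \<in> verts G. \<bar>u (Vertex v)\<bar> powr q)"

text \<open>
  The infimum is taken in the extended reals, so that it is the true infimum even when the energy
  is unbounded below.
\<close>

definition ground_state ::
  "real \<Rightarrow> real \<Rightarrow> real \<Rightarrow> ('v, 'e) mgraph \<Rightarrow> (('v, 'e) point \<Rightarrow> real) \<Rightarrow> bool" where
  "ground_state p q \<mu> G u \<longleftrightarrow>
     u \<in> H1_mass G \<mu> \<and> ereal (energy p q u G) = (INF w \<in> H1_mass G \<mu>. ereal (energy p q w G))"

end

theory Submission
  imports Defs "HOL-Complex_Analysis.Great_Picard" "HOL-Real_Asymp.Real_Asymp" "HOL-Probability.Sinc_Integral"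
begin

text \<open>
  Let $I$ be the infimum of the energy at mass $\mu$. A function on a half-line is cut, at little
  cost, into pieces supported in windows of a fixed length $d$ less than half of every edge. Moving
  such a piece to the vertex of degree two, centred at its maximum, changes neither its mass nor its
  line energy but gains the vertex term. In the natural scaling $\mu = h^{(6-p)/2}$, with soliton
  height $h$ and width $h^{-(p-2)/2}$, the cutting costs $O(h^2)$, whereas the gain is of order
  $h^q$ (or $h^{(p+2)/2}$ if the piece is too flat). As $q > 2$ and $p > 2$, for large $\mu$
  there is $\gamma > 0$ such that every function living on the half-lines with mass $m \le \mu$ has
  energy at least $(I + \gamma) m / \mu$. Since energies scale superlinearly in the mass, the
  remaining part of a minimising sequence has energy at least its share of $I$, so no mass escapes to
  infinity. Hence the sequence converges in $L^2$, and by the parallelogram law in $H^1$.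
\<close>

section \<open>Smooth steps and cutoffs\<close>

text \<open>Degree two is what lets a function on the line be laid on the graph without distortion:
  the two edge-ends at the vertex unfold to an interval around 0, so mass and line energy are kept
  exactly. The obstacle is that only a fixed length is available there, while a function on a
  half-line may be spread arbitrarily far; this forces the windows. The soliton width L =
  h^(-(p-2)/2) tends to 0, so a number of cut positions comparable to d / L fits into a window of
  length d. Cutting over a width L costs about h^(p-2) per unit of mass in the strip, and averaging
  over the positions turns this into a total of order h^(p-2) \<mu> L = h^2. The bounds p < 6 and q
  < 4 enter through the estimate of sup |u|^4 by a multiple of the kinetic energy plus a constant,
  at fixed mass, which subordinates both nonlinear terms to the kinetic energy. No weak compactness
  is used: functions converge pointwise first, and limits of derivatives come from completeness of
  L^2. Throughout, a function is accompanied by an explicit weak derivative.\<close>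

definition sstep :: "real \<Rightarrow> real" where
  "sstep x = 2 * (max 0 x)\<^sup>2 - 4 * (max 0 (x - 1/2))\<^sup>2 + 2 * (max 0 (x - 1))\<^sup>2"

text \<open>The tent of height 2 and area 1 over [0, 1], with primitive \<open>sstep\<close>.
  Truncated powers reduce the smoothness of the step to the single fact \<open>max_sq_deriv\<close>.
  The tent reappears as a mollifier in \<open>bump_limit\<close>.\<close>

definition sstep' :: "real \<Rightarrow> real" where
  "sstep' x = 4 * max 0 x - 8 * max 0 (x - 1/2) + 4 * max 0 (x - 1)"

lemma max_sq_deriv: "((\<lambda>x. (max 0 x)\<^sup>2) has_real_derivative 2 * max 0 x) (at (x::real))"
proof (cases x "0::real" rule: linorder_cases)
  case less
  have "((\<lambda>x. 0) has_real_derivative 2 * max 0 x) (at x)" using less by simp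
  then show ?thesis
    by (rule has_field_derivative_transform_within_open[of _ _ _ "{..<0}"]) (use less in auto)
next
  case equal
  have "((\<lambda>h. (max 0 h)\<^sup>2 / h) \<longlongrightarrow> 0) (at (0::real))"
  proof (rule Lim_null_comparison)
    show "\<forall>\<^sub>F h in at 0. norm ((max 0 h)\<^sup>2 / h) \<le> \<bar>h::real\<bar>"
      by (rule always_eventually) (auto simp: max_def power2_eq_square)
    show "((\<lambda>h::real. \<bar>h\<bar>) \<longlongrightarrow> 0) (at 0)" by (auto intro!: tendsto_eq_intros)
  qed
  then show ?thesis using equal by (simp add: DERIV_def)
next
  case greater
  have "((\<lambda>x. x\<^sup>2) has_real_derivative 2 * max 0 x) (at x)"
    using greater by (auto intro!: derivative_eq_intros)
  then show ?thesis
    by (rule has_field_derivative_transform_within_open[of _ _ _ "{0<..}"]) (use greater in auto)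
qed

lemma max_sq_deriv_shift:
  "((\<lambda>x. (max 0 (x - c))\<^sup>2) has_real_derivative 2 * max 0 (x - c)) (at (x::real))"
proof -
  have "((\<lambda>x. x - c) has_real_derivative 1) (at x)" by (auto intro!: derivative_eq_intros)
  from DERIV_chain2[where f = "\<lambda>x. (max 0 x)\<^sup>2" and g = "\<lambda>x. x - c", OF max_sq_deriv this]
  show ?thesis by simp
qed

lemma sstep_deriv: "(sstep has_real_derivative sstep' x) (at x)"
  unfolding sstep_def[abs_def] sstep'_def
  by (rule derivative_eq_intros max_sq_deriv max_sq_deriv_shift | simp)+

lemma sstep_deriv_comp [derivative_intros]:
  "(f has_real_derivative f') (at x within A) \<Longrightarrow>
    ((\<lambda>x. sstep (f x)) has_real_derivative sstep' (f x) * f') (at x within A)"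
  by (rule DERIV_chain2[OF sstep_deriv])

lemma continuous_sstep': "continuous_on A sstep'"
  unfolding sstep'_def[abs_def] by (intro continuous_intros)

lemma continuous_sstep: "continuous_on A sstep"
  unfolding sstep_def[abs_def] by (intro continuous_intros)

lemma sstep_le0: "x \<le> 0 \<Longrightarrow> sstep x = 0" and sstep_ge1: "1 \<le> x \<Longrightarrow> sstep x = 1"
  by (auto simp: sstep_def max_def power2_eq_square algebra_simps)

lemma sstep'_le0: "x \<le> 0 \<Longrightarrow> sstep' x = 0" and sstep'_ge1: "1 \<le> x \<Longrightarrow> sstep' x = 0"
  by (auto simp: sstep'_def max_def)

lemma sstep'_nonneg: "0 \<le> sstep' x" and sstep'_le: "sstep' x \<le> 2"
  by (auto simp: sstep'_def max_def)

lemma sstep_mono: "x \<le> y \<Longrightarrow> sstep x \<le> sstep y"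
  by (rule DERIV_nonneg_imp_nondecreasing) (auto intro: sstep_deriv sstep'_nonneg)

lemma sstep_nonneg: "0 \<le> sstep x"
  using sstep_mono[of "min 0 x" x] sstep_le0[of "min 0 x"] by auto

lemma sstep_le_1: "sstep x \<le> 1"
  using sstep_mono[of x "max 1 x"] sstep_ge1[of "max 1 x"] by auto

section \<open>A pair of cutoffs whose squares add up to one\<close>

definition cutang :: "real \<Rightarrow> real \<Rightarrow> real \<Rightarrow> real" where
  "cutang a L t = pi / 2 * sstep ((t - a) / L)"

definition cutang' :: "real \<Rightarrow> real \<Rightarrow> real \<Rightarrow> real" where
  "cutang' a L t = pi / 2 * (sstep' ((t - a) / L) / L)"

text \<open>Cosine and sine of one angle that rises from 0 to pi/2 over [a, a+L]. The squares of
  \<open>chi\<close> and \<open>eta\<close> then add up to 1, so that a cut preserves the mass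
  exactly.\<close>

definition chi where "chi a L t = cos (cutang a L t)"
definition chi' where "chi' a L t = - sin (cutang a L t) * cutang' a L t"
definition eta where "eta a L t = sin (cutang a L t)"
definition eta' where "eta' a L t = cos (cutang a L t) * cutang' a L t"

lemma cutang_deriv: "(cutang a L has_real_derivative cutang' a L t) (at t)"
proof -
  have "((\<lambda>t. t - a) has_real_derivative 1) (at t)" by (auto intro!: derivative_eq_intros)
  from DERIV_cmult[OF sstep_deriv_comp[OF DERIV_cdivide[OF this, of L]], of "pi / 2"]
  show ?thesis by (simp add: cutang_def[abs_def] cutang'_def)
qed

lemma cutang_deriv_comp [derivative_intros]:
  "(f has_real_derivative f') (at x within A) \<Longrightarrow>
    ((\<lambda>x. cutang a L (f x)) has_real_derivative cutang' a L (f x) * f') (at x within A)"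
  by (rule DERIV_chain2[OF cutang_deriv])

lemma chi_deriv: "(chi a L has_real_derivative chi' a L t) (at t)"
  unfolding chi_def[abs_def] chi'_def by (auto intro!: derivative_eq_intros)

lemma eta_deriv: "(eta a L has_real_derivative eta' a L t) (at t)"
  unfolding eta_def[abs_def] eta'_def by (auto intro!: derivative_eq_intros)

lemma continuous_cutang: "continuous_on A (cutang a L)"
  using DERIV_continuous_on[of A "cutang a L" "cutang' a L"] cutang_deriv
  by (auto intro: has_field_derivative_at_within)

lemma continuous_cutang': "continuous_on A (cutang' a L)"
  unfolding cutang'_def[abs_def]
proof (cases "L = 0")
  case False
  then have "continuous_on A (\<lambda>t. sstep' ((t - a) / L))"
    by (auto intro!: continuous_on_compose2[OF continuous_sstep'[of UNIV]] continuous_intros)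
  then show "continuous_on A (\<lambda>t. pi / 2 * (sstep' ((t - a) / L) / L))"
    using False by (auto intro!: continuous_intros)
qed simp

lemma continuous_chi: "continuous_on A (chi a L)"
  and continuous_chi': "continuous_on A (chi' a L)"
  and continuous_eta: "continuous_on A (eta a L)"
  and continuous_eta': "continuous_on A (eta' a L)"
  unfolding chi_def[abs_def] chi'_def[abs_def] eta_def[abs_def] eta'_def[abs_def]
  by (intro continuous_intros continuous_cutang continuous_cutang')+

lemma cut_low: assumes "L > 0" "t \<le> a"
  shows "chi a L t = 1" "chi' a L t = 0" "eta a L t = 0" "eta' a L t = 0"
proof -
  have "(t - a) / L \<le> 0" using assms by (simp add: divide_nonpos_pos)
  then show "chi a L t = 1" "chi' a L t = 0" "eta a L t = 0" "eta' a L t = 0"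
    by (auto simp: chi_def chi'_def eta_def eta'_def cutang_def cutang'_def sstep_le0 sstep'_le0)
qed

lemma cut_high: assumes "L > 0" "a + L \<le> t"
  shows "chi a L t = 0" "chi' a L t = 0" "eta a L t = 1" "eta' a L t = 0"
proof -
  have "1 \<le> (t - a) / L" using assms by (simp add: field_simps)
  then show "chi a L t = 0" "chi' a L t = 0" "eta a L t = 1" "eta' a L t = 0"
    by (auto simp: chi_def chi'_def eta_def eta'_def cutang_def cutang'_def sstep_ge1 sstep'_ge1)
qed

lemma chi_eta_sq: "(chi a L t)\<^sup>2 + (eta a L t)\<^sup>2 = 1"
  by (simp add: chi_def eta_def)

lemma abs_chi_le: "\<bar>chi a L t\<bar> \<le> 1" and abs_eta_le: "\<bar>eta a L t\<bar> \<le> 1"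
  by (simp_all add: chi_def eta_def)

text \<open>The sum collapses to the square of the angle's derivative, which is at most (pi/2)(2/L)
  since the tent has height 2; pi < 4 gives the round constant.\<close>

lemma cut_deriv_bound:
  assumes "L > 0" shows "(chi' a L t)\<^sup>2 + (eta' a L t)\<^sup>2 \<le> 16 / L\<^sup>2"
proof -
  have "(chi' a L t)\<^sup>2 + (eta' a L t)\<^sup>2
      = (cutang' a L t)\<^sup>2 * ((sin (cutang a L t))\<^sup>2 + (cos (cutang a L t))\<^sup>2)"
    unfolding chi'_def eta'_def by algebra
  also have "\<dots> = (cutang' a L t)\<^sup>2" by simp
  also have "\<dots> \<le> (4 / L)\<^sup>2"
  proof (rule power_mono)
    have "pi / 2 * (sstep' ((t - a) / L) / L) \<le> 2 * (2 / L)"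
      using assms pi_less_4 by (intro mult_mono divide_right_mono) (auto simp: sstep'_le sstep'_nonneg)
    then show "cutang' a L t \<le> 4 / L" by (simp add: cutang'_def)
    show "0 \<le> cutang' a L t" using assms by (simp add: cutang'_def sstep'_nonneg)
  qed
  also have "\<dots> = 16 / L\<^sup>2" by (simp add: power_divide)
  finally show ?thesis .
qed

text \<open>IMS localisation: since $\chi^2 + \eta^2 = 1$, the cross terms cancel.\<close>

lemma ims_identity:
  "(chi' a L t * f + chi a L t * g)\<^sup>2 + (eta' a L t * f + eta a L t * g)\<^sup>2
     = g\<^sup>2 + ((chi' a L t)\<^sup>2 + (eta' a L t)\<^sup>2) * f\<^sup>2"
proof -
  have "chi' a L t * chi a L t + eta' a L t * eta a L t = 0"
    by (simp add: chi_def chi'_def eta_def eta'_def)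
  moreover have "(chi' a L t * f + chi a L t * g)\<^sup>2 + (eta' a L t * f + eta a L t * g)\<^sup>2
     = ((chi a L t)\<^sup>2 + (eta a L t)\<^sup>2) * g\<^sup>2 + ((chi' a L t)\<^sup>2 + (eta' a L t)\<^sup>2) * f\<^sup>2
       + 2 * f * g * (chi' a L t * chi a L t + eta' a L t * eta a L t)"
    by (simp add: power2_eq_square algebra_simps)
  ultimately show ?thesis by (simp add: chi_eta_sq)
qed

section \<open>Calculus of weak derivatives\<close>

lemma set_integrable_lborel_iff:
  fixes f :: "real \<Rightarrow> real"
  shows "set_integrable lborel A f \<longleftrightarrow> integrable lborel (\<lambda>t. indicator A t * f t)"
  by (simp add: set_integrable_def)

lemma C1_alt:
  "f C1_differentiable_on UNIV \<longleftrightarrow> (\<forall>t. (f has_real_derivative deriv f t) (at t)) \<and> continuous_on UNIV (deriv f)"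
  for f :: "real \<Rightarrow> real"
proof
  assume "f C1_differentiable_on UNIV"
  then obtain D where D: "\<And>x. (f has_vector_derivative D x) (at x)" "continuous_on UNIV D"
    by (auto simp: C1_differentiable_on_def)
  have "(f has_real_derivative D x) (at x)" for x
    using D(1) has_real_derivative_iff_has_vector_derivative by blast
  moreover from this have "deriv f = D" by (auto simp: DERIV_imp_deriv)
  ultimately show "(\<forall>t. (f has_real_derivative deriv f t) (at t)) \<and> continuous_on UNIV (deriv f)"
    using D by simp
next
  assume "(\<forall>t. (f has_real_derivative deriv f t) (at t)) \<and> continuous_on UNIV (deriv f)"
  then show "f C1_differentiable_on UNIV"
    unfolding C1_differentiable_on_def using has_real_derivative_iff_has_vector_derivative by blast
qed

lemma C1I:
  fixes f :: "real \<Rightarrow> real"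
  assumes "\<And>t. (f has_real_derivative f' t) (at t)" "continuous_on UNIV f'"
  shows "f C1_differentiable_on UNIV" "deriv f = f'"
proof -
  show "deriv f = f'" using assms(1) by (auto simp: DERIV_imp_deriv)
  then show "f C1_differentiable_on UNIV" using assms by (simp add: C1_alt)
qed

lemma deriv_zero_off_support:
  fixes f :: "real \<Rightarrow> real"
  assumes "(f has_real_derivative d) (at t)" "t \<notin> closure {t. f t \<noteq> 0}"
  shows "d = 0" "f t = 0"
proof -
  let ?U = "- closure {t. f t \<noteq> 0}"
  have z: "f x = 0" if "x \<in> ?U" for x using that closure_subset[of "{t. f t \<noteq> 0}"] by auto
  have "(f has_real_derivative 0) (at t)"
  proof (rule has_field_derivative_transform_within_open[of "\<lambda>_. 0" _ _ ?U])
    show "t \<in> ?U" using assms(2) by simp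
    show "0 = f x" if "x \<in> ?U" for x using z[OF that] by simp
    show "open ?U" by (rule open_Compl[OF closed_closure])
  qed simp_all
  then show "d = 0" using assms(1) DERIV_unique by blast
  show "f t = 0" by (rule z) (use assms(2) in simp)
qed

lemma C1cE:
  assumes "\<phi> \<in> C1c I"
  obtains K where "compact K" "K \<subseteq> I" "\<And>t. t \<notin> K \<Longrightarrow> \<phi> t = 0" "\<And>t. t \<notin> K \<Longrightarrow> deriv \<phi> t = 0"
    "\<And>t. (\<phi> has_real_derivative deriv \<phi> t) (at t)" "continuous_on UNIV \<phi>" "continuous_on UNIV (deriv \<phi>)"
proof (rule that[of "closure {t. \<phi> t \<noteq> 0}"])
  have C: "(\<phi> has_real_derivative deriv \<phi> t) (at t)" "continuous_on UNIV (deriv \<phi>)" for t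
    using assms by (auto simp: C1c_def C1_alt)
  show "(\<phi> has_real_derivative deriv \<phi> t) (at t)" "continuous_on UNIV (deriv \<phi>)" for t
    using C by auto
  show "continuous_on UNIV \<phi>"
    using C(1) DERIV_continuous_on by blast
  show "compact (closure {t. \<phi> t \<noteq> 0})" "closure {t. \<phi> t \<noteq> 0} \<subseteq> I"
    using assms by (auto simp: C1c_def)
  show "\<phi> t = 0" "deriv \<phi> t = 0" if "t \<notin> closure {t. \<phi> t \<noteq> 0}" for t
    using deriv_zero_off_support[OF C(1) that] by auto
qed

lemma C1cI:
  assumes "\<And>t. (\<phi> has_real_derivative \<phi>' t) (at t)" "continuous_on UNIV \<phi>'"
    "compact K" "K \<subseteq> I" "\<And>t. t \<notin> K \<Longrightarrow> \<phi> t = 0"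
  shows "\<phi> \<in> C1c I \<and> deriv \<phi> = \<phi>'"
proof
  have "closure {t. \<phi> t \<noteq> 0} \<subseteq> K"
    using assms by (intro closure_minimal) (auto intro: compact_imp_closed)
  moreover from this have "compact (closure {t. \<phi> t \<noteq> 0})"
    using assms(3) compact_closure bounded_subset compact_imp_bounded
    by (metis closure_closure compact_eq_bounded_closed closed_closure)
  ultimately show "\<phi> \<in> C1c I" using C1I[OF assms(1,2)] assms(4) by (auto simp: C1c_def)
  show "deriv \<phi> = \<phi>'" by (rule C1I[OF assms(1,2)])
qed

section \<open>Local integrability\<close>

lemma loc_int_cmult: "locally_integrable_on f I \<Longrightarrow> locally_integrable_on (\<lambda>t. c * f t) I"
  unfolding locally_integrable_on_def by auto

lemma loc_int_add: "locally_integrable_on f I \<Longrightarrow> locally_integrable_on g I \<Longrightarrow>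
    locally_integrable_on (\<lambda>t. f t + g t) I"
  unfolding locally_integrable_on_def by auto

lemma loc_int_continuous:
  assumes "continuous_on I f" shows "locally_integrable_on f I"
  unfolding locally_integrable_on_def
proof (intro allI impI)
  fix K :: "real set" assume "compact K \<and> K \<subseteq> I"
  then show "set_integrable lborel K f"
    unfolding set_integrable_def
    by (intro borel_integrable_compact) (auto intro: continuous_on_subset assms)
qed

text \<open>The last premise permits the domain to change from I to J: on a compact part of J the
  factor h vanishes off some compact part of I, so f is only ever evaluated where it is known to be
  integrable, and h is bounded there.\<close>

lemma loc_int_mult_cont:
  assumes f: "locally_integrable_on f I" and h: "continuous_on UNIV h"
    and J: "\<And>K. compact K \<Longrightarrow> K \<subseteq> J \<Longrightarrow> \<exists>K'\<subseteq>I. compact K' \<and> (\<forall>t\<in>K-K'. h t = 0)"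
  shows "locally_integrable_on (\<lambda>t. h t * f t) J"
  unfolding locally_integrable_on_def
proof (intro allI impI)
  fix K :: "real set" assume K: "compact K \<and> K \<subseteq> J"
  then obtain K' where K': "K' \<subseteq> I" "compact K'" "\<And>t. t \<in> K - K' \<Longrightarrow> h t = 0" using J[of K] by auto
  have i: "integrable lborel (\<lambda>t. indicator (K \<inter> K') t * f t)"
    using f K K' by (auto simp: locally_integrable_on_def set_integrable_lborel_iff compact_Int le_infI2)
  obtain B where B: "\<And>t. t \<in> K' \<Longrightarrow> \<bar>h t\<bar> \<le> B"
    using compact_imp_bounded[OF compact_continuous_image[OF continuous_on_subset[OF h] K'(2)]]
    unfolding bounded_iff by auto
  have eq: "(\<lambda>t. indicator K t * (h t * f t)) = (\<lambda>t. (indicator (K \<inter> K') t * f t) * h t)"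
    using K K' by (auto simp: indicator_def fun_eq_iff)
  have [measurable]: "h \<in> borel_measurable borel"
    using h(1) by (simp add: borel_measurable_continuous_onI)
  have [measurable]: "(\<lambda>t. indicator (K \<inter> K') t * f t) \<in> borel_measurable lborel"
    using i by simp
  show "set_integrable lborel K (\<lambda>t. h t * f t)" unfolding set_integrable_lborel_iff eq
  proof (rule Bochner_Integration.integrable_bound[OF integrable_mult_right[OF i, of "B"]])
    show "(\<lambda>t. indicator (K \<inter> K') t * f t * h t) \<in> borel_measurable lborel" by measurable
    show "AE t in lborel. norm (indicator (K \<inter> K') t * f t * h t) \<le> norm (B * (indicator (K \<inter> K') t * f t))"
    proof (rule AE_I2)
      fix t
      show "norm (indicator (K \<inter> K') t * f t * h t) \<le> norm (B * (indicator (K \<inter> K') t * f t))"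
        using mult_right_mono[OF order_trans[OF B abs_ge_self], of t "\<bar>f t\<bar>"] by (auto simp: indicator_def abs_mult mult.commute)
    qed
  qed
qed

lemma loc_int_mult:
  assumes f: "locally_integrable_on f I" and K: "compact K" "K \<subseteq> I"
    and h: "continuous_on UNIV h" "\<And>t. t \<notin> K \<Longrightarrow> h t = 0"
  shows "integrable lborel (\<lambda>t. indicator I t * (f t * h t))"
proof -
  have "locally_integrable_on (\<lambda>t. h t * f t) I"
    by (rule loc_int_mult_cont[OF f h(1)]) auto
  then have "integrable lborel (\<lambda>t. indicator K t * (h t * f t))"
    using K by (simp add: locally_integrable_on_def set_integrable_lborel_iff)
  moreover have "(\<lambda>t. indicator K t * (h t * f t)) = (\<lambda>t. indicator I t * (f t * h t))"
    using K h(2) by (auto simp: indicator_def fun_eq_iff)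
  ultimately show ?thesis by simp
qed

section \<open>Algebra of weak derivatives\<close>

abbreviation wd where "wd \<equiv> has_weak_deriv_on"

lemma wd_iff:
  "wd f g I \<longleftrightarrow> locally_integrable_on f I \<and> locally_integrable_on g I \<and>
     (\<forall>\<phi> \<in> C1c I. (\<integral>t. indicator I t * (f t * deriv \<phi> t) \<partial>lborel) = - (\<integral>t. indicator I t * (g t * \<phi> t) \<partial>lborel))"
  by (simp add: has_weak_deriv_on_def set_lebesgue_integral_def)

lemma C1c_int:
  assumes "locally_integrable_on f I" "\<phi> \<in> C1c I"
  shows "integrable lborel (\<lambda>t. indicator I t * (f t * \<phi> t))"
    "integrable lborel (\<lambda>t. indicator I t * (f t * deriv \<phi> t))"
  by (rule C1cE[OF assms(2)], rule loc_int_mult[OF assms(1)]; assumption)+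

lemma wd_cmult: assumes "wd f g I" shows "wd (\<lambda>t. c * f t) (\<lambda>t. c * g t) I"
  unfolding wd_iff
proof (intro conjI ballI)
  show "locally_integrable_on (\<lambda>t. c * f t) I" "locally_integrable_on (\<lambda>t. c * g t) I"
    using assms by (auto simp: wd_iff intro: loc_int_cmult)
  fix \<phi> assume "\<phi> \<in> C1c I"
  then have "(\<integral>t. indicator I t * (f t * deriv \<phi> t) \<partial>lborel) = - (\<integral>t. indicator I t * (g t * \<phi> t) \<partial>lborel)"
    using assms by (auto simp: wd_iff)
  from arg_cong[OF this, of "(*) c"]
  show "(\<integral>t. indicator I t * (c * f t * deriv \<phi> t) \<partial>lborel) = - (\<integral>t. indicator I t * (c * g t * \<phi> t) \<partial>lborel)"
    by (simp add: integral_mult_right_zero[symmetric] ac_simps del: integral_mult_right_zero)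
qed

lemma wd_add: assumes "wd f g I" "wd f' g' I" shows "wd (\<lambda>t. f t + f' t) (\<lambda>t. g t + g' t) I"
  unfolding wd_iff
proof (intro conjI ballI)
  have L: "locally_integrable_on f I" "locally_integrable_on g I" "locally_integrable_on f' I" "locally_integrable_on g' I"
    using assms by (auto simp: wd_iff)
  show "locally_integrable_on (\<lambda>t. f t + f' t) I" "locally_integrable_on (\<lambda>t. g t + g' t) I"
    using L by (auto intro: loc_int_add)
  fix \<phi> assume p: "\<phi> \<in> C1c I"
  have "(\<integral>t. indicator I t * (f t * deriv \<phi> t) \<partial>lborel) = - (\<integral>t. indicator I t * (g t * \<phi> t) \<partial>lborel)"
    "(\<integral>t. indicator I t * (f' t * deriv \<phi> t) \<partial>lborel) = - (\<integral>t. indicator I t * (g' t * \<phi> t) \<partial>lborel)"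
    using assms p by (auto simp: wd_iff)
  then show "(\<integral>t. indicator I t * ((f t + f' t) * deriv \<phi> t) \<partial>lborel) = - (\<integral>t. indicator I t * ((g t + g' t) * \<phi> t) \<partial>lborel)"
    using C1c_int[OF L(1) p] C1c_int[OF L(2) p] C1c_int[OF L(3) p] C1c_int[OF L(4) p]
    by (simp add: algebra_simps Bochner_Integration.integral_add)
qed

lemma wd_diff: assumes "wd f g I" "wd f' g' I" shows "wd (\<lambda>t. f t - f' t) (\<lambda>t. g t - g' t) I"
  using wd_add[OF assms(1) wd_cmult[OF assms(2), of "-1"]] by simp

text \<open>Multiplication by a $C^1$ function whose support allows the domain to be changed: this covers
  the product rule, restriction to a smaller domain and extension by zero.\<close>

lemma wd_mult_C1:
  assumes "wd f g I" and e: "\<And>t. (\<eta> has_real_derivative \<eta>' t) (at t)" "continuous_on UNIV \<eta>'"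
    and s: "closed S" "\<And>t. t \<notin> S \<Longrightarrow> \<eta> t = 0" "S \<inter> J \<subseteq> I"
  shows "wd (\<lambda>t. \<eta> t * f t) (\<lambda>t. \<eta>' t * f t + \<eta> t * g t) J"
proof -
  obtain S0 where S0: "S0 = closure {t. \<eta> t \<noteq> 0}" by blast
  have cS: "S0 \<subseteq> S" unfolding S0 using s by (intro closure_minimal) auto
  have clS: "closed S0" unfolding S0 by simp
  have L: "locally_integrable_on f I" "locally_integrable_on g I"
    using assms by (auto simp: wd_iff)
  have z: "\<eta>' t = 0" "\<eta> t = 0" if "t \<notin> S0" for t
    using deriv_zero_off_support[OF e(1)] that unfolding S0 by blast+
  have ce: "continuous_on UNIV \<eta>"
    using e(1) DERIV_continuous_on by blast
  have K: "\<exists>K'\<subseteq>I. compact K' \<and> (\<forall>t\<in>K-K'. h t = 0)" if "compact K" "K \<subseteq> J" "\<And>t. t \<notin> S0 \<Longrightarrow> h t = 0" for K and h :: "real \<Rightarrow> real"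
  proof (intro exI[of _ "K \<inter> S0"] conjI ballI)
    show "K \<inter> S0 \<subseteq> I" using that(2) cS s(3) by fast
    show "compact (K \<inter> S0)" using that(1) by (intro compact_Int_closed clS)
    show "h t = 0" if "t \<in> K - K \<inter> S0" for t using that \<open>\<And>t. t \<notin> S0 \<Longrightarrow> h t = 0\<close> by fast
  qed
  have L1: "locally_integrable_on (\<lambda>t. \<eta> t * f t) J"
    by (rule loc_int_mult_cont[OF L(1) ce K]) (simp_all add: z)
  moreover have L2: "locally_integrable_on (\<lambda>t. \<eta>' t * f t) J"
    by (rule loc_int_mult_cont[OF L(1) e(2) K]) (simp_all add: z)
  moreover have L3: "locally_integrable_on (\<lambda>t. \<eta> t * g t) J"
    by (rule loc_int_mult_cont[OF L(2) ce K]) (simp_all add: z)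
  moreover have "(\<integral>t. indicator J t * (\<eta> t * f t * deriv \<phi> t) \<partial>lborel) = - (\<integral>t. indicator J t * ((\<eta>' t * f t + \<eta> t * g t) * \<phi> t) \<partial>lborel)"
    if p: "\<phi> \<in> C1c J" for \<phi>
  proof -
    obtain K where K: "compact K" "K \<subseteq> J" "\<And>t. t \<notin> K \<Longrightarrow> \<phi> t = 0" "\<And>t. t \<notin> K \<Longrightarrow> deriv \<phi> t = 0"
      "\<And>t. (\<phi> has_real_derivative deriv \<phi> t) (at t)" "continuous_on UNIV \<phi>" "continuous_on UNIV (deriv \<phi>)"
      using C1cE[OF p] by metis
    have "(\<lambda>t. \<eta> t * \<phi> t) \<in> C1c I \<and> deriv (\<lambda>t. \<eta> t * \<phi> t) = (\<lambda>t. \<eta>' t * \<phi> t + \<eta> t * deriv \<phi> t)"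
    proof (rule C1cI[of _ _ "K \<inter> S0"])
      show "((\<lambda>t. \<eta> t * \<phi> t) has_real_derivative \<eta>' t * \<phi> t + \<eta> t * deriv \<phi> t) (at t)" for t
        by (auto intro!: derivative_eq_intros e K)
      show "continuous_on UNIV (\<lambda>t. \<eta>' t * \<phi> t + \<eta> t * deriv \<phi> t)"
        by (intro continuous_intros e ce K)
      show "K \<inter> S0 \<subseteq> I" using K cS s by auto
      show "compact (K \<inter> S0)" by (intro compact_Int_closed clS K)
      show "\<eta> t * \<phi> t = 0" if "t \<notin> K \<inter> S0" for t using K(3)[of t] z(2)[of t] that by auto
    qed
    then have "(\<integral>t. indicator I t * (f t * (\<eta>' t * \<phi> t + \<eta> t * deriv \<phi> t)) \<partial>lborel) = - (\<integral>t. indicator I t * (g t * (\<eta> t * \<phi> t)) \<partial>lborel)"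
      using assms(1) by (auto simp: wd_iff)
    moreover have "(\<lambda>t. indicator I t * (f t * (\<eta>' t * \<phi> t + \<eta> t * deriv \<phi> t))) = 
      (\<lambda>t. indicator J t * (\<eta>' t * f t * \<phi> t) + indicator J t * (\<eta> t * f t * deriv \<phi> t))"
    proof
      fix t show "indicator I t * (f t * (\<eta>' t * \<phi> t + \<eta> t * deriv \<phi> t)) = 
        indicator J t * (\<eta>' t * f t * \<phi> t) + indicator J t * (\<eta> t * f t * deriv \<phi> t)"
        using K(2) K(3)[of t] K(4)[of t] z[of t] cS s(3)
        by (cases "t \<in> K"; cases "t \<in> S0"; cases "t \<in> I"; cases "t \<in> J"; auto simp: algebra_simps)
    qed
    moreover have "(\<lambda>t. indicator I t * (g t * (\<eta> t * \<phi> t))) = (\<lambda>t. indicator J t * (\<eta> t * g t * \<phi> t))"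
    proof
      fix t show "indicator I t * (g t * (\<eta> t * \<phi> t)) = indicator J t * (\<eta> t * g t * \<phi> t)"
        using K(2) K(3)[of t] K(4)[of t] z[of t] cS s(3)
        by (cases "t \<in> K"; cases "t \<in> S0"; cases "t \<in> I"; cases "t \<in> J"; auto simp: algebra_simps)
    qed
    moreover have "(\<lambda>t. indicator J t * ((\<eta>' t * f t + \<eta> t * g t) * \<phi> t)) =
       (\<lambda>t. indicator J t * (\<eta>' t * f t * \<phi> t) + indicator J t * (\<eta> t * g t * \<phi> t))"
      by (auto simp: algebra_simps)
    ultimately show ?thesis
      using C1c_int[OF L1 p] C1c_int[OF L2 p] C1c_int[OF L3 p]
      by (simp add: Bochner_Integration.integral_add)
  qed
  ultimately show ?thesis by (auto simp: wd_iff intro: loc_int_add)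
qed

lemma wd_subset: assumes "wd f g I" "J \<subseteq> I" shows "wd f g J"
  using wd_mult_C1[OF assms(1), where \<eta> = "\<lambda>_. 1" and \<eta>' = "\<lambda>_. 0" and S = UNIV and J = J] assms(2) by auto

text \<open>A test function vanishes outside some [-B, B], so the integral of its derivative over
  [-B-1, B+1] is a difference of two zero boundary values.\<close>

lemma wd_const: "wd (\<lambda>_. c) (\<lambda>_. 0) I"
  unfolding wd_iff
proof (intro conjI ballI loc_int_continuous continuous_on_const)
  fix \<phi> assume p: "\<phi> \<in> C1c I"
  obtain K where K: "compact K" "K \<subseteq> I" "\<And>t. t \<notin> K \<Longrightarrow> \<phi> t = 0" "\<And>t. t \<notin> K \<Longrightarrow> deriv \<phi> t = 0"
    "\<And>t. (\<phi> has_real_derivative deriv \<phi> t) (at t)" "continuous_on UNIV \<phi>" "continuous_on UNIV (deriv \<phi>)"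
    using C1cE[OF p] by metis
  obtain B where B: "\<And>t. t \<in> K \<Longrightarrow> \<bar>t\<bar> \<le> B" "B > 0"
    using compact_imp_bounded[OF K(1)] unfolding bounded_pos by auto
  have "(\<integral>t. indicator I t * (c * deriv \<phi> t) \<partial>lborel) = (\<integral>t. c * (deriv \<phi> t * indicator {-B-1..B+1} t) \<partial>lborel)"
  proof (rule Bochner_Integration.integral_cong)
    fix t show "indicator I t * (c * deriv \<phi> t) = c * (deriv \<phi> t * indicator {-B-1..B+1} t)"
      using B(1)[of t] K(2,4) by (cases "t \<in> K") (auto simp: indicator_def)
  qed simp
  also have "\<dots> = c * (\<integral>t. deriv \<phi> t * indicator {-B-1..B+1} t \<partial>lborel)" by simp
  also have "(\<integral>t. deriv \<phi> t * indicator {-B-1..B+1} t \<partial>lborel) = \<phi> (B+1) - \<phi> (-B-1)"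
    by (rule integral_FTC_Icc_real)
      (use B K in \<open>auto intro: continuous_on_interior[of UNIV]\<close>)
  also have "\<phi> (B+1) = 0" using K(3)[of "B+1"] B(1)[of "B+1"] B(2) by linarith
  also have "\<phi> (-B-1) = 0" using K(3)[of "-B-1"] B(1)[of "-B-1"] B(2) by linarith
  finally show "(\<integral>t. indicator I t * (c * deriv \<phi> t) \<partial>lborel) = - (\<integral>t. indicator I t * (0 * \<phi> t) \<partial>lborel)"
    by simp
qed

lemma wd_C1:
  assumes "\<And>t. (\<eta> has_real_derivative \<eta>' t) (at t)" "continuous_on UNIV \<eta>'"
  shows "wd \<eta> \<eta>' I"
  using wd_mult_C1[OF wd_const[where c = 1 and I = I] assms, where S = UNIV and J = I] by auto

text \<open>Translations serve to recentre a profile, reflections to read an edge backwards from its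
  head. The test function is pulled back along the inverse map; as s is 1 or -1, the substitution
  has Jacobian 1 and the chain rule leaves only the sign s.\<close>

lemma wd_affine:
  assumes "wd f g I" and s: "s = 1 \<or> s = -1"
  shows "wd (\<lambda>t. f (c + s * t)) (\<lambda>t. s * g (c + s * t)) {t. c + s * t \<in> I}"
proof -
  let ?T = "\<lambda>t. c + s * t" and ?T' = "\<lambda>x. - (s * c) + s * x"
  let ?J = "{t. c + s * t \<in> I}"
  have ss: "s * s = 1" "s \<noteq> 0" "\<bar>s\<bar> = 1" using s by auto
  have inv: "?T (?T' x) = x" "?T' (?T x) = x" for x
    using s by (auto simp: algebra_simps)
  have L: "locally_integrable_on (\<lambda>t. h (?T t)) ?J" if "locally_integrable_on h I" for h
    unfolding locally_integrable_on_def
  proof (intro allI impI)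
    fix K assume K: "compact K \<and> K \<subseteq> ?J"
    have "compact (?T ` K)" by (intro compact_continuous_image continuous_intros) (use K in auto)
    moreover have "?T ` K \<subseteq> I" using K by auto
    ultimately have "integrable lborel (\<lambda>t. indicator (?T ` K) t * h t)"
      using that by (simp add: locally_integrable_on_def set_integrable_lborel_iff)
    from lborel_integrable_real_affine[OF this, of s c] ss
    have "integrable lborel (\<lambda>x. indicator (?T ` K) (?T x) * h (?T x))" by simp
    moreover have "indicator (?T ` K) (?T x) = (indicator K x :: real)" for x
      using inv(2) by (auto simp: indicator_def image_iff) metis
    ultimately show "set_integrable lborel K (\<lambda>t. h (?T t))" by (simp add: set_integrable_lborel_iff)
  qed
  have "locally_integrable_on f I" "locally_integrable_on g I" using assms by (auto simp: wd_iff)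
  note L' = L[OF this(1)] loc_int_cmult[OF L[OF this(2)], of s]
  moreover have "(\<integral>t. indicator ?J t * (f (?T t) * deriv \<phi> t) \<partial>lborel) = - (\<integral>t. indicator ?J t * (s * g (?T t) * \<phi> t) \<partial>lborel)"
    if p: "\<phi> \<in> C1c ?J" for \<phi>
  proof -
    obtain K where K: "compact K" "K \<subseteq> ?J" "\<And>t. t \<notin> K \<Longrightarrow> \<phi> t = 0" "\<And>t. t \<notin> K \<Longrightarrow> deriv \<phi> t = 0"
      "\<And>t. (\<phi> has_real_derivative deriv \<phi> t) (at t)" "continuous_on UNIV \<phi>" "continuous_on UNIV (deriv \<phi>)"
      using C1cE[OF p] by metis
    have "(\<lambda>x. \<phi> (?T' x)) \<in> C1c I \<and> deriv (\<lambda>x. \<phi> (?T' x)) = (\<lambda>x. s * deriv \<phi> (?T' x))"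
    proof (rule C1cI[of _ _ "?T ` K"])
      show "((\<lambda>x. \<phi> (?T' x)) has_real_derivative s * deriv \<phi> (?T' x)) (at x)" for x
      proof -
        have "(?T' has_real_derivative s) (at x)" by (auto intro!: derivative_eq_intros)
        from DERIV_chain2[where f = \<phi> and g = ?T', OF K(5) this] show ?thesis by (simp add: mult.commute)
      qed
      show "continuous_on UNIV (\<lambda>x. s * deriv \<phi> (?T' x))"
        by (intro continuous_intros continuous_on_compose2[OF K(7)]) auto
      show "compact (?T ` K)" by (intro compact_continuous_image continuous_intros K)
      show "?T ` K \<subseteq> I" using K by auto
      show "\<phi> (?T' t) = 0" if "t \<notin> ?T ` K" for t
        using that inv(1) K(3) by (metis image_eqI)
    qed
    then have e: "(\<integral>t. indicator I t * (f t * (s * deriv \<phi> (?T' t))) \<partial>lborel) = - (\<integral>t. indicator I t * (g t * \<phi> (?T' t)) \<partial>lborel)"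
      using assms(1) by (auto simp: wd_iff)
    have "(\<integral>t. indicator I t * (f t * (s * deriv \<phi> (?T' t))) \<partial>lborel)
      = \<bar>s\<bar> *\<^sub>R (\<integral>t. indicator I (?T t) * (f (?T t) * (s * deriv \<phi> (?T' (?T t)))) \<partial>lborel)"
      by (rule lborel_integral_real_affine[OF ss(2), of _ c])
    moreover have "(\<integral>t. indicator I t * (g t * \<phi> (?T' t)) \<partial>lborel)
      = \<bar>s\<bar> *\<^sub>R (\<integral>t. indicator I (?T t) * (g (?T t) * \<phi> (?T' (?T t))) \<partial>lborel)"
      by (rule lborel_integral_real_affine[OF ss(2), of _ c])
    moreover have "indicator I (?T t) = (indicator ?J t :: real)" for t by (auto simp: indicator_def)
    ultimately have "(\<integral>t. indicator ?J t * (f (?T t) * (s * deriv \<phi> t)) \<partial>lborel) = - (\<integral>t. indicator ?J t * (g (?T t) * \<phi> t) \<partial>lborel)"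
      using e ss unfolding inv(2) by simp
    then show ?thesis using s by (elim disjE) simp_all
  qed
  ultimately show ?thesis by (auto simp: wd_iff)
qed

section \<open>Square-integrable functions\<close>

text \<open>The intervals with rational endpoints inside I, enumerated; all other rational pairs are
  sent to \<open>(1, 0)\<close>, that is, to an empty interval. The countable cover turns facts
  about compact subsets into measurability and almost-everywhere statements on I.\<close>

lemma open_real_UN_intervals:
  fixes I :: "real set"
  assumes "open I"
  obtains a b :: "nat \<Rightarrow> real" where "I = (\<Union>n. {a n..b n})"
proof -
  define c where "c n = (case (from_nat n :: rat \<times> rat) of (x, y) \<Rightarrow>
     if {of_rat x..of_rat y :: real} \<subseteq> I then (of_rat x :: real, of_rat y :: real) else (1, 0))" for n
  have "x \<in> I \<longleftrightarrow> (\<exists>n. fst (c n) \<le> x \<and> x \<le> snd (c n))" for x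
  proof
    assume "x \<in> I"
    then obtain e where e: "e > 0" "\<And>y. \<bar>y - x\<bar> < e \<Longrightarrow> y \<in> I"
      using assms unfolding open_dist dist_real_def by blast
    obtain p where p: "x - e < of_rat p" "of_rat p < x"
      using of_rat_dense[of "x - e" x] e by auto
    obtain q where q: "x < of_rat q" "of_rat q < x + e"
      using of_rat_dense[of x "x + e"] e by auto
    have "{of_rat p..of_rat q} \<subseteq> I" using p q by (auto intro!: e(2))
    then have "c (to_nat (p, q)) = (of_rat p, of_rat q)" by (simp add: c_def)
    then have "fst (c (to_nat (p, q))) \<le> x \<and> x \<le> snd (c (to_nat (p, q)))"
      using less_imp_le[OF p(2)] less_imp_le[OF q(1)] by (simp only: fst_conv snd_conv)
    then show "\<exists>n. fst (c n) \<le> x \<and> x \<le> snd (c n)" by (rule exI)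
  next
    assume "\<exists>n. fst (c n) \<le> x \<and> x \<le> snd (c n)"
    then obtain n where n: "x \<in> {fst (c n)..snd (c n)}" by auto
    obtain p q :: rat where pq: "from_nat n = (p, q)" by (cases "from_nat n :: rat \<times> rat") simp
    show "x \<in> I"
    proof (cases "{of_rat p..of_rat q :: real} \<subseteq> I")
      case True
      then have "c n = (of_rat p, of_rat q)" by (simp add: c_def pq)
      then have "x \<in> {of_rat p..of_rat q}" using n by (simp only: fst_conv snd_conv)
      then show ?thesis by (rule subsetD[OF True])
    next
      case False
      then have "c n = (1, 0)" by (simp add: c_def pq)
      then show ?thesis using n by simp
    qed
  qed
  then have "I = (\<Union>n. {fst (c n)..snd (c n)})" by auto
  then show ?thesis by (rule that)
qed

text \<open>Local integrability speaks of compact sets only, so measurability is glued from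
  countably many intervals. Piece 0 is the complement of I, where the function is 0; piece
  \<open>Suc m\<close> is the interval with index m.\<close>

lemma loc_int_measurable:
  assumes "locally_integrable_on g I" "open I"
  shows "(\<lambda>t. indicator I t * g t) \<in> borel_measurable borel"
proof -
  obtain a b :: "nat \<Rightarrow> real" where I: "I = (\<Union>n. {a n..b n})"
    using open_real_UN_intervals[OF assms(2)] by blast
  define A where "A n = (case n of 0 \<Rightarrow> - I | Suc m \<Rightarrow> {a m..b m})" for n
  show ?thesis
  proof (rule measurable_piecewise_restrict2[of A])
    show "A n \<in> sets borel" for n using assms(2) by (auto simp: A_def split: nat.splits)
    show "space borel = (\<Union>n. A n)"
    proof (safe; simp)
      fix x show "\<exists>n. x \<in> A n"
      proof (cases "x \<in> I")
        case True
        then obtain n where "x \<in> {a n..b n}" using I by blast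
        then show ?thesis by (intro exI[of _ "Suc n"]) (simp add: A_def)
      next
        case False then show ?thesis by (intro exI[of _ 0]) (simp add: A_def)
      qed
    qed
    fix n
    show "\<exists>h\<in>borel_measurable borel. \<forall>x\<in>A n. indicator I x * g x = h x"
    proof (cases n)
      case 0
      then show ?thesis by (intro bexI[of _ "\<lambda>_. 0"]) (auto simp: A_def)
    next
      case (Suc m)
      have "integrable lborel (\<lambda>t. indicator {a m..b m} t * g t)"
        using assms(1) I by (auto simp: locally_integrable_on_def set_integrable_lborel_iff)
      then have "(\<lambda>t. indicator {a m..b m} t * g t) \<in> borel_measurable borel"
        using borel_measurable_integrable by force
      then show ?thesis
        using Suc I by (intro bexI[of _ "\<lambda>t. indicator {a m..b m} t * g t"]) (auto simp: A_def indicator_def)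
    qed
  qed
qed

section \<open>Cauchy--Schwarz, Fatou and completeness of L^2\<close>

lemma CS_integral:
  fixes a b :: "'a \<Rightarrow> real"
  assumes [measurable]: "a \<in> borel_measurable M" "b \<in> borel_measurable M"
    and ia: "integrable M (\<lambda>x. (a x)\<^sup>2)" and ib: "integrable M (\<lambda>x. (b x)\<^sup>2)"
  shows "integrable M (\<lambda>x. a x * b x)"
    and "(\<integral>x. a x * b x \<partial>M)\<^sup>2 \<le> (\<integral>x. (a x)\<^sup>2 \<partial>M) * (\<integral>x. (b x)\<^sup>2 \<partial>M)"
proof -
  have bd: "\<bar>a x * b x\<bar> \<le> (a x)\<^sup>2 + (b x)\<^sup>2" for x
  proof -
    have "0 \<le> (\<bar>a x\<bar> - \<bar>b x\<bar>)\<^sup>2" by simp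
    then have "2 * \<bar>a x * b x\<bar> \<le> (a x)\<^sup>2 + (b x)\<^sup>2" by (simp add: power2_diff abs_mult)
    then show ?thesis by linarith
  qed
  show iab: "integrable M (\<lambda>x. a x * b x)"
    by (rule Bochner_Integration.integrable_bound[OF Bochner_Integration.integrable_add[OF ia ib]])
      (use bd in auto)
  let ?A = "\<integral>x. (a x)\<^sup>2 \<partial>M" and ?B = "\<integral>x. a x * b x \<partial>M" and ?C = "\<integral>x. (b x)\<^sup>2 \<partial>M"
  \<comment> \<open>This is the squared L^2 norm of t a + b. Its minimum over t gives the claim; if
    \<open>?A\<close> is 0 it is affine in t, and a nonzero slope would allow the value -1.\<close>
  have q: "0 \<le> ?A * t\<^sup>2 + 2 * ?B * t + ?C" for t
  proof -
    have "0 \<le> (\<integral>x. (a x * t + b x)\<^sup>2 \<partial>M)" by simp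
    also have "(\<lambda>x. (a x * t + b x)\<^sup>2) = (\<lambda>x. ((a x)\<^sup>2 * t\<^sup>2 + a x * b x * (2 * t)) + (b x)\<^sup>2)"
      by (auto simp: power2_eq_square algebra_simps)
    also have "(\<integral>x. ((a x)\<^sup>2 * t\<^sup>2 + a x * b x * (2 * t)) + (b x)\<^sup>2 \<partial>M) = ?A * t\<^sup>2 + ?B * (2 * t) + ?C"
      using ia ib iab by simp
    finally show ?thesis by (simp add: algebra_simps)
  qed
  show "?B\<^sup>2 \<le> ?A * ?C"
  proof (cases "?A = 0")
    case True
    have "?B = 0"
    proof (rule ccontr)
      assume "?B \<noteq> 0"
      then have "?A * ((- ?C - 1) / (2 * ?B))\<^sup>2 + 2 * ?B * ((- ?C - 1) / (2 * ?B)) + ?C = -1"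
        using True by (simp add: field_simps)
      then show False using q[of "(- ?C - 1) / (2 * ?B)"] by linarith
    qed
    then show ?thesis using True by simp
  next
    case False
    then have "?A > 0" using integral_nonneg_AE[of "\<lambda>x. (a x)\<^sup>2" M] by (simp add: less_le)
    moreover from this have "?A * (- ?B / ?A)\<^sup>2 + 2 * ?B * (- ?B / ?A) + ?C = ?C - ?B\<^sup>2 / ?A"
      by (simp add: power2_eq_square field_simps)
    ultimately have "0 \<le> ?C - ?B\<^sup>2 / ?A" using q[of "- ?B / ?A"] by linarith
    then have "?B\<^sup>2 / ?A \<le> ?C" by simp
    then show ?thesis using \<open>?A > 0\<close> by (simp add: pos_divide_le_eq mult.commute)
  qed
qed

text \<open>Fatou's lemma is applied to extended nonnegative integrals, where integrability of the
  limit need not be known beforehand but comes out together with the bound. The bound on the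
  sequence is asked for only eventually, to suit subsequences.\<close>

lemma fatou_sq:
  fixes h :: "nat \<Rightarrow> 'a \<Rightarrow> real"
  assumes [measurable]: "\<And>k. h k \<in> borel_measurable M" "F \<in> borel_measurable M"
    and i: "\<And>k. integrable M (\<lambda>x. (h k x)\<^sup>2)"
    and b: "\<forall>\<^sub>F k in sequentially. (\<integral>x. (h k x)\<^sup>2 \<partial>M) \<le> B"
    and l: "AE x in M. (\<lambda>k. h k x) \<longlonglongrightarrow> F x"
  shows "integrable M (\<lambda>x. (F x)\<^sup>2)" "(\<integral>x. (F x)\<^sup>2 \<partial>M) \<le> B"
proof -
  obtain k where "(\<integral>x. (h k x)\<^sup>2 \<partial>M) \<le> B"
    using b eventually_happens trivial_limit_sequentially by blast
  moreover have "0 \<le> (\<integral>x. (h k x)\<^sup>2 \<partial>M)" by simp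
  ultimately have B: "0 \<le> B" by linarith
  have "(\<integral>\<^sup>+x. ennreal ((F x)\<^sup>2) \<partial>M) = (\<integral>\<^sup>+x. liminf (\<lambda>k. ennreal ((h k x)\<^sup>2)) \<partial>M)"
  proof (rule nn_integral_cong_AE, use l in eventually_elim)
    fix x assume "(\<lambda>k. h k x) \<longlonglongrightarrow> F x"
    then have "(\<lambda>k. ennreal ((h k x)\<^sup>2)) \<longlonglongrightarrow> ennreal ((F x)\<^sup>2)"
      by (intro tendsto_ennrealI tendsto_intros)
    then show "ennreal ((F x)\<^sup>2) = liminf (\<lambda>k. ennreal ((h k x)\<^sup>2))"
      by (rule lim_imp_Liminf[OF trivial_limit_sequentially, symmetric])
  qed
  also have "\<dots> \<le> liminf (\<lambda>k. \<integral>\<^sup>+x. ennreal ((h k x)\<^sup>2) \<partial>M)"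
    by (rule nn_integral_liminf) measurable
  also have "\<dots> \<le> limsup (\<lambda>k. \<integral>\<^sup>+x. ennreal ((h k x)\<^sup>2) \<partial>M)"
    by (rule Liminf_le_Limsup) simp
  also have "\<dots> \<le> ennreal B"
  proof (rule Limsup_bounded)
    show "\<forall>\<^sub>F k in sequentially. (\<integral>\<^sup>+x. ennreal ((h k x)\<^sup>2) \<partial>M) \<le> ennreal B"
      using b by eventually_elim (simp add: nn_integral_eq_integral[OF i] ennreal_leI)
  qed
  finally have *: "(\<integral>\<^sup>+x. ennreal ((F x)\<^sup>2) \<partial>M) \<le> ennreal B" .
  show int: "integrable M (\<lambda>x. (F x)\<^sup>2)"
  proof (rule integrableI_bounded)
    have "(\<integral>\<^sup>+x. ennreal (norm ((F x)\<^sup>2)) \<partial>M) \<le> ennreal B" using * by simp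
    also have "\<dots> < \<infinity>" by simp
    finally show "(\<integral>\<^sup>+x. ennreal (norm ((F x)\<^sup>2)) \<partial>M) < \<infinity>" .
  qed measurable
  show "(\<integral>x. (F x)\<^sup>2 \<partial>M) \<le> B"
    using * B by (simp add: nn_integral_eq_integral[OF int])
qed

lemma sq_int_add:
  fixes f g :: "'a \<Rightarrow> real"
  assumes [measurable]: "f \<in> borel_measurable M" "g \<in> borel_measurable M"
    and "integrable M (\<lambda>x. (f x)\<^sup>2)" "integrable M (\<lambda>x. (g x)\<^sup>2)"
  shows "integrable M (\<lambda>x. (f x + g x)\<^sup>2)"
proof -
  have "integrable M (\<lambda>x. (f x)\<^sup>2 + 2 * (f x * g x) + (g x)\<^sup>2)"
    using assms CS_integral(1)[OF assms] by auto
  then show ?thesis by (simp add: power2_sum algebra_simps)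
qed

lemma sq_int_diff:
  fixes f g :: "'a \<Rightarrow> real"
  assumes "f \<in> borel_measurable M" "g \<in> borel_measurable M"
    and "integrable M (\<lambda>x. (f x)\<^sup>2)" "integrable M (\<lambda>x. (g x)\<^sup>2)"
  shows "integrable M (\<lambda>x. (f x - g x)\<^sup>2)"
  using sq_int_add[of f M "\<lambda>x. - g x"] assms by simp

text \<open>A weight in $L^1 \cap L^2$ turns $L^2$-Cauchy sequences into $L^1$-Cauchy ones.\<close>

lemma L2_complete:
  fixes f :: "nat \<Rightarrow> real \<Rightarrow> real"
  assumes m[measurable]: "\<And>n. f n \<in> borel_measurable lborel"
    and i: "\<And>n. integrable lborel (\<lambda>x. (f n x)\<^sup>2)"
    and c: "\<And>\<epsilon>. \<epsilon> > 0 \<Longrightarrow> \<exists>N. \<forall>m\<ge>N. \<forall>n\<ge>N. (\<integral>x. (f m x - f n x)\<^sup>2 \<partial>lborel) \<le> \<epsilon>"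
  obtains F where "F \<in> borel_measurable lborel" "integrable lborel (\<lambda>x. (F x)\<^sup>2)"
    "\<And>n. integrable lborel (\<lambda>x. (f n x - F x)\<^sup>2)"
    "(\<lambda>n. \<integral>x. (f n x - F x)\<^sup>2 \<partial>lborel) \<longlonglongrightarrow> 0"
proof -
  \<comment> \<open>Integrable, at most 1 (hence also square-integrable) and nowhere 0, so that it
    can be divided out again after the passage to an almost everywhere Cauchy subsequence.\<close>
  define w :: "real \<Rightarrow> real" where "w x = inverse (1 + x\<^sup>2)" for x
  have [measurable]: "w \<in> borel_measurable lborel" unfolding w_def by measurable
  have w0: "0 \<le> w x" "w x \<le> 1" "w x \<noteq> 0" for x
  proof -
    have "1 \<le> 1 + x\<^sup>2" by simp
    then show "0 \<le> w x" "w x \<le> 1" "w x \<noteq> 0"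
      unfolding w_def by (auto simp: inverse_le_1_iff intro: add_nonneg_nonneg) (metis add_pos_nonneg less_irrefl zero_le_power2 zero_less_one)
  qed
  have wi: "integrable lborel w"
    using integrable_inverse_1_plus_square by (simp add: set_integrable_def w_def[abs_def])
  have w2: "integrable lborel (\<lambda>x. (w x)\<^sup>2)"
    by (rule Bochner_Integration.integrable_bound[OF wi])
      (use w0 in \<open>auto simp: power2_eq_square intro!: mult_left_le_one_le\<close>)
  have di: "integrable lborel (\<lambda>x. (f m x - f n x)\<^sup>2)" for m n
    by (rule sq_int_diff[OF m m i i])
  define W where "W = (\<integral>x. (w x)\<^sup>2 \<partial>lborel)"
  have W0: "0 \<le> W" unfolding W_def by simp
  obtain r where r: "strict_mono r" "AE x in lborel. Cauchy (\<lambda>k. f (r k) x * w x)"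
  proof (rule cauchy_L1_AE_cauchy_subseq[of lborel "\<lambda>n x. f n x * w x"])
    show "integrable lborel (\<lambda>x. f n x * w x)" for n by (rule CS_integral(1)) (use i w2 in auto)
    fix e :: real assume e: "e > 0"
    \<comment> \<open>Chosen so that \<epsilon> W < e^2, which is what Cauchy--Schwarz against w
      requires.\<close>
    define \<epsilon> where "\<epsilon> = e\<^sup>2 / (2 * (W + 1))"
    have "\<epsilon> > 0" using e W0 by (simp add: \<epsilon>_def)
    from c[OF this] obtain N where N: "\<And>m n. m \<ge> N \<Longrightarrow> n \<ge> N \<Longrightarrow> (\<integral>x. (f m x - f n x)\<^sup>2 \<partial>lborel) \<le> \<epsilon>" by blast
    have "(\<integral>x. norm (f m x * w x - f n x * w x) \<partial>lborel) < e" if "m \<ge> N" "n \<ge> N" for m n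
    proof -
      have "(\<integral>x. \<bar>f m x - f n x\<bar> * w x \<partial>lborel)\<^sup>2 \<le> (\<integral>x. \<bar>f m x - f n x\<bar>\<^sup>2 \<partial>lborel) * W"
        unfolding W_def by (rule CS_integral(2)) (use di w2 in auto)
      also have "\<dots> \<le> \<epsilon> * W" using N[OF that] W0 by (intro mult_right_mono) auto
      also have "\<epsilon> * W = e\<^sup>2 * (W / (2 * (W + 1)))" by (simp add: \<epsilon>_def)
      also have "\<dots> < e\<^sup>2 * 1" using e W0 by (intro mult_strict_left_mono) (auto simp: field_simps)
      finally have "(\<integral>x. \<bar>f m x - f n x\<bar> * w x \<partial>lborel) < e"
        using e power2_less_imp_less by (metis less_eq_real_def mult.right_neutral)
      moreover have "norm (f m x * w x - f n x * w x) = \<bar>f m x - f n x\<bar> * w x" for x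
        using w0(1)[of x] by (simp add: left_diff_distrib[symmetric] abs_mult)
      ultimately show ?thesis by simp
    qed
    then show "\<exists>N. \<forall>m\<ge>N. \<forall>n\<ge>N. (\<integral>x. norm (f m x * w x - f n x * w x) \<partial>lborel) < e" by blast
  qed auto
  define F where "F x = lim (\<lambda>k. f (r k) x)" for x
  have [measurable]: "F \<in> borel_measurable lborel" unfolding F_def by measurable
  have lF: "AE x in lborel. (\<lambda>k. f (r k) x) \<longlonglongrightarrow> F x"
    using r(2)
  proof eventually_elim
    fix x assume "Cauchy (\<lambda>k. f (r k) x * w x)"
    then have "convergent (\<lambda>k. f (r k) x * w x)" by (simp add: Cauchy_convergent)
    then obtain y where "(\<lambda>k. f (r k) x * w x) \<longlonglongrightarrow> y" by (auto simp: convergent_def)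
    from tendsto_divide[OF this tendsto_const w0(3)[of x]]
    have "(\<lambda>k. f (r k) x) \<longlonglongrightarrow> y / w x" using w0(3)[of x] by simp
    then show "(\<lambda>k. f (r k) x) \<longlonglongrightarrow> F x" unfolding F_def by (simp add: limI)
  qed
  \<comment> \<open>With n fixed, the other index runs along the almost everywhere convergent
    subsequence; Fatou then carries the Cauchy bound over to the distance from F. This controls the
    full sequence, not only the subsequence.\<close>
  have key: "\<exists>N. \<forall>n\<ge>N. integrable lborel (\<lambda>x. (f n x - F x)\<^sup>2) \<and> (\<integral>x. (f n x - F x)\<^sup>2 \<partial>lborel) \<le> \<epsilon>" if \<epsilon>: "\<epsilon> > 0" for \<epsilon>
  proof -
    from c[OF \<epsilon>] obtain N where N: "\<And>m n. m \<ge> N \<Longrightarrow> n \<ge> N \<Longrightarrow> (\<integral>x. (f m x - f n x)\<^sup>2 \<partial>lborel) \<le> \<epsilon>" by blast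
    have "integrable lborel (\<lambda>x. (f n x - F x)\<^sup>2) \<and> (\<integral>x. (f n x - F x)\<^sup>2 \<partial>lborel) \<le> \<epsilon>" if n: "n \<ge> N" for n
    proof (rule conjI; rule fatou_sq[of "\<lambda>k x. f n x - f (r k) x" lborel _ \<epsilon>])
      show "AE x in lborel. (\<lambda>k. f n x - f (r k) x) \<longlonglongrightarrow> f n x - F x"
        using lF by eventually_elim (intro tendsto_intros)
      show "\<forall>\<^sub>F k in sequentially. (\<integral>x. (f n x - f (r k) x)\<^sup>2 \<partial>lborel) \<le> \<epsilon>"
        using eventually_ge_at_top[of N]
        by eventually_elim (use N n seq_suble[OF r(1)] le_trans in blast)
      show "AE x in lborel. (\<lambda>k. f n x - f (r k) x) \<longlonglongrightarrow> f n x - F x"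
        using lF by eventually_elim (intro tendsto_intros)
      show "\<forall>\<^sub>F k in sequentially. (\<integral>x. (f n x - f (r k) x)\<^sup>2 \<partial>lborel) \<le> \<epsilon>"
        using eventually_ge_at_top[of N]
        by eventually_elim (use N n seq_suble[OF r(1)] le_trans in blast)
    qed (auto intro: di)
    then show ?thesis by blast
  qed
  have Fi: "integrable lborel (\<lambda>x. (F x)\<^sup>2)"
  proof -
    obtain n where n: "integrable lborel (\<lambda>x. (f n x - F x)\<^sup>2)" using key[of 1] by auto
    show ?thesis using sq_int_diff[OF m _ i n, of n] by simp
  qed
  show ?thesis
  proof (rule that[of F])
    show "integrable lborel (\<lambda>x. (f n x - F x)\<^sup>2)" for n by (rule sq_int_diff) (use i Fi in auto)
    show "(\<lambda>n. \<integral>x. (f n x - F x)\<^sup>2 \<partial>lborel) \<longlonglongrightarrow> 0"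
    proof (rule LIMSEQ_I)
      fix e :: real assume "e > 0"
      then obtain N where "\<forall>n\<ge>N. (\<integral>x. (f n x - F x)\<^sup>2 \<partial>lborel) \<le> e / 2" using key[of "e/2"] by auto
      then show "\<exists>N. \<forall>n\<ge>N. norm ((\<integral>x. (f n x - F x)\<^sup>2 \<partial>lborel) - 0) < e"
        using \<open>e > 0\<close> by (intro exI[of _ N]) fastforce
    qed
  qed (use Fi in auto)
qed

section \<open>The fundamental theorem of calculus and uniqueness of weak derivatives\<close>

lemma sstep'_int: "integrable lborel sstep'" "(\<integral>s. sstep' s \<partial>lborel) = 1"
proof -
  have e: "sstep' = (\<lambda>s. sstep' s * indicator {0..1} s)"
  proof
    fix s show "sstep' s = sstep' s * indicator {0..1} s"
      using sstep'_le0[of s] sstep'_ge1[of s] by (cases "s < 0"; cases "s > 1") auto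
  qed
  have "(\<integral>s. sstep' s * indicator {0..1} s \<partial>lborel) = sstep 1 - sstep 0"
    by (rule integral_FTC_Icc_real)
      (auto intro: sstep_deriv continuous_on_interior[OF continuous_sstep'[of UNIV]])
  then show "(\<integral>s. sstep' s \<partial>lborel) = 1" using e sstep_le0[of 0] sstep_ge1[of 1] by simp
  have "integrable lborel (\<lambda>s. indicator {0..1} s *\<^sub>R sstep' s)"
    by (rule borel_integrable_compact) (auto intro: continuous_sstep')
  moreover have "(\<lambda>s. indicator {0..1} s *\<^sub>R sstep' s) = sstep'"
    by (subst (2) e) (auto simp: mult.commute)
  ultimately show "integrable lborel sstep'" by simp
qed

text \<open>The rescaled tents form an approximate identity concentrated to the right of x. The
  substitution t = x + s / r moves the scale into the argument of F, and since r is at least R only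
  the values of F on [x, x + 1/R] matter, which gives a dominating function.\<close>

lemma bump_limit:
  fixes F :: "real \<Rightarrow> real"
  assumes F: "continuous_on UNIV F" and r: "\<And>n. r n \<ge> R" "R > 0" "filterlim r at_top sequentially"
  shows "(\<lambda>n. \<integral>t. F t * (r n * sstep' (r n * (t - x))) \<partial>lborel) \<longlonglongrightarrow> F x"
proof -
  have rp: "r n > 0" for n using r(1)[of n] r(2) by linarith
  obtain B where B: "\<And>t. t \<in> {x..x+1/R} \<Longrightarrow> \<bar>F t\<bar> \<le> B"
    using compact_imp_bounded[OF compact_continuous_image[OF continuous_on_subset[OF F], of "{x..x+1/R}"]]
    unfolding bounded_iff ball_simps real_norm_def by blast
  have [measurable]: "F \<in> borel_measurable borel" "sstep' \<in> borel_measurable borel"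
    using F continuous_sstep' by (auto intro: borel_measurable_continuous_onI)
  have eq: "(\<integral>t. F t * (r n * sstep' (r n * (t - x))) \<partial>lborel) = (\<integral>s. F (x + s / r n) * sstep' s \<partial>lborel)" for n
  proof -
    have "(\<integral>t. F t * (r n * sstep' (r n * (t - x))) \<partial>lborel) =
      \<bar>1 / r n\<bar> *\<^sub>R (\<integral>s. F (x + (1 / r n) * s) * (r n * sstep' (r n * (x + (1 / r n) * s - x))) \<partial>lborel)"
      by (rule lborel_integral_real_affine) (use rp[of n] in simp)
    also have "(\<integral>s. F (x + (1 / r n) * s) * (r n * sstep' (r n * (x + (1 / r n) * s - x))) \<partial>lborel)
        = (\<integral>s. r n * (F (x + s / r n) * sstep' s) \<partial>lborel)"
      using rp[of n] by (intro Bochner_Integration.integral_cong) auto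
    also have "\<bar>1 / r n\<bar> *\<^sub>R (\<integral>s. r n * (F (x + s / r n) * sstep' s) \<partial>lborel) = (\<integral>s. F (x + s / r n) * sstep' s \<partial>lborel)"
      using rp[of n] by simp
    finally show ?thesis .
  qed
  have "(\<lambda>n. \<integral>s. F (x + s / r n) * sstep' s \<partial>lborel) \<longlonglongrightarrow> (\<integral>s. F x * sstep' s \<partial>lborel)"
  proof (rule integral_dominated_convergence[where w = "\<lambda>s. B * sstep' s"])
    show "integrable lborel (\<lambda>s. B * sstep' s)" using sstep'_int by simp
    show "AE s in lborel. (\<lambda>n. F (x + s / r n) * sstep' s) \<longlonglongrightarrow> F x * sstep' s"
    proof (rule AE_I2)
      fix s
      have "(\<lambda>n. s / r n) \<longlonglongrightarrow> 0"
        by (rule tendsto_divide_0[OF tendsto_const filterlim_at_top_imp_at_infinity[OF r(3)]])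
      then have "(\<lambda>n. x + s / r n) \<longlonglongrightarrow> x" using tendsto_add[OF tendsto_const[of x]] by fastforce
      moreover have "isCont F x" using F by (simp add: continuous_on_eq_continuous_at)
      ultimately have "(\<lambda>n. F (x + s / r n)) \<longlonglongrightarrow> F x" using isCont_tendsto_compose by blast
      then show "(\<lambda>n. F (x + s / r n) * sstep' s) \<longlonglongrightarrow> F x * sstep' s" by (intro tendsto_intros)
    qed
    show "AE s in lborel. norm (F (x + s / r n) * sstep' s) \<le> B * sstep' s" for n
    proof (rule AE_I2)
      fix s
      show "norm (F (x + s / r n) * sstep' s) \<le> B * sstep' s"
      proof (cases "0 < s \<and> s < 1")
        case True
        then have "s / r n \<le> 1 / R" using r(1)[of n] r(2) by (intro frac_le) auto
        then have "x + s / r n \<in> {x..x+1/R}" using True rp[of n] by auto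
        from mult_right_mono[OF B[OF this] sstep'_nonneg[of s]] show ?thesis
          using sstep'_nonneg[of s] by (simp add: abs_mult)
      next
        case False
        then have "sstep' s = 0" using sstep'_le0 sstep'_ge1 by force
        then show ?thesis by simp
      qed
    qed
  qed measurable
  then show ?thesis using eq sstep'_int by simp
qed

text \<open>The weak identity is tested with a difference of two steep steps at a and b. These tend
  to the indicator of [a, b], while their derivatives act on f like a point mass at a minus one at
  b.\<close>

lemma wd_FTC:
  assumes wd: "wd f g I" and f: "continuous_on I f" and I: "open I" "{a..b} \<subseteq> I" "a < b"
  shows "f b - f a = (\<integral>t. indicator {a..b} t * g t \<partial>lborel)"
proof -
  \<comment> \<open>The steps rise to the right of their base points, so the support of the test
    function sticks out beyond b; c provides the room inside the open set I.\<close>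
  obtain c where c: "c > b" "{a..c} \<subseteq> I"
  proof -
    have "b \<in> I" using I by auto
    then obtain e where e: "e > 0" "\<And>y. \<bar>y - b\<bar> < e \<Longrightarrow> y \<in> I"
      using I(1) unfolding open_dist dist_real_def by blast
    have "{a..b+e/2} \<subseteq> I"
    proof
      fix x assume "x \<in> {a..b+e/2}"
      then show "x \<in> I" using I(2) e(1) e(2)[of x] by (cases "x \<le> b") auto
    qed
    then show ?thesis using that[of "b+e/2"] e by auto
  qed
  define r where "r n = real n + 1 / (c - b)" for n
  have r: "r n \<ge> 1 / (c - b)" "1 / (c - b) > 0" "filterlim r at_top sequentially" for n
  proof -
    show "r n \<ge> 1 / (c - b)" "1 / (c - b) > 0" using c by (auto simp: r_def)
    show "filterlim r at_top sequentially" unfolding r_def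
      by (rule filterlim_at_top_mono[OF filterlim_real_sequentially]) (use c in auto)
  qed
  have rp: "r n > 0" for n using r(1)[of n] r(2) by linarith
  have rc: "r n * (c - b) \<ge> 1" for n using r(1)[of n] c by (simp add: field_simps)
  define \<phi> where "\<phi> n t = sstep (r n * (t - a)) - sstep (r n * (t - b))" for n t
  define \<phi>' where "\<phi>' n t = r n * sstep' (r n * (t - a)) - r n * sstep' (r n * (t - b))" for n t
  \<comment> \<open>Clamping the argument extends f from [a, c] to a continuous function on the
    whole line, as \<open>bump_limit\<close> expects.\<close>
  define F where "F t = f (max a (min c t))" for t
  have F: "continuous_on UNIV F" unfolding F_def
    by (rule continuous_on_compose2[OF continuous_on_subset[OF f c(2)]]) (use I c in \<open>auto intro!: continuous_intros\<close>)
  have z: "\<phi> n t = 0" "\<phi>' n t = 0" if "t \<notin> {a..c}" for n t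
  proof -
    have "\<phi> n t = 0 \<and> \<phi>' n t = 0"
    proof (cases "t < a")
      case True
      then have "r n * (t - a) \<le> 0" "r n * (t - b) \<le> 0"
        using rp[of n] I by (auto simp: mult_le_0_iff)
      then show ?thesis by (simp add: \<phi>_def \<phi>'_def sstep_le0 sstep'_le0)
    next
      case False
      then have "t > c" using that by auto
      then have "r n * (c - b) \<le> r n * (t - b)" "r n * (c - b) \<le> r n * (t - a)"
        using rp[of n] I by (auto intro!: mult_left_mono)
      then have "1 \<le> r n * (t - b)" "1 \<le> r n * (t - a)" using rc[of n] by linarith+
      then show ?thesis by (simp add: \<phi>_def \<phi>'_def sstep_ge1 sstep'_ge1)
    qed
    then show "\<phi> n t = 0" "\<phi>' n t = 0" by auto
  qed
  have C: "\<phi> n \<in> C1c I \<and> deriv (\<phi> n) = \<phi>' n" for n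
  proof (rule C1cI[of _ _ "{a..c}"])
    show "(\<phi> n has_real_derivative \<phi>' n t) (at t)" for t
      unfolding \<phi>_def[abs_def] \<phi>'_def by (auto intro!: derivative_eq_intros)
    show "continuous_on UNIV (\<phi>' n)" unfolding \<phi>'_def[abs_def]
      by (intro continuous_intros continuous_on_compose2[OF continuous_sstep'[of UNIV]]) auto
  qed (use c z in auto)
  have lhs: "(\<integral>t. indicator I t * (f t * deriv (\<phi> n) t) \<partial>lborel) =
     (\<integral>t. F t * (r n * sstep' (r n * (t - a))) \<partial>lborel) - (\<integral>t. F t * (r n * sstep' (r n * (t - b))) \<partial>lborel)" for n
  proof -
    have "(\<integral>t. indicator I t * (f t * deriv (\<phi> n) t) \<partial>lborel) = (\<integral>t. F t * \<phi>' n t \<partial>lborel)"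
    proof (rule Bochner_Integration.integral_cong)
      fix t show "indicator I t * (f t * deriv (\<phi> n) t) = F t * \<phi>' n t"
        using z(2)[of t n] C[of n] c by (cases "t \<in> {a..c}") (auto simp: F_def subset_iff)
    qed simp
    also have "\<dots> = (\<integral>t. F t * (r n * sstep' (r n * (t - a))) - F t * (r n * sstep' (r n * (t - b))) \<partial>lborel)"
      by (simp add: \<phi>'_def algebra_simps)
    also have "\<dots> = (\<integral>t. F t * (r n * sstep' (r n * (t - a))) \<partial>lborel) - (\<integral>t. F t * (r n * sstep' (r n * (t - b))) \<partial>lborel)"
    proof (rule Bochner_Integration.integral_diff)
      have *: "integrable lborel (\<lambda>t. F t * (r n * sstep' (r n * (t - x))))" for x
      proof -
        have "integrable lborel (\<lambda>t. indicator {x..x+1/r n} t *\<^sub>R (F t * (r n * sstep' (r n * (t - x)))))"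
          by (rule borel_integrable_compact)
            (auto intro!: continuous_intros continuous_on_subset[OF F] continuous_on_compose2[OF continuous_sstep'[of UNIV]])
        moreover have "(\<lambda>t. indicator {x..x+1/r n} t *\<^sub>R (F t * (r n * sstep' (r n * (t - x))))) = (\<lambda>t. F t * (r n * sstep' (r n * (t - x))))"
        proof
          fix t
          show "indicator {x..x+1/r n} t *\<^sub>R (F t * (r n * sstep' (r n * (t - x)))) = F t * (r n * sstep' (r n * (t - x)))"
          proof (cases "t < x \<or> t > x + 1 / r n")
            case True
            then have "r n * (t - x) \<le> 0 \<or> 1 \<le> r n * (t - x)"
              using rp[of n] by (auto simp: field_simps)
            then show ?thesis using sstep'_le0[of "r n * (t - x)"] sstep'_ge1[of "r n * (t - x)"] by auto
          next
            case False
            then have "t \<in> {x..x+1/r n}" by simp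
            then show ?thesis by simp
          qed
        qed
        ultimately show ?thesis by simp
      qed
      show "integrable lborel (\<lambda>t. F t * (r n * sstep' (r n * (t - a))))"
        "integrable lborel (\<lambda>t. F t * (r n * sstep' (r n * (t - b))))" by (rule *)+
    qed
    finally show ?thesis .
  qed
  have L: "locally_integrable_on g I" using wd by (auto simp: wd_iff)
  have gi: "integrable lborel (\<lambda>t. indicator {a..c} t * g t)"
    using L c by (simp add: locally_integrable_on_def set_integrable_lborel_iff)
  have gm: "(\<lambda>t. indicator {a..c} t * g t) \<in> borel_measurable borel" using gi by simp
  have cs: "continuous_on UNIV (\<phi> n)" for n
    unfolding \<phi>_def[abs_def] by (intro continuous_intros continuous_on_compose2[OF continuous_sstep[of UNIV]]) auto
  have [measurable]: "\<phi> n \<in> borel_measurable borel" for n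
    using cs by (rule borel_measurable_continuous_onI)
  have \<phi>1: "\<bar>\<phi> n t\<bar> \<le> 1" for n t
    unfolding \<phi>_def using sstep_nonneg[of "r n * (t - a)"] sstep_le_1[of "r n * (t - a)"]
      sstep_nonneg[of "r n * (t - b)"] sstep_le_1[of "r n * (t - b)"] by linarith
  have "(\<lambda>n. \<integral>t. (indicator {a..c} t * g t) * \<phi> n t \<partial>lborel) \<longlonglongrightarrow> (\<integral>t. (indicator {a..c} t * g t) * indicator {a..b} t \<partial>lborel)"
  proof (rule integral_dominated_convergence[where w = "\<lambda>t. norm (indicator {a..c} t * g t)"])
    show "(\<lambda>t. (indicator {a..c} t * g t) * indicator {a..b} t) \<in> borel_measurable lborel"
      "(\<lambda>t. (indicator {a..c} t * g t) * \<phi> n t) \<in> borel_measurable lborel" for n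
      using gm by measurable
    show "AE t in lborel. norm (indicator {a..c} t * g t * \<phi> n t) \<le> norm (indicator {a..c} t * g t)" for n
      by (rule AE_I2) (use \<phi>1[of n] in \<open>auto simp: abs_mult intro!: mult_right_le_one_le\<close>)
    show "AE t in lborel. (\<lambda>n. indicator {a..c} t * g t * \<phi> n t) \<longlonglongrightarrow> indicator {a..c} t * g t * indicator {a..b} t"
      using AE_lborel_singleton[of a] AE_lborel_singleton[of b]
    proof eventually_elim
      fix t assume t: "t \<noteq> a" "t \<noteq> b"
      have ev: "\<forall>\<^sub>F n in sequentially. r n * d \<ge> 1" if "d > 0" for d
        using r(3) that unfolding filterlim_at_top
        by (auto elim!: allE[of _ "1/d"] eventually_mono simp: field_simps)
      have s1: "(\<lambda>n. sstep (r n * d)) \<longlonglongrightarrow> 1" if "d > 0" for d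
        using ev[OF that] by (intro tendsto_eventually) (auto elim: eventually_mono simp: sstep_ge1)
      have s0: "(\<lambda>n. sstep (r n * d)) \<longlonglongrightarrow> 0" if "d < 0" for d
        using rp that by (intro tendsto_eventually always_eventually) (auto intro!: sstep_le0 simp: mult_le_0_iff less_imp_le)
      have "(\<lambda>n. \<phi> n t) \<longlonglongrightarrow> indicator {a..b} t"
      proof -
        consider "t < a" | "a < t" "t < b" | "b < t" using t by linarith
        then show ?thesis
        proof cases
          case 1 then show ?thesis using tendsto_diff[OF s0[of "t - a"] s0[of "t - b"]] I unfolding \<phi>_def by simp
        next
          case 2 then show ?thesis using tendsto_diff[OF s1[of "t - a"] s0[of "t - b"]] I unfolding \<phi>_def by simp
        next
          case 3 then show ?thesis using tendsto_diff[OF s1[of "t - a"] s1[of "t - b"]] I unfolding \<phi>_def by simp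
        qed
      qed
      then show "(\<lambda>n. indicator {a..c} t * g t * \<phi> n t) \<longlonglongrightarrow> indicator {a..c} t * g t * indicator {a..b} t"
        by (intro tendsto_intros)
    qed
  qed (use gi in auto)
  moreover have "(\<lambda>t. (indicator {a..c} t * g t) * indicator {a..b} t) = (\<lambda>t. indicator {a..b} t * g t)"
    using c by (auto simp: indicator_def)
  moreover have "(\<lambda>t. (indicator {a..c} t * g t) * \<phi> n t) = (\<lambda>t. indicator I t * (g t * \<phi> n t))" for n
  proof
    fix t show "indicator {a..c} t * g t * \<phi> n t = indicator I t * (g t * \<phi> n t)"
      using z(1)[of t n] c(2) by (cases "t \<in> {a..c}") (auto simp: subset_iff)
  qed
  ultimately have R: "(\<lambda>n. \<integral>t. indicator I t * (g t * \<phi> n t) \<partial>lborel) \<longlonglongrightarrow> (\<integral>t. indicator {a..b} t * g t \<partial>lborel)"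
    by simp
  have "(\<lambda>n. \<integral>t. indicator I t * (f t * deriv (\<phi> n) t) \<partial>lborel) \<longlonglongrightarrow> F a - F b"
    unfolding lhs by (intro tendsto_diff bump_limit[OF F r])
  moreover have "(\<integral>t. indicator I t * (f t * deriv (\<phi> n) t) \<partial>lborel) = - (\<integral>t. indicator I t * (g t * \<phi> n t) \<partial>lborel)" for n
    using wd C[of n] by (auto simp: wd_iff)
  ultimately have "(\<lambda>n. - (\<integral>t. indicator I t * (g t * \<phi> n t) \<partial>lborel)) \<longlonglongrightarrow> F a - F b" by simp
  from LIMSEQ_unique[OF this tendsto_minus[OF R]]
  show ?thesis using I c by (simp add: F_def)
qed

text \<open>The positive and the negative part of h are densities of finite measures. By hypothesis
  these agree on all half-lines {x<..}, which determine a finite measure, so the densities agree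
  almost everywhere.\<close>

lemma AE_zero_of_integrals:
  fixes h :: "real \<Rightarrow> real"
  assumes h: "integrable lborel h" and z: "\<And>x. (\<integral>t. indicator {x<..} t * h t \<partial>lborel) = 0"
  shows "AE t in lborel. h t = 0"
proof -
  have [measurable]: "h \<in> borel_measurable lborel" using h by simp
  define P where "P t = max 0 (h t)" for t
  define N where "N t = max 0 (- h t)" for t
  have [measurable]: "P \<in> borel_measurable lborel" "N \<in> borel_measurable lborel"
    unfolding P_def N_def by measurable
  have iP: "integrable lborel P" and iN: "integrable lborel N"
    unfolding P_def[abs_def] N_def[abs_def] using h by auto
  have i2: "integrable lborel (\<lambda>t. indicator {x<..} t * u t)" if "integrable lborel u" for u :: "real \<Rightarrow> real" and x
    using integrable_mult_indicator[OF _ that, of "{x<..}"] by simp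
  have em: "emeasure (density lborel (\<lambda>t. ennreal (u t))) {x<..} = ennreal (\<integral>t. indicator {x<..} t * u t \<partial>lborel)"
    if u: "integrable lborel u" "\<And>t. 0 \<le> u t" for u :: "real \<Rightarrow> real" and x
  proof -
    have [measurable]: "u \<in> borel_measurable lborel" using u by simp
    have "emeasure (density lborel (\<lambda>t. ennreal (u t))) {x<..} = (\<integral>\<^sup>+t. ennreal (u t) * indicator {x<..} t \<partial>lborel)"
      by (rule emeasure_density) auto
    also have "\<dots> = (\<integral>\<^sup>+t. ennreal (indicator {x<..} t * u t) \<partial>lborel)"
      by (intro nn_integral_cong) (auto simp: indicator_def)
    also have "\<dots> = ennreal (\<integral>t. indicator {x<..} t * u t \<partial>lborel)"
      by (rule nn_integral_eq_integral[OF i2[OF u(1)]]) (use u in auto)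
    finally show ?thesis .
  qed
  have PN: "(\<integral>t. indicator {x<..} t * P t \<partial>lborel) = (\<integral>t. indicator {x<..} t * N t \<partial>lborel)" for x
  proof -
    have "(\<lambda>t. indicator {x<..} t * h t) = (\<lambda>t. indicator {x<..} t * P t - indicator {x<..} t * N t)"
      by (auto simp: P_def N_def fun_eq_iff max_def)
    then have "0 = (\<integral>t. indicator {x<..} t * P t - indicator {x<..} t * N t \<partial>lborel)" using z[of x] by simp
    then show ?thesis using i2[OF iP, of x] i2[OF iN, of x] by simp
  qed
  have "density lborel (\<lambda>t. ennreal (P t)) = density lborel (\<lambda>t. ennreal (N t))"
  proof (rule measure_eqI_lessThan)
    show "emeasure (density lborel (\<lambda>t. ennreal (P t))) {x<..} < \<infinity>" for x
      by (subst em[OF iP]) (auto simp: P_def)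
    show "emeasure (density lborel (\<lambda>t. ennreal (P t))) {x<..} = emeasure (density lborel (\<lambda>t. ennreal (N t))) {x<..}" for x
      by (subst em[OF iP], simp add: P_def, subst em[OF iN], simp add: N_def) (simp add: PN)
  qed auto
  then have "AE t in lborel. ennreal (P t) = ennreal (N t)"
    by (intro sigma_finite_measure.density_unique[OF lborel.sigma_finite_measure_axioms]) auto
  then show ?thesis
    by eventually_elim (auto simp: P_def N_def max_def split: if_splits)
qed

text \<open>The difference of the two derivatives is a weak derivative of 0, so by
  \<open>wd_FTC\<close> its integral over every compact interval in I vanishes. This is what makes
  the arbitrary choice in \<open>weak_deriv\<close> harmless.\<close>

lemma wd_unique:
  assumes w: "wd f g I" "wd f g' I" and I: "open I"
  shows "AE t in lborel. t \<in> I \<longrightarrow> g t = g' t"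
proof -
  obtain a b :: "nat \<Rightarrow> real" where ab: "I = (\<Union>n. {a n..b n})"
    using open_real_UN_intervals[OF I] by blast
  define d where "d t = g t - g' t" for t
  have wd0: "wd (\<lambda>_. 0) d I" using wd_diff[OF w] by (simp add: d_def[abs_def])
  have L: "locally_integrable_on d I" using wd0 by (simp add: wd_iff)
  have "AE t in lborel. t \<in> {a n..b n} \<longrightarrow> d t = 0" for n
  proof -
    have sub: "{a n..b n} \<subseteq> I" using ab by auto
    have i: "integrable lborel (\<lambda>t. indicator {a n..b n} t * d t)"
      using L sub by (simp add: locally_integrable_on_def set_integrable_lborel_iff)
    have "AE t in lborel. indicator {a n..b n} t * d t = 0"
    proof (rule AE_zero_of_integrals[OF i])
      fix x
      have "AE t in lborel. indicator {x<..} t * (indicator {a n..b n} t * d t) = indicator {max x (a n)..b n} t * d t"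
        using AE_lborel_singleton[of x] by eventually_elim (auto simp: indicator_def)
      moreover have m: "(\<lambda>t. indicator {a n..b n} t * d t) \<in> borel_measurable lborel" using i by simp
      moreover have "(\<lambda>t. indicator {max x (a n)..b n} t * d t) = (\<lambda>t. indicator {max x (a n)..b n} t * (indicator {a n..b n} t * d t))"
        by (auto simp: indicator_def)
      ultimately have "(\<integral>t. indicator {x<..} t * (indicator {a n..b n} t * d t) \<partial>lborel) = (\<integral>t. indicator {max x (a n)..b n} t * d t \<partial>lborel)"
        by (intro Bochner_Integration.integral_cong_AE) (simp_all, measurable)
      also have "\<dots> = 0"
      proof (cases "max x (a n) < b n")
        case True
        then show ?thesis
          using wd_FTC[OF wd0 continuous_on_const I, of "max x (a n)" "b n"] sub by (auto simp: subset_iff)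
      next
        case False
        have "AE t in lborel. indicator {max x (a n)..b n} t * d t = 0"
          using AE_lborel_singleton[of "b n"] by eventually_elim (use False in \<open>auto simp: indicator_def\<close>)
        then show ?thesis by (rule integral_eq_zero_AE)
      qed
      finally show "(\<integral>t. indicator {x<..} t * (indicator {a n..b n} t * d t) \<partial>lborel) = 0" .
    qed
    then show ?thesis by eventually_elim (auto simp: indicator_def)
  qed
  then have "AE t in lborel. \<forall>n. t \<in> {a n..b n} \<longrightarrow> d t = 0" unfolding AE_all_countable by blast
  then show ?thesis by eventually_elim (auto simp: ab d_def)
qed

section \<open>One-dimensional Sobolev functions\<close>

text \<open>The derivative is an explicit argument instead of the chosen \<open>weak_deriv\<close>,
  so that cutting, gluing and reflecting a function come with a formula for the derivative.\<close>

definition sob :: "(real \<Rightarrow> real) \<Rightarrow> (real \<Rightarrow> real) \<Rightarrow> real set \<Rightarrow> bool" where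
  "sob f g I \<longleftrightarrow> wd f g I \<and> integrable lborel (\<lambda>t. indicator I t * (f t)\<^sup>2) \<and> integrable lborel (\<lambda>t. indicator I t * (g t)\<^sup>2)"

definition sq :: "real set \<Rightarrow> (real \<Rightarrow> real) \<Rightarrow> real" where
  "sq I f = (\<integral>t. indicator I t * (f t)\<^sup>2 \<partial>lborel)"

lemma sq_nonneg: "0 \<le> sq I f"
  unfolding sq_def by simp

lemma sobD:
  assumes "sob f g I"
  shows "wd f g I" "integrable lborel (\<lambda>t. indicator I t * (f t)\<^sup>2)" "integrable lborel (\<lambda>t. indicator I t * (g t)\<^sup>2)"
  using assms by (auto simp: sob_def)

lemma sob_measurable:
  assumes "sob f g I" "open I"
  shows "(\<lambda>t. indicator I t * f t) \<in> borel_measurable lborel" "(\<lambda>t. indicator I t * g t) \<in> borel_measurable lborel"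
  using assms loc_int_measurable[OF _ assms(2)] by (auto simp: sob_def wd_iff)

lemma ind_sq: "(indicator I t * f)\<^sup>2 = indicator I t * (f::real)\<^sup>2"
  by (simp add: indicator_def)

lemma sob_int_sq:
  assumes "sob f g I"
  shows "integrable lborel (\<lambda>t. (indicator I t * f t)\<^sup>2)" "integrable lborel (\<lambda>t. (indicator I t * g t)\<^sup>2)"
  using assms by (simp_all add: ind_sq sob_def)

lemma sob_holder_open:
  assumes s: "sob f g I" and I: "open I" "continuous_on I f" "{a..b} \<subseteq> I" "a < b"
  shows "(f b - f a)\<^sup>2 \<le> (b - a) * sq I g"
proof -
  have "(\<integral>t. indicator {a..b} t * g t \<partial>lborel) = (\<integral>t. indicator {a..b} t * (indicator I t * g t) \<partial>lborel)"
    using I by (intro Bochner_Integration.integral_cong) (auto simp: indicator_def)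
  moreover have "(\<integral>t. indicator {a..b} t * (indicator I t * g t) \<partial>lborel)\<^sup>2
    \<le> (\<integral>t. (indicator {a..b} t)\<^sup>2 \<partial>lborel) * (\<integral>t. (indicator I t * g t)\<^sup>2 \<partial>lborel)"
  proof (rule CS_integral(2))
    have "(\<lambda>t. (indicator {a..b} t)\<^sup>2) = (indicator {a..b} :: real \<Rightarrow> real)" by (auto simp: indicator_def)
    then show "integrable lborel (\<lambda>t. (indicator {a..b} t :: real)\<^sup>2)" using I by simp
  qed (use sob_measurable[OF s I(1)] sob_int_sq[OF s] in auto)
  moreover have "(\<integral>t. (indicator {a..b} t)\<^sup>2 \<partial>lborel) = b - a"
  proof -
    have "(\<lambda>t. (indicator {a..b} t)\<^sup>2) = (indicator {a..b} :: real \<Rightarrow> real)" by (auto simp: indicator_def)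
    then show ?thesis using I by simp
  qed
  ultimately show ?thesis
    using wd_FTC[OF sobD(1)[OF s] I(2,1,3,4)] by (simp add: ind_sq sq_def)
qed

text \<open>Inside I this is Cauchy--Schwarz applied to \<open>wd_FTC\<close>. Continuity extends it
  to any set C between I and its closure, in particular to an edge with its endpoints, where the
  vertex values are read off.\<close>

lemma sob_holder:
  assumes s: "sob f g I" and I: "open I" "convex I" "continuous_on C f" "I \<subseteq> C" "C \<subseteq> closure I"
    and ab: "a \<in> C" "b \<in> C"
  shows "(f b - f a)\<^sup>2 \<le> \<bar>b - a\<bar> * sq I g"
proof -
  have op: "(f y - f x)\<^sup>2 \<le> \<bar>y - x\<bar> * sq I g" if "x \<in> I" "y \<in> I" for x y
  proof (cases x y rule: linorder_cases)
    case less
    then have "{x..y} \<subseteq> I"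
      using that I(2) by (metis atLeastAtMost_iff convex_contains_segment closed_segment_eq_real_ivl less_imp_le subset_iff)
    then show ?thesis using sob_holder_open[OF s I(1) continuous_on_subset[OF I(3,4)] _ less] less by simp
  next
    case greater
    then have "{y..x} \<subseteq> I"
      using that I(2) by (metis atLeastAtMost_iff convex_contains_segment closed_segment_eq_real_ivl less_imp_le subset_iff)
    then show ?thesis using sob_holder_open[OF s I(1) continuous_on_subset[OF I(3,4)] _ greater] greater
      by (simp add: power2_commute)
  qed simp
  obtain x where x: "\<And>n::nat. x n \<in> I" "x \<longlonglongrightarrow> a" using ab(1) I(5) by (meson closure_sequential subset_iff)
  obtain y where y: "\<And>n::nat. y n \<in> I" "y \<longlonglongrightarrow> b" using ab(2) I(5) by (meson closure_sequential subset_iff)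
  have "(\<lambda>n. f (x n)) \<longlonglongrightarrow> f a" "(\<lambda>n. f (y n)) \<longlonglongrightarrow> f b"
    using I(3,4) x y ab by (auto simp: continuous_on_sequentially o_def subset_iff)
  note lim = tendsto_power[OF tendsto_diff[OF this(2,1)], of 2]
    tendsto_mult[OF tendsto_rabs[OF tendsto_diff[OF y(2) x(2)]] tendsto_const[of "sq I g"]]
  show ?thesis by (rule LIMSEQ_le[OF lim]) (use op x y in auto)
qed

text \<open>A Gagliardo--Nirenberg bound: near a point where \<open>\<bar>f\<bar>\<close> equals $M$, Hoelder continuity keeps
  \<open>\<bar>f\<bar>\<close> above $M/2$ on an interval of length \<open>min d (M\<^sup>2 / (4 K))\<close>.\<close>

lemma sup_bound:
  assumes hol: "\<And>s t. s \<in> {a..a+d} \<Longrightarrow> t \<in> {a..a+d} \<Longrightarrow> (f t - f s)\<^sup>2 \<le> \<bar>t - s\<bar> * K"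
    and d: "d > 0" "{a<..<a+d} \<subseteq> I" and i: "integrable lborel (\<lambda>t. indicator I t * (f t)\<^sup>2)"
    and x: "x \<in> {a..a+d}" and K: "K \<ge> 0"
  shows "(f x)^4 \<le> 16 * sq I f * K + 16 * (sq I f)\<^sup>2 / d\<^sup>2"
proof (cases "f x = 0")
  case False
  define M2 where "M2 = (f x)\<^sup>2"
  have M2: "M2 > 0" using False by (simp add: M2_def)
  define e where "e = (if 4 * K * d \<le> M2 then d else M2 / (4 * K))"
  have e: "0 < e" "e \<le> d" "K * e \<le> M2 / 4"
  proof -
    show "0 < e" using d M2 K by (auto simp: e_def intro!: divide_pos_pos) (use K in \<open>cases "K = 0"; simp\<close>)
    show "e \<le> d" using K M2 d by (cases "K = 0") (auto simp: e_def field_simps)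
    show "K * e \<le> M2 / 4" using K M2 d by (cases "K = 0") (auto simp: e_def field_simps)
  qed
  \<comment> \<open>The interval [y, y + e] contains x and stays inside [a, a + d]: it ends at x,
    unless that would push it over the left end, in which case it starts at a.\<close>
  define y where "y = max a (x - e)"
  have y: "a \<le> y" "y + e \<le> a + d" "y \<le> x" "x \<le> y + e" using x e by (auto simp: y_def)
  have low: "M2 / 4 \<le> (f t)\<^sup>2" if "t \<in> {y..y+e}" for t
  proof -
    have "(f t - f x)\<^sup>2 \<le> \<bar>t - x\<bar> * K" by (rule hol) (use that x y in auto)
    also have "\<dots> \<le> e * K" using that y K by (intro mult_right_mono) auto
    also have "\<dots> \<le> (\<bar>f x\<bar> / 2)\<^sup>2" using e(3) by (simp add: M2_def power_divide mult.commute)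
    finally have "\<bar>f t - f x\<bar> \<le> \<bar>f x\<bar> / 2" by (simp add: abs_le_square_iff[symmetric])
    then have "\<bar>f x / 2\<bar> \<le> \<bar>f t\<bar>" by linarith
    then have "(f x / 2)\<^sup>2 \<le> (f t)\<^sup>2" by (simp only: abs_le_square_iff)
    then show ?thesis by (simp add: M2_def power_divide)
  qed
  have "e * (M2 / 4) = (\<integral>t. indicator {y<..<y+e} t * (M2 / 4) \<partial>lborel)" using e by simp
  also have "\<dots> \<le> sq I f" unfolding sq_def
  proof (rule Bochner_Integration.integral_mono[OF _ i])
    show "integrable lborel (\<lambda>t. indicator {y<..<y+e} t * (M2 / 4))"
      using e by (intro integrable_mult_left integrable_real_indicator) auto
    show "indicator {y<..<y+e} t * (M2 / 4) \<le> indicator I t * (f t)\<^sup>2" for t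
      using low[of t] d(2) y by (auto simp: indicator_def subset_iff)
  qed
  finally have m: "e * (M2 / 4) \<le> sq I f" .
  have f4: "(f x)^4 = M2\<^sup>2" by (simp add: M2_def)
  show ?thesis
  proof (cases "4 * K * d \<le> M2")
    case True
    then have "M2 \<le> 4 * sq I f / d" using m d by (simp add: e_def field_simps)
    then have "M2\<^sup>2 \<le> (4 * sq I f / d)\<^sup>2" using M2 by (intro power_mono) auto
    also have "\<dots> = 16 * (sq I f)\<^sup>2 / d\<^sup>2" by (simp add: power_divide power_mult_distrib)
    finally show ?thesis using f4 K sq_nonneg[of I f] by (simp add: add_increasing)
  next
    case False
    then have "K > 0" using K M2 by (cases "K = 0") auto
    then have "M2\<^sup>2 \<le> 16 * sq I f * K" using m False by (simp add: e_def field_simps power2_eq_square)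
    then show ?thesis using f4 by (simp add: add_increasing2)
  qed
qed (simp add: sq_nonneg K)

section \<open>Sup and energy bounds on the whole line\<close>

definition h1 :: "(real \<Rightarrow> real) \<Rightarrow> (real \<Rightarrow> real) \<Rightarrow> bool" where
  "h1 f g \<longleftrightarrow> continuous_on UNIV f \<and> sob f g UNIV"

abbreviation mass where "mass \<equiv> sq UNIV"

text \<open>On the line the interval in \<open>sup_bound\<close> may be taken of any length n + 1,
  and the lower-order term tends to 0.\<close>

lemma h1_sup: assumes "h1 f g" shows "(f x)^4 \<le> 16 * mass f * mass g"
proof -
  have s: "sob f g UNIV" "continuous_on UNIV f" using assms by (auto simp: h1_def)
  have "(f x)^4 \<le> 16 * mass f * mass g + 16 * (mass f)\<^sup>2 / (real n + 1)\<^sup>2" for n :: nat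
    by (rule sup_bound[of x])
      (use sob_holder[OF s(1) _ _ s(2)] sobD[OF s(1)] sq_nonneg in auto)
  moreover have "(\<lambda>n. 16 * mass f * mass g + 16 * (mass f)\<^sup>2 / (real n + 1)\<^sup>2) \<longlonglongrightarrow> 16 * mass f * mass g"
  proof -
    have "(\<lambda>n. 1 / (real n + 1)\<^sup>2) \<longlonglongrightarrow> 0" by real_asymp
    from tendsto_add[OF tendsto_const tendsto_mult_right_zero[OF this]]
    show ?thesis by simp
  qed
  ultimately show ?thesis by (intro LIMSEQ_le_const) auto
qed

lemma powr_le_sq: "\<bar>x\<bar> \<le> B \<Longrightarrow> 2 < p \<Longrightarrow> \<bar>x\<bar> powr p \<le> B powr (p - 2) * x\<^sup>2" for x B p :: real
proof (cases "x = 0")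
  case False
  assume a: "\<bar>x\<bar> \<le> B" "2 < p"
  have "\<bar>x\<bar> powr (p - 2 + 2) = \<bar>x\<bar> powr (p - 2) * \<bar>x\<bar> powr 2" by (rule powr_add)
  then have "\<bar>x\<bar> powr p = \<bar>x\<bar> powr (p - 2) * \<bar>x\<bar> powr 2" by (simp del: powr_numeral)
  also have "\<dots> \<le> B powr (p - 2) * \<bar>x\<bar> powr 2"
    using a by (intro mult_right_mono powr_mono2) auto
  finally show ?thesis using False by simp
qed simp

definition ed :: "real \<Rightarrow> real \<Rightarrow> real \<Rightarrow> real" where
  "ed p f g = g\<^sup>2 / 2 - \<bar>f\<bar> powr p / p"

definition en :: "real \<Rightarrow> real set \<Rightarrow> (real \<Rightarrow> real) \<Rightarrow> (real \<Rightarrow> real) \<Rightarrow> real" where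
  "en p I f g = (\<integral>t. indicator I t * ed p (f t) (g t) \<partial>lborel)"

definition pint :: "real \<Rightarrow> real set \<Rightarrow> (real \<Rightarrow> real) \<Rightarrow> real" where
  "pint p I f = (\<integral>t. indicator I t * \<bar>f t\<bar> powr p \<partial>lborel)"

lemma powr_integrable:
  fixes f :: "real \<Rightarrow> real"
  assumes m: "(\<lambda>t. indicator I t * f t) \<in> borel_measurable lborel" and i: "integrable lborel (\<lambda>t. indicator I t * (f t)\<^sup>2)"
    and b: "\<And>t. t \<in> I \<Longrightarrow> \<bar>f t\<bar> \<le> B" and p: "2 < p"
  shows "integrable lborel (\<lambda>t. indicator I t * \<bar>f t\<bar> powr p)" "pint p I f \<le> B powr (p - 2) * sq I f"
proof -
  have e: "indicator I t * \<bar>f t\<bar> powr p = \<bar>indicator I t * f t\<bar> powr p" for t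
    by (simp add: indicator_def)
  have m: "(\<lambda>t. indicator I t * \<bar>f t\<bar> powr p) \<in> borel_measurable lborel"
    unfolding e using m by measurable
  have le: "indicator I t * \<bar>f t\<bar> powr p \<le> B powr (p - 2) * (indicator I t * (f t)\<^sup>2)" for t
    using powr_le_sq[OF b p, of t] by (auto simp: indicator_def)
  have i: "integrable lborel (\<lambda>t. B powr (p - 2) * (indicator I t * (f t)\<^sup>2))" using i by simp
  then show int: "integrable lborel (\<lambda>t. indicator I t * \<bar>f t\<bar> powr p)"
    by (rule Bochner_Integration.integrable_bound[OF _ m])
      (use le in \<open>auto intro!: AE_I2 simp: abs_mult\<close>)
  have "pint p I f \<le> (\<integral>t. B powr (p - 2) * (indicator I t * (f t)\<^sup>2) \<partial>lborel)"
    unfolding pint_def by (rule Bochner_Integration.integral_mono[OF int i le])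
  then show "pint p I f \<le> B powr (p - 2) * sq I f" by (simp add: sq_def)
qed

lemma sob_powr:
  assumes s: "sob f g I" "open I" and b: "\<And>t. t \<in> I \<Longrightarrow> \<bar>f t\<bar> \<le> B" and p: "2 < p"
  shows "integrable lborel (\<lambda>t. indicator I t * \<bar>f t\<bar> powr p)" "pint p I f \<le> B powr (p - 2) * sq I f"
  using powr_integrable[OF sob_measurable(1)[OF s] sobD(2)[OF s(1)] b p] by auto

lemma sob_en:
  assumes s: "sob f g I" "open I" and b: "\<And>t. t \<in> I \<Longrightarrow> \<bar>f t\<bar> \<le> B" and p: "2 < p"
  shows "integrable lborel (\<lambda>t. indicator I t * ed p (f t) (g t))" "en p I f g = sq I g / 2 - pint p I f / p"
proof -
  have e: "(\<lambda>t. indicator I t * ed p (f t) (g t)) = (\<lambda>t. (indicator I t * (g t)\<^sup>2) / 2 - (indicator I t * \<bar>f t\<bar> powr p) / p)"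
    by (auto simp: ed_def algebra_simps)
  show "integrable lborel (\<lambda>t. indicator I t * ed p (f t) (g t))" unfolding e
    using sobD(3)[OF s(1)] sob_powr(1)[OF s b p] by auto
  show "en p I f g = sq I g / 2 - pint p I f / p"
    unfolding en_def e sq_def pint_def
    using sobD(3)[OF s(1)] sob_powr(1)[OF s b p] by (subst Bochner_Integration.integral_diff) auto
qed

lemma pint_nonneg: "0 \<le> pint p I f"
  unfolding pint_def by (rule integral_nonneg_AE) auto

definition h1_bd where "h1_bd f g = (16 * mass f * mass g) powr (1/4)"

lemma h1_bdd: assumes "h1 f g" shows "\<bar>f x\<bar> \<le> h1_bd f g"
proof -
  have "(\<bar>f x\<bar> powr 4) powr (1/4) = \<bar>f x\<bar> powr (4 * (1/4))" by (rule powr_powr)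
  then have "\<bar>f x\<bar> = (\<bar>f x\<bar> powr 4) powr (1/4)" by simp
  also have "\<bar>f x\<bar> powr 4 = (f x)^4" by (cases "f x = 0") (simp_all add: powr_numeral)
  also have "((f x)^4) powr (1/4) \<le> (16 * mass f * mass g) powr (1/4)"
    by (rule powr_mono2) (use h1_sup[OF assms] in auto)
  finally show ?thesis by (simp add: h1_bd_def)
qed

text \<open>With B the sup bound, B^4 = 16 \<open>mass f\<close> \<open>mass g\<close>. Negative
  energy gives \<open>mass g\<close> <= B^(p-2) \<open>mass f\<close>, because 2/p < 1. Inserting
  this leaves B^(6-p) <= 16 (\<open>mass f\<close>)^2, which bounds B since p < 6.\<close>

lemma h1_neg_energy_bound:
  assumes h: "h1 f g" and p: "2 < p" "p < 6" and neg: "en p UNIV f g < 0"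
  shows "\<bar>f x\<bar> \<le> (16 * (mass f)\<^sup>2) powr (1 / (6 - p))"
proof -
  have s: "sob f g UNIV" using h by (simp add: h1_def)
  define B where "B = h1_bd f g"
  have B: "\<bar>f t\<bar> \<le> B" for t using h1_bdd[OF h] by (simp add: B_def)
  show ?thesis
  proof (cases "mass f * mass g = 0")
    case True
    then have "16 * mass f * mass g = 0" by simp
    then have "(f x)^4 \<le> 0" using h1_sup[OF h, of x] by linarith
    then have "f x = 0" by (simp add: zero_le_even_power order_antisym_conv)
    then show ?thesis by simp
  next
    case False
    then have pos: "mass f > 0" "mass g > 0" using sq_nonneg[of UNIV f] sq_nonneg[of UNIV g] by (auto simp: less_le)
    then have Bp: "B > 0" by (simp add: B_def h1_bd_def)
    have B4: "B powr 4 = 16 * mass f * mass g" using pos by (simp add: B_def h1_bd_def powr_powr)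
    have "mass g / 2 < pint p UNIV f / p" using neg sob_en(2)[OF s open_UNIV B p(1)] by simp
    also have "\<dots> \<le> B powr (p - 2) * mass f / p" using sob_powr(2)[OF s open_UNIV B p(1)] p by (intro divide_right_mono) auto
    also have "\<dots> \<le> B powr (p - 2) * mass f / 2" using p pos by (intro divide_left_mono) auto
    finally have "mass g \<le> B powr (p - 2) * mass f" by simp
    then have "B powr 4 \<le> 16 * mass f * (B powr (p - 2) * mass f)"
      unfolding B4 using pos by (intro mult_left_mono) auto
    then have "B powr 4 / B powr (p - 2) \<le> 16 * (mass f)\<^sup>2"
      using Bp by (simp add: divide_le_eq power2_eq_square mult_ac)
    then have "B powr (6 - p) \<le> 16 * (mass f)\<^sup>2" by (simp add: powr_diff[symmetric])
    then have "(B powr (6 - p)) powr (1 / (6 - p)) \<le> (16 * (mass f)\<^sup>2) powr (1 / (6 - p))"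
      using p by (intro powr_mono2) auto
    then have "B \<le> (16 * (mass f)\<^sup>2) powr (1 / (6 - p))" using p Bp by (simp add: powr_powr)
    then show ?thesis using B[of x] by linarith
  qed
qed

text \<open>In the case of negative energy the kinetic term is dropped and the sup bound inserted.
  The bound is superlinear in the mass, so a piece of small mass has nearly nonnegative energy per
  unit mass; this disposes of the far tail of a function.\<close>

lemma h1_energy_lower:
  assumes h: "h1 f g" and p: "2 < p" "p < 6"
  shows "- ((16 * (mass f)\<^sup>2) powr ((p - 2) / (6 - p)) * mass f / p) \<le> en p UNIV f g"
proof (cases "en p UNIV f g < 0")
  case True
  have s: "sob f g UNIV" using h by (simp add: h1_def)
  let ?B = "(16 * (mass f)\<^sup>2) powr (1 / (6 - p))"
  have B: "\<bar>f t\<bar> \<le> ?B" for t by (rule h1_neg_energy_bound[OF h p True])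
  have "pint p UNIV f / p \<le> ?B powr (p - 2) * mass f / p"
    using sob_powr(2)[OF s open_UNIV B p(1)] p by (intro divide_right_mono) auto
  also have "?B powr (p - 2) = (16 * (mass f)\<^sup>2) powr ((p - 2) / (6 - p))" by (simp add: powr_powr)
  finally show ?thesis using sob_en(2)[OF s open_UNIV B p(1)] sq_nonneg[of UNIV g] by linarith
next
  case False
  then have "0 \<le> en p UNIV f g" by simp
  moreover have "0 \<le> (16 * (mass f)\<^sup>2) powr ((p - 2) / (6 - p)) * mass f / p"
    using p sq_nonneg[of UNIV f] by simp
  ultimately show ?thesis by linarith
qed

section \<open>Cutting\<close>

text \<open>The price of a cut at a point of the transition strip: half of the bound 16 / L^2 on the
  squared cutoff derivatives, and the whole potential term of f, since no potential energy of the
  two pieces is credited there.\<close>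

definition cerr :: "real \<Rightarrow> real \<Rightarrow> real \<Rightarrow> real" where
  "cerr p L f = 8 / L\<^sup>2 * f\<^sup>2 + \<bar>f\<bar> powr p / p"

lemma cerr_nonneg: "0 < p \<Longrightarrow> 0 \<le> cerr p L f"
  unfolding cerr_def by (auto intro!: add_nonneg_nonneg)

lemma cut_pointwise:
  assumes "L > 0" "p > 0"
  shows "ed p (chi a L t * f) (chi' a L t * f + chi a L t * g) + ed p (eta a L t * f) (eta' a L t * f + eta a L t * g)
     \<le> ed p f g + indicator {a..<a+L} t * cerr p L f"
proof -
  consider "t < a" | "t \<in> {a..<a+L}" | "t \<ge> a + L" by force
  then show ?thesis
  proof cases
    case 1
    then show ?thesis using cut_low[OF assms(1), of t a] by (simp add: ed_def)
  next
    case 2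
    have "(chi' a L t * f + chi a L t * g)\<^sup>2 + (eta' a L t * f + eta a L t * g)\<^sup>2 \<le> g\<^sup>2 + 16 / L\<^sup>2 * f\<^sup>2"
      unfolding ims_identity using cut_deriv_bound[OF assms(1)] by (intro add_left_mono mult_right_mono) auto
    moreover have "16 / L\<^sup>2 * f\<^sup>2 = 2 * (8 / L\<^sup>2 * f\<^sup>2)" by simp
    ultimately have "(chi' a L t * f + chi a L t * g)\<^sup>2 / 2 + (eta' a L t * f + eta a L t * g)\<^sup>2 / 2 \<le> g\<^sup>2 / 2 + 8 / L\<^sup>2 * f\<^sup>2"
      by linarith
    moreover have "0 \<le> \<bar>chi a L t * f\<bar> powr p / p" "0 \<le> \<bar>eta a L t * f\<bar> powr p / p" using assms by auto
    ultimately have "ed p (chi a L t * f) (chi' a L t * f + chi a L t * g) + ed p (eta a L t * f) (eta' a L t * f + eta a L t * g)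
     \<le> g\<^sup>2 / 2 + 8 / L\<^sup>2 * f\<^sup>2" unfolding ed_def by linarith
    then show ?thesis using 2 by (simp add: ed_def cerr_def)
  next
    case 3
    then show ?thesis using cut_high[OF assms(1), of a t] by (simp add: ed_def)
  qed
qed

text \<open>Both new derivatives are square-integrable at once, since \<open>ims_identity\<close>
  bounds the sum of their squares by g^2 + (16 / L^2) f^2.\<close>

lemma sob_mult_cut:
  assumes s: "sob f g I" "open I" and L: "L > 0"
  shows "sob (\<lambda>t. chi a L t * f t) (\<lambda>t. chi' a L t * f t + chi a L t * g t) I"
    "sob (\<lambda>t. eta a L t * f t) (\<lambda>t. eta' a L t * f t + eta a L t * g t) I"
proof -
  have w: "wd (\<lambda>t. chi a L t * f t) (\<lambda>t. chi' a L t * f t + chi a L t * g t) I"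
    "wd (\<lambda>t. eta a L t * f t) (\<lambda>t. eta' a L t * f t + eta a L t * g t) I"
    by (rule wd_mult_C1[OF sobD(1)[OF s(1)] chi_deriv continuous_chi' closed_UNIV]; simp)
       (rule wd_mult_C1[OF sobD(1)[OF s(1)] eta_deriv continuous_eta' closed_UNIV]; simp)
  have m: "(\<lambda>t. indicator I t * u t) \<in> borel_measurable lborel" if "locally_integrable_on u I" for u
    using loc_int_measurable[OF that s(2)] by simp
  have i: "integrable lborel (\<lambda>t. indicator I t * (u t)\<^sup>2)"
    if "locally_integrable_on u I" "\<And>t. (u t)\<^sup>2 \<le> (g t)\<^sup>2 + c * (f t)\<^sup>2" for u c
  proof (rule Bochner_Integration.integrable_bound)
    show "integrable lborel (\<lambda>t. indicator I t * (g t)\<^sup>2 + c * (indicator I t * (f t)\<^sup>2))"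
      using sobD(2,3)[OF s(1)] by auto
    show "(\<lambda>t. indicator I t * (u t)\<^sup>2) \<in> borel_measurable lborel"
      unfolding ind_sq[symmetric] using m[OF that(1)] by measurable
    show "AE t in lborel. norm (indicator I t * (u t)\<^sup>2) \<le> norm (indicator I t * (g t)\<^sup>2 + c * (indicator I t * (f t)\<^sup>2))"
      using that(2) order_trans[OF that(2) abs_ge_self] by (auto intro!: AE_I2 simp: indicator_def)
  qed
  have b0: "(c * f t)\<^sup>2 \<le> (g t)\<^sup>2 + 1 * (f t)\<^sup>2" if "\<bar>c\<bar> \<le> 1" for c t
  proof -
    have "c\<^sup>2 \<le> 1" using that by (simp add: abs_square_le_1)
    then have "c\<^sup>2 * (f t)\<^sup>2 \<le> 1 * (f t)\<^sup>2" by (intro mult_right_mono) auto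
    then show ?thesis by (simp add: power_mult_distrib add_increasing)
  qed
  have "(chi' a L t * f t + chi a L t * g t)\<^sup>2 + (eta' a L t * f t + eta a L t * g t)\<^sup>2 \<le> (g t)\<^sup>2 + 16 / L\<^sup>2 * (f t)\<^sup>2" for t
    unfolding ims_identity using cut_deriv_bound[OF L] by (intro add_left_mono mult_right_mono) auto
  then have b1: "(chi' a L t * f t + chi a L t * g t)\<^sup>2 \<le> (g t)\<^sup>2 + 16 / L\<^sup>2 * (f t)\<^sup>2"
    "(eta' a L t * f t + eta a L t * g t)\<^sup>2 \<le> (g t)\<^sup>2 + 16 / L\<^sup>2 * (f t)\<^sup>2" for t
    by (smt (verit) zero_le_power2)+
  show "sob (\<lambda>t. chi a L t * f t) (\<lambda>t. chi' a L t * f t + chi a L t * g t) I"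
    using w(1) i[OF _ b0[OF abs_chi_le]] i[OF _ b1(1)] by (auto simp: sob_def wd_iff)
  show "sob (\<lambda>t. eta a L t * f t) (\<lambda>t. eta' a L t * f t + eta a L t * g t) I"
    using w(2) i[OF _ b0[OF abs_eta_le]] i[OF _ b1(2)] by (auto simp: sob_def wd_iff)
qed

lemma sq_cut:
  assumes s: "sob f g I" "open I" and L: "L > 0"
  shows "sq I (\<lambda>t. chi a L t * f t) + sq I (\<lambda>t. eta a L t * f t) = sq I f"
proof -
  note i = sobD(2)[OF sob_mult_cut(1)[OF s L, of a]] sobD(2)[OF sob_mult_cut(2)[OF s L, of a]]
  have "sq I (\<lambda>t. chi a L t * f t) + sq I (\<lambda>t. eta a L t * f t)
     = (\<integral>t. indicator I t * (chi a L t * f t)\<^sup>2 + indicator I t * (eta a L t * f t)\<^sup>2 \<partial>lborel)"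
    unfolding sq_def using i by simp
  also have "\<dots> = sq I f" unfolding sq_def
  proof (intro Bochner_Integration.integral_cong refl)
    fix t
    have "indicator I t * (chi a L t * f t)\<^sup>2 + indicator I t * (eta a L t * f t)\<^sup>2
      = indicator I t * (((chi a L t)\<^sup>2 + (eta a L t)\<^sup>2) * (f t)\<^sup>2)" by (simp add: power_mult_distrib algebra_simps)
    then show "indicator I t * (chi a L t * f t)\<^sup>2 + indicator I t * (eta a L t * f t)\<^sup>2 = indicator I t * (f t)\<^sup>2"
      by (simp add: chi_eta_sq)
  qed
  finally show ?thesis .
qed

definition cint :: "real \<Rightarrow> real \<Rightarrow> (real \<Rightarrow> real) \<Rightarrow> real set \<Rightarrow> real set \<Rightarrow> real" where
  "cint p L f I A = (\<integral>t. indicator I t * (indicator A t * cerr p L (f t)) \<partial>lborel)"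

lemma cerr_integrable:
  assumes s: "sob f g I" "open I" and b: "\<And>t. t \<in> I \<Longrightarrow> \<bar>f t\<bar> \<le> B" and p: "2 < p"
    and A: "A \<in> sets borel"
  shows "integrable lborel (\<lambda>t. indicator I t * (indicator A t * cerr p L (f t)))"
    "cint p L f I UNIV \<le> (8 / L\<^sup>2 + B powr (p - 2) / p) * sq I f"
proof -
  have i: "integrable lborel (\<lambda>t. 8 / L\<^sup>2 * (indicator I t * (f t)\<^sup>2) + (indicator I t * \<bar>f t\<bar> powr p) / p)"
    using sobD(2)[OF s(1)] sob_powr(1)[OF s b p] by auto
  have e: "(\<lambda>t. 8 / L\<^sup>2 * (indicator I t * (f t)\<^sup>2) + (indicator I t * \<bar>f t\<bar> powr p) / p) = (\<lambda>t. indicator I t * cerr p L (f t))"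
    by (auto simp: cerr_def algebra_simps)
  show "integrable lborel (\<lambda>t. indicator I t * (indicator A t * cerr p L (f t)))"
    using integrable_mult_indicator[OF _ i[unfolded e], of A] A by (simp add: mult.left_commute)
  have "cint p L f I UNIV = 8 / L\<^sup>2 * sq I f + pint p I f / p"
    unfolding cint_def using e[symmetric] sobD(2)[OF s(1)] sob_powr(1)[OF s b p]
    by (simp add: sq_def pint_def Bochner_Integration.integral_add)
  also have "\<dots> \<le> 8 / L\<^sup>2 * sq I f + (B powr (p - 2) * sq I f) / p"
    using sob_powr(2)[OF s b p] p by (intro add_left_mono divide_right_mono) auto
  finally show "cint p L f I UNIV \<le> (8 / L\<^sup>2 + B powr (p - 2) / p) * sq I f" by (simp add: algebra_simps)
qed

lemma en_cut:
  assumes s: "sob f g I" "open I" and b: "\<And>t. t \<in> I \<Longrightarrow> \<bar>f t\<bar> \<le> B" and p: "2 < p" and L: "L > 0"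
  shows "en p I (\<lambda>t. chi a L t * f t) (\<lambda>t. chi' a L t * f t + chi a L t * g t)
       + en p I (\<lambda>t. eta a L t * f t) (\<lambda>t. eta' a L t * f t + eta a L t * g t)
       \<le> en p I f g + cint p L f I {a..<a+L}"
proof -
  have bb: "\<bar>c * f t\<bar> \<le> B" if "\<bar>c\<bar> \<le> 1" "t \<in> I" for c t
    using mult_right_mono[OF that(1), of "\<bar>f t\<bar>"] b[OF that(2)] by (simp add: abs_mult)
  note i1 = sob_en(1)[OF sob_mult_cut(1)[OF s L, of a] s(2) bb[OF abs_chi_le] p]
  note i2 = sob_en(1)[OF sob_mult_cut(2)[OF s L, of a] s(2) bb[OF abs_eta_le] p]
  note i3 = sob_en(1)[OF s b p]
  have i4: "integrable lborel (\<lambda>t. indicator I t * (indicator {a..<a+L} t * cerr p L (f t)))"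
    by (rule cerr_integrable(1)[OF s b p]) auto
  have "(\<integral>t. indicator I t * ed p (chi a L t * f t) (chi' a L t * f t + chi a L t * g t)
     + indicator I t * ed p (eta a L t * f t) (eta' a L t * f t + eta a L t * g t) \<partial>lborel)
     \<le> (\<integral>t. indicator I t * ed p (f t) (g t) + indicator I t * (indicator {a..<a+L} t * cerr p L (f t)) \<partial>lborel)"
  proof (rule Bochner_Integration.integral_mono)
    fix t
    show "indicator I t * ed p (chi a L t * f t) (chi' a L t * f t + chi a L t * g t)
     + indicator I t * ed p (eta a L t * f t) (eta' a L t * f t + eta a L t * g t)
     \<le> indicator I t * ed p (f t) (g t) + indicator I t * (indicator {a..<a+L} t * cerr p L (f t))"
      using cut_pointwise[OF L, of p a t "f t" "g t"] p by (cases "t \<in> I") auto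
  qed (use i1 i2 i3 i4 in auto)
  then show ?thesis unfolding en_def cint_def using i1 i2 i3 i4 by (simp add: Bochner_Integration.integral_add)
qed

lemma int_indicator_mult:
  fixes u :: "real \<Rightarrow> real"
  assumes "integrable lborel u" "A \<in> sets borel"
  shows "integrable lborel (\<lambda>t. indicator A t * u t)"
  using integrable_mult_indicator[of A lborel u] assms by simp

lemma cint_sum:
  assumes i: "\<And>A. A \<in> sets borel \<Longrightarrow> integrable lborel (\<lambda>t. indicator I t * (indicator A t * cerr p L (f t)))"
    and L: "L \<ge> 0"
  shows "(\<Sum>n<M. cint p L f I {x + real n * L..<x + real n * L + L}) = cint p L f I {x..<x + real M * L}"
proof (induction M)
  case 0
  then show ?case by (simp add: cint_def)
next
  case (Suc M)
  have "(\<lambda>t. indicator I t * (indicator {x..<x + real (Suc M) * L} t * cerr p L (f t))) =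
    (\<lambda>t. indicator I t * (indicator {x..<x + real M * L} t * cerr p L (f t)) +
        indicator I t * (indicator {x + real M * L..<x + real M * L + L} t * cerr p L (f t)))"
  proof
    fix t
    obtain r where r: "r = real M * L" "0 \<le> r" "real (Suc M) * L = r + L" using L by (simp add: algebra_simps)
    have "indicator {x..<x + real (Suc M) * L} t = indicator {x..<x + real M * L} t + (indicator {x + real M * L..<x + real M * L + L} t :: real)"
      unfolding r(3) r(1)[symmetric] using L r(2) by (auto simp: indicator_def)
    then show "indicator I t * (indicator {x..<x + real (Suc M) * L} t * cerr p L (f t)) =
      indicator I t * (indicator {x..<x + real M * L} t * cerr p L (f t)) +
        indicator I t * (indicator {x + real M * L..<x + real M * L + L} t * cerr p L (f t))"
      by (simp add: algebra_simps)
  qed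
  then have "cint p L f I {x..<x + real (Suc M) * L} = cint p L f I {x..<x + real M * L}
     + cint p L f I {x + real M * L..<x + real M * L + L}"
    unfolding cint_def using i[of "{x..<x + real M * L}"] i[of "{x + real M * L..<x + real M * L + L}"]
    by simp
  then show ?case using Suc.IH by simp
qed

lemma cint_mono_set:
  assumes i: "\<And>A. A \<in> sets borel \<Longrightarrow> integrable lborel (\<lambda>t. indicator I t * (indicator A t * cerr p L (f t)))"
    and A: "A \<in> sets borel" and p: "p > 0"
  shows "cint p L f I A \<le> cint p L f I UNIV" "0 \<le> cint p L f I A"
proof -
  show "cint p L f I A \<le> cint p L f I UNIV"
    unfolding cint_def using i[OF A] i[of UNIV] cerr_nonneg[OF p]
    by (intro Bochner_Integration.integral_mono) (auto simp: indicator_def)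
  show "0 \<le> cint p L f I A" unfolding cint_def
    using cerr_nonneg[OF p] by (intro integral_nonneg_AE AE_I2) auto
qed

lemma sq_mono_set:
  assumes "integrable lborel (\<lambda>t. indicator B t * (f t)\<^sup>2)" "A \<subseteq> B" "A \<in> sets borel"
  shows "sq A f \<le> sq B f"
proof -
  have "integrable lborel (\<lambda>t. indicator A t * (indicator B t * (f t)\<^sup>2))"
    by (rule int_indicator_mult) (use assms in auto)
  moreover have "(\<lambda>t. indicator A t * (indicator B t * (f t)\<^sup>2)) = (\<lambda>t. indicator A t * (f t)\<^sup>2)"
    using assms(2) by (auto simp: indicator_def fun_eq_iff)
  ultimately show ?thesis unfolding sq_def
    using assms by (intro Bochner_Integration.integral_mono) (auto simp: indicator_def)
qed

lemma sq_tail: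
  assumes "integrable lborel (\<lambda>t. (f t)\<^sup>2)" "\<epsilon> > 0"
  shows "\<exists>x. \<forall>y\<ge>x. sq {y..} f \<le> \<epsilon>"
proof -
  have "(\<lambda>n. \<integral>t. indicator {real n..} t * (f t)\<^sup>2 \<partial>lborel) \<longlonglongrightarrow> (\<integral>t. 0 \<partial>(lborel :: real measure))"
  proof (rule integral_dominated_convergence[where w = "\<lambda>t. (f t)\<^sup>2"])
    show "(\<lambda>t. indicator {real n..} t * (f t)\<^sup>2) \<in> borel_measurable lborel" for n
      using int_indicator_mult[OF assms(1), of "{real n..}"] by simp
    show "AE t in lborel. (\<lambda>n. indicator {real n..} t * (f t)\<^sup>2) \<longlonglongrightarrow> 0"
    proof (rule AE_I2, rule tendsto_eventually)
      fix t :: real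
      obtain N :: nat where "t < real N" using reals_Archimedean2 by blast
      then show "\<forall>\<^sub>F n in sequentially. indicator {real n..} t * (f t)\<^sup>2 = 0"
        unfolding eventually_sequentially by (intro exI[of _ N]) (auto simp: indicator_def)
    qed
    show "AE t in lborel. norm (indicator {real n..} t * (f t)\<^sup>2) \<le> (f t)\<^sup>2" for n
      by (intro AE_I2) (auto simp: indicator_def)
  qed (use assms in auto)
  then have "(\<lambda>n. sq {real n..} f) \<longlonglongrightarrow> 0" by (simp add: sq_def)
  then have "\<forall>\<^sub>F n in sequentially. sq {real n..} f < \<epsilon>" using assms(2) by (rule order_tendstoD)
  then obtain n where n: "sq {real n..} f < \<epsilon>" using eventually_happens trivial_limit_sequentially by blast
  have "sq {y..} f \<le> sq {real n..} f" if "y \<ge> real n" for y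
    by (rule sq_mono_set) (use that int_indicator_mult[OF assms(1), of "{real n..}"] in auto)
  then show ?thesis using n by (intro exI[of _ "real n"]) force
qed

section \<open>Decomposition of a function on the line into windows\<close>

lemma h1_sob: "h1 f g \<Longrightarrow> sob f g UNIV"
  by (simp add: h1_def)

lemma h1_cut:
  assumes "h1 f g" "L > 0"
  shows "h1 (\<lambda>t. chi a L t * f t) (\<lambda>t. chi' a L t * f t + chi a L t * g t)"
    "h1 (\<lambda>t. eta a L t * f t) (\<lambda>t. eta' a L t * f t + eta a L t * g t)"
  using sob_mult_cut[OF h1_sob[OF assms(1)] open_UNIV assms(2)] assms(1)
  by (auto simp: h1_def intro!: continuous_intros continuous_chi continuous_eta)

lemma h1_cint_integrable:
  assumes "h1 f g" "2 < p" "A \<in> sets borel"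
  shows "integrable lborel (\<lambda>t. indicator UNIV t * (indicator A t * cerr p L (f t)))"
  by (rule cerr_integrable(1)[OF h1_sob[OF assms(1)] open_UNIV h1_bdd[OF assms(1)] assms(2,3)])

lemma cerr_mono: "\<bar>c\<bar> \<le> 1 \<Longrightarrow> 0 < p \<Longrightarrow> cerr p L (c * f) \<le> cerr p L f"
proof -
  assume c: "\<bar>c\<bar> \<le> 1" and p: "0 < p"
  have cf: "\<bar>c * f\<bar> \<le> \<bar>f\<bar>" using mult_right_mono[OF c, of "\<bar>f\<bar>"] by (simp add: abs_mult)
  have "\<bar>c * f\<bar> powr p \<le> \<bar>f\<bar> powr p" using cf p by (intro powr_mono2) auto
  moreover have "(c * f)\<^sup>2 \<le> f\<^sup>2" using cf by (simp only: abs_le_square_iff)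
  ultimately show ?thesis unfolding cerr_def using p
    by (intro add_mono mult_left_mono divide_right_mono) auto
qed

text \<open>Windows are peeled off from the left at spacing D, each of length D + L at most d. After
  k cuts the remainder has mass at most m1, and \<open>tail\<close> takes over, so finitely many
  cuts suffice although the support may be unbounded.\<close>

lemma window_induct:
  assumes p: "2 < p" and L: "L > 0" and dD: "D \<ge> 0" "D + L \<le> d"
    and win: "\<And>f g x. h1 f g \<Longrightarrow> (\<And>t. t \<notin> {x..x+d} \<Longrightarrow> f t = 0 \<and> g t = 0) \<Longrightarrow> mass f \<le> \<mu> \<Longrightarrow>
        s * mass f \<le> en p UNIV f g"
    and tail: "\<And>f g. h1 f g \<Longrightarrow> mass f \<le> m1 \<Longrightarrow> s * mass f \<le> en p UNIV f g"
  shows "h1 f g \<Longrightarrow> (\<And>t. t < b \<Longrightarrow> f t = 0 \<and> g t = 0) \<Longrightarrow> mass f \<le> \<mu> \<Longrightarrow> sq {b + real k * D..} f \<le> m1 \<Longrightarrow>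
    s * mass f \<le> en p UNIV f g + (\<Sum>i<k. cint p L f UNIV {b + real (Suc i) * D..<b + real (Suc i) * D + L})"
proof (induction k arbitrary: f g b)
  case 0
  have "sq {b..} f = mass f" unfolding sq_def
    by (intro Bochner_Integration.integral_cong refl) (use 0(2) in \<open>force simp: indicator_def\<close>)
  then show ?case using tail[OF 0(1)] 0(4) by simp
next
  case (Suc k)
  let ?a = "b + D"
  define f1 g1 f2 g2 where "f1 = (\<lambda>t. chi ?a L t * f t)" and "g1 = (\<lambda>t. chi' ?a L t * f t + chi ?a L t * g t)"
    and "f2 = (\<lambda>t. eta ?a L t * f t)" and "g2 = (\<lambda>t. eta' ?a L t * f t + eta ?a L t * g t)"
  have h: "h1 f1 g1" "h1 f2 g2" using h1_cut[OF Suc.prems(1) L, of ?a] by (simp_all add: f1_def g1_def f2_def g2_def)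
  have m: "mass f1 + mass f2 = mass f"
    using sq_cut[OF h1_sob[OF Suc.prems(1)] open_UNIV L, of ?a] by (simp add: f1_def f2_def)
  have ml: "mass f1 \<le> \<mu>" "mass f2 \<le> \<mu>" using m Suc.prems(3) sq_nonneg[of UNIV f1] sq_nonneg[of UNIV f2] by linarith+
  \<comment> \<open>The peeled piece lives on [b, b + D + L]: it vanishes left of b because f does,
    and right of the strip because \<open>chi\<close> does.\<close>
  have e1: "s * mass f1 \<le> en p UNIV f1 g1"
  proof (rule win[OF h(1) _ ml(1)])
    fix t assume "t \<notin> {b..b+d}"
    then consider "t < b" | "t \<ge> ?a + L" using dD by force
    then show "f1 t = 0 \<and> g1 t = 0"
      by cases (use Suc.prems(2)[of t] cut_high[OF L, of ?a t] in \<open>auto simp: f1_def g1_def\<close>)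
  qed
  have le1: "\<bar>f2 t\<bar> \<le> \<bar>f t\<bar>" for t
    using mult_right_mono[OF abs_eta_le[of ?a L t], of "\<bar>f t\<bar>"] by (simp add: f2_def abs_mult)
  have "s * mass f2 \<le> en p UNIV f2 g2 + (\<Sum>i<k. cint p L f2 UNIV {?a + real (Suc i) * D..<?a + real (Suc i) * D + L})"
  proof (rule Suc.IH[OF h(2) _ ml(2)])
    show "f2 t = 0 \<and> g2 t = 0" if "t < ?a" for t
      using cut_low[OF L, of t ?a] that by (auto simp: f2_def g2_def)
    have "sq {?a + real k * D..} f2 \<le> sq {?a + real k * D..} f" unfolding sq_def
    proof (rule Bochner_Integration.integral_mono)
      show "integrable lborel (\<lambda>t. indicator {?a + real k * D..} t * (f2 t)\<^sup>2)"
        "integrable lborel (\<lambda>t. indicator {?a + real k * D..} t * (f t)\<^sup>2)"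
        using sobD(2)[OF h1_sob[OF h(2)]] sobD(2)[OF h1_sob[OF Suc.prems(1)]]
        by (auto intro!: int_indicator_mult)
      show "indicator {?a + real k * D..} t * (f2 t)\<^sup>2 \<le> indicator {?a + real k * D..} t * (f t)\<^sup>2" for t
        using le1[of t] by (intro mult_left_mono) (simp_all only: abs_le_square_iff, simp)
    qed
    also have "?a + real k * D = b + real (Suc k) * D" by (simp add: algebra_simps)
    also note Suc.prems(4)
    finally show "sq {?a + real k * D..} f2 \<le> m1" by (simp add: algebra_simps)
  qed
  \<comment> \<open>Multiplying by \<open>eta\<close> only decreases the error density, so the later
    cuts of the remainder may be charged to the original f. This is what lets the errors be summed
    over disjoint strips.\<close>
  moreover have "cint p L f2 UNIV A \<le> cint p L f UNIV A" if "A \<in> sets borel" for A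
    unfolding cint_def
  proof (rule Bochner_Integration.integral_mono)
    show "indicator UNIV t * (indicator A t * cerr p L (f2 t)) \<le> indicator UNIV t * (indicator A t * cerr p L (f t))" for t
      using cerr_mono[OF abs_eta_le[of ?a L t], of p L "f t"] p by (auto simp: f2_def indicator_def)
  qed (use h1_cint_integrable[OF h(2) p that] h1_cint_integrable[OF Suc.prems(1) p that] in auto)
  then have "(\<Sum>i<k. cint p L f2 UNIV {?a + real (Suc i) * D..<?a + real (Suc i) * D + L})
      \<le> (\<Sum>i<k. cint p L f UNIV {?a + real (Suc i) * D..<?a + real (Suc i) * D + L})"
    by (intro sum_mono) auto
  ultimately have e2: "s * mass f2 \<le> en p UNIV f2 g2 + (\<Sum>i<k. cint p L f UNIV {?a + real (Suc i) * D..<?a + real (Suc i) * D + L})"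
    by linarith
  have e: "en p UNIV f1 g1 + en p UNIV f2 g2 \<le> en p UNIV f g + cint p L f UNIV {?a..<?a+L}"
    unfolding f1_def g1_def f2_def g2_def
    by (rule en_cut[OF h1_sob[OF Suc.prems(1)] open_UNIV h1_bdd[OF Suc.prems(1)] p L])
  have "(\<Sum>i<Suc k. cint p L f UNIV {b + real (Suc i) * D..<b + real (Suc i) * D + L}) =
     cint p L f UNIV {?a..<?a+L} + (\<Sum>i<k. cint p L f UNIV {?a + real (Suc i) * D..<?a + real (Suc i) * D + L})"
    unfolding sum.lessThan_Suc_shift by (simp add: algebra_simps)
  moreover have "s * mass f = s * mass f1 + s * mass f2" unfolding m[symmetric] by (simp add: algebra_simps)
  ultimately show ?case using e e1 e2 by linarith
qed

text \<open>Averaging over the $N$ possible offsets of the cut points makes the total cutting error a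
  fraction $1/N$ of the whole.\<close>

lemma windowed_energy:
  assumes p: "2 < p" and L: "L > 0" and N: "N > 0" and d: "(real N + 1) * L \<le> d" and m1: "m1 > 0"
    and win: "\<And>f g x. h1 f g \<Longrightarrow> (\<And>t. t \<notin> {x..x+d} \<Longrightarrow> f t = 0 \<and> g t = 0) \<Longrightarrow> mass f \<le> \<mu> \<Longrightarrow>
        s * mass f \<le> en p UNIV f g"
    and tail: "\<And>f g. h1 f g \<Longrightarrow> mass f \<le> m1 \<Longrightarrow> s * mass f \<le> en p UNIV f g"
    and h: "h1 f g" and z: "\<And>t. t < 0 \<Longrightarrow> f t = 0 \<and> g t = 0" and m: "mass f \<le> \<mu>"
    and B: "\<And>t. \<bar>f t\<bar> \<le> B"
  shows "s * mass f \<le> en p UNIV f g + (8 / L\<^sup>2 + B powr (p - 2) / p) * mass f / real N"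
proof -
  \<comment> \<open>Moving the starting point by one strip width L gives N different families of
    strips with spacing N L, which together tile the line.\<close>
  define D where "D = real N * L"
  have D: "D > 0" using N L by (simp add: D_def)
  obtain x where x: "\<And>y. y \<ge> x \<Longrightarrow> sq {y..} f \<le> m1"
    using sq_tail[of f m1] sobD(2)[OF h1_sob[OF h]] m1 by auto
  \<comment> \<open>Large enough for every offset: the starting points lie at most N L to the left
    of 0, and k steps of length D must still reach past x.\<close>
  obtain k :: nat where k: "(x + real N * L) / D \<le> real k" using real_arch_simple by blast
  then have k: "x \<le> - real N * L + real k * D" using D by (simp add: field_simps)
  define c where "c n = cint p L f UNIV {real n * L..<real n * L + L}" for n
  note ci = h1_cint_integrable[OF h p, where L = L]
  have E: "s * mass f \<le> en p UNIV f g + (\<Sum>i<k. c (Suc i * N - j))" if j: "j < N" for j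
  proof -
    \<comment> \<open>The windows may start at -j L, because f vanishes on the negative
      axis.\<close>
    have "s * mass f \<le> en p UNIV f g + (\<Sum>i<k. cint p L f UNIV {- real j * L + real (Suc i) * D..<- real j * L + real (Suc i) * D + L})"
    proof (rule window_induct[OF p L less_imp_le[OF D] _ win tail h _ m])
      show "D + L \<le> d" using d by (simp add: D_def algebra_simps)
      show "f t = 0 \<and> g t = 0" if "t < - real j * L" for t
        by (rule z) (use that L mult_nonneg_nonneg[of "real j" L] in linarith)
      have "real j * L \<le> real N * L" using j L by (intro mult_right_mono) auto
      then show "sq {- real j * L + real k * D..} f \<le> m1" using k by (intro x) simp
    qed auto
    also have "(\<Sum>i<k. cint p L f UNIV {- real j * L + real (Suc i) * D..<- real j * L + real (Suc i) * D + L})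
      = (\<Sum>i<k. c (Suc i * N - j))"
    proof (intro sum.cong refl)
      fix i
      have "j \<le> Suc i * N" using j by simp
      then have "real (Suc i * N - j) = real (Suc i) * real N - real j" by (simp only: of_nat_diff of_nat_mult)
      then have "- real j * L + real (Suc i) * D = real (Suc i * N - j) * L"
        unfolding D_def by (simp only:) (simp add: algebra_simps)
      then show "cint p L f UNIV {- real j * L + real (Suc i) * D..<- real j * L + real (Suc i) * D + L} = c (Suc i * N - j)"
        by (simp add: c_def)
    qed
    finally show ?thesis .
  qed
  have "(\<Sum>j<N. s * mass f) \<le> (\<Sum>j<N. en p UNIV f g + (\<Sum>i<k. c (Suc i * N - j)))"
    by (intro sum_mono E) auto
  then have S: "real N * (s * mass f) \<le> real N * en p UNIV f g + (\<Sum>j<N. \<Sum>i<k. c (Suc i * N - j))"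
    by (simp add: sum.distrib)
  have "(\<Sum>j<N. \<Sum>i<k. c (Suc i * N - j)) = (\<Sum>i<k. \<Sum>j<N. c (Suc i * N - j))" by (rule sum.swap)
  \<comment> \<open>For fixed i the strip number (i+1) N - j, with j < N, runs through iN+1, ...,
    iN+N. Hence over all i and j each strip from number 1 to kN is charged exactly once.\<close>
  also have "\<dots> = (\<Sum>i<k. \<Sum>j\<in>{i*N..<i*N+N}. c (Suc j))"
  proof (rule sum.cong[OF refl])
    fix i
    have "(\<Sum>j<N. c (Suc i * N - j)) = (\<Sum>j<N. c (Suc (i * N + (N - Suc j))))"
      by (intro sum.cong refl arg_cong[of _ _ c]) auto
    also have "\<dots> = (\<Sum>j<N. c (Suc (i * N + j)))"
      by (rule sum.nat_diff_reindex[where g = "\<lambda>j. c (Suc (i * N + j))"])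
    also have "\<dots> = (\<Sum>j\<in>{0+i*N..<N+i*N}. c (Suc j))"
      by (subst sum.shift_bounds_nat_ivl) (simp add: atLeast0LessThan add.commute)
    finally show "(\<Sum>j<N. c (Suc i * N - j)) = (\<Sum>j\<in>{i*N..<i*N+N}. c (Suc j))" by (simp add: add.commute)
  qed
  also have "\<dots> = (\<Sum>j<k*N. c (Suc j))" by (rule sum.nat_group)
  also have "\<dots> = (\<Sum>n<k*N. cint p L f UNIV {L + real n * L..<L + real n * L + L})"
    by (intro sum.cong refl) (simp add: c_def algebra_simps)
  also have "\<dots> = cint p L f UNIV {L..<L + real (k*N) * L}"
    by (rule cint_sum) (use ci L in auto)
  also have "\<dots> \<le> cint p L f UNIV UNIV"
    by (rule cint_mono_set(1)) (use ci p in auto)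
  also have "\<dots> \<le> (8 / L\<^sup>2 + B powr (p - 2) / p) * mass f"
    by (rule cerr_integrable(2)[OF h1_sob[OF h] open_UNIV B p]) auto
  finally have "real N * (s * mass f) \<le> real N * en p UNIV f g + (8 / L\<^sup>2 + B powr (p - 2) / p) * mass f"
    using S by linarith
  then have "real N * (s * mass f) / real N \<le> (real N * en p UNIV f g + (8 / L\<^sup>2 + B powr (p - 2) / p) * mass f) / real N"
    by (rule divide_right_mono) simp
  then show ?thesis using N by (simp add: add_divide_distrib)
qed

section \<open>Limits in $L^2$\<close>

lemma loc_int_of_sq:
  assumes m: "(\<lambda>t. indicator I t * F t) \<in> borel_measurable lborel" and i: "integrable lborel (\<lambda>t. indicator I t * (F t)\<^sup>2)"
  shows "locally_integrable_on F I"
  unfolding locally_integrable_on_def set_integrable_lborel_iff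
proof (intro allI impI)
  fix K assume K: "compact K \<and> K \<subseteq> I"
  then have [measurable]: "K \<in> sets borel" by (auto intro: borel_compact)
  have "(\<lambda>t. indicator K t * F t) = (\<lambda>t. indicator K t * (indicator I t * F t))" using K by (auto simp: indicator_def fun_eq_iff)
  then have mK: "(\<lambda>t. indicator K t * F t) \<in> borel_measurable lborel" using m by simp
  have "integrable lborel (\<lambda>t. indicator K t *\<^sub>R (1::real))" by (rule borel_integrable_compact) (use K in auto)
  then have "integrable lborel (\<lambda>t. indicator K t + indicator I t * (F t)\<^sup>2)" using i by simp
  then show "integrable lborel (\<lambda>t. indicator K t * F t)"
  proof (rule Bochner_Integration.integrable_bound[OF _ mK], intro AE_I2)
    fix t
    have "0 \<le> (\<bar>F t\<bar> - 1)\<^sup>2" by simp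
    then have "\<bar>F t\<bar> \<le> 1 + (F t)\<^sup>2" unfolding power2_diff using zero_le_power2[of "F t"] by simp
    then show "norm (indicator K t * F t) \<le> norm (indicator K t + indicator I t * (F t)\<^sup>2)"
      using K by (auto simp: indicator_def)
  qed
qed

text \<open>Pairing with a fixed compactly supported continuous function is continuous in L^2, by
  Cauchy--Schwarz.\<close>

lemma L2_test_limit:
  assumes m: "\<And>n. (\<lambda>t. indicator I t * f n t) \<in> borel_measurable lborel" "(\<lambda>t. indicator I t * F t) \<in> borel_measurable lborel"
    and i: "\<And>n. integrable lborel (\<lambda>t. indicator I t * (f n t)\<^sup>2)" "integrable lborel (\<lambda>t. indicator I t * (F t)\<^sup>2)"
    and l: "(\<lambda>n. sq I (\<lambda>t. f n t - F t)) \<longlonglongrightarrow> 0"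
    and h: "continuous_on UNIV h" "compact K" "K \<subseteq> I" "\<And>t. t \<notin> K \<Longrightarrow> h t = 0"
  shows "(\<lambda>n. \<integral>t. indicator I t * (f n t * h t) \<partial>lborel) \<longlonglongrightarrow> (\<integral>t. indicator I t * (F t * h t) \<partial>lborel)"
proof -
  have li: "locally_integrable_on (f n) I" "locally_integrable_on F I" for n
    using loc_int_of_sq m i by auto
  have hm: "h \<in> borel_measurable lborel" using h(1) by (auto intro: borel_measurable_continuous_onI)
  have "integrable lborel (\<lambda>t. indicator K t *\<^sub>R (h t)\<^sup>2)"
    by (rule borel_integrable_compact) (use h in \<open>auto intro!: continuous_intros continuous_on_subset[OF h(1)]\<close>)
  moreover have "(\<lambda>t. indicator K t *\<^sub>R (h t)\<^sup>2) = (\<lambda>t. (h t)\<^sup>2)" using h(4) by (auto simp: indicator_def fun_eq_iff)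
  ultimately have hi: "integrable lborel (\<lambda>t. (h t)\<^sup>2)" by simp
  have dm: "(\<lambda>t. indicator I t * (f n t - F t)) \<in> borel_measurable lborel" for n
    using borel_measurable_diff[OF m(1)[of n] m(2)] by (simp add: algebra_simps)
  have "integrable lborel (\<lambda>t. (indicator I t * f n t - indicator I t * F t)\<^sup>2)" for n
    by (rule sq_int_diff) (use m i in \<open>simp_all add: ind_sq\<close>)
  then have di: "integrable lborel (\<lambda>t. (indicator I t * (f n t - F t))\<^sup>2)" for n by (simp add: right_diff_distrib)
  have b: "((\<integral>t. indicator I t * (f n t * h t) \<partial>lborel) - (\<integral>t. indicator I t * (F t * h t) \<partial>lborel))\<^sup>2
     \<le> sq I (\<lambda>t. f n t - F t) * (\<integral>t. (h t)\<^sup>2 \<partial>lborel)" for n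
  proof -
    have "(\<integral>t. indicator I t * (f n t * h t) \<partial>lborel) - (\<integral>t. indicator I t * (F t * h t) \<partial>lborel)
      = (\<integral>t. indicator I t * (f n t * h t) - indicator I t * (F t * h t) \<partial>lborel)"
      using loc_int_mult[OF li(1) h(2,3,1,4)] loc_int_mult[OF li(2) h(2,3,1,4)] by simp
    also have "\<dots> = (\<integral>t. indicator I t * (f n t - F t) * h t \<partial>lborel)" by (simp add: algebra_simps)
    finally show ?thesis using CS_integral(2)[OF dm[of n] hm di hi] by (simp add: sq_def ind_sq)
  qed
  have "(\<lambda>n. ((\<integral>t. indicator I t * (f n t * h t) \<partial>lborel) - (\<integral>t. indicator I t * (F t * h t) \<partial>lborel))\<^sup>2) \<longlonglongrightarrow> 0"
    by (rule tendsto_sandwich[OF _ _ tendsto_const tendsto_mult_left_zero[OF l]])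
      (use b in \<open>auto intro!: always_eventually\<close>)
  then have "(\<lambda>n. sqrt (((\<integral>t. indicator I t * (f n t * h t) \<partial>lborel) - (\<integral>t. indicator I t * (F t * h t) \<partial>lborel))\<^sup>2)) \<longlonglongrightarrow> sqrt 0"
    by (rule tendsto_real_sqrt)
  then show ?thesis by (simp add: tendsto_rabs_zero_iff LIM_zero_iff)
qed

text \<open>The weak derivative is a closed operator: in the defining identity both sides are
  pairings with a fixed test function, so L^2 convergence of functions and derivatives passes to the
  limit.\<close>

lemma sob_limit:
  assumes s: "\<And>n. sob (f n) (g n) I" and I: "open I"
    and m: "(\<lambda>t. indicator I t * F t) \<in> borel_measurable lborel" "(\<lambda>t. indicator I t * G t) \<in> borel_measurable lborel"
    and i: "integrable lborel (\<lambda>t. indicator I t * (F t)\<^sup>2)" "integrable lborel (\<lambda>t. indicator I t * (G t)\<^sup>2)"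
    and l: "(\<lambda>n. sq I (\<lambda>t. f n t - F t)) \<longlonglongrightarrow> 0" "(\<lambda>n. sq I (\<lambda>t. g n t - G t)) \<longlonglongrightarrow> 0"
  shows "sob F G I"
proof -
  have "(\<integral>t. indicator I t * (F t * deriv \<phi> t) \<partial>lborel) = - (\<integral>t. indicator I t * (G t * \<phi> t) \<partial>lborel)"
    if p: "\<phi> \<in> C1c I" for \<phi>
  proof -
    obtain K where K: "compact K" "K \<subseteq> I" "\<And>t. t \<notin> K \<Longrightarrow> \<phi> t = 0" "\<And>t. t \<notin> K \<Longrightarrow> deriv \<phi> t = 0"
      "\<And>t. (\<phi> has_real_derivative deriv \<phi> t) (at t)" "continuous_on UNIV \<phi>" "continuous_on UNIV (deriv \<phi>)"
      using C1cE[OF p] by metis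
    have a: "(\<lambda>n. \<integral>t. indicator I t * (f n t * deriv \<phi> t) \<partial>lborel) \<longlonglongrightarrow> (\<integral>t. indicator I t * (F t * deriv \<phi> t) \<partial>lborel)"
      by (rule L2_test_limit[OF sob_measurable(1)[OF s I] m(1) sobD(2)[OF s] i(1) l(1) K(7,1,2,4)])
    have b: "(\<lambda>n. \<integral>t. indicator I t * (g n t * \<phi> t) \<partial>lborel) \<longlonglongrightarrow> (\<integral>t. indicator I t * (G t * \<phi> t) \<partial>lborel)"
      by (rule L2_test_limit[OF sob_measurable(2)[OF s I] m(2) sobD(3)[OF s] i(2) l(2) K(6,1,2,3)])
    have "(\<integral>t. indicator I t * (f n t * deriv \<phi> t) \<partial>lborel) = - (\<integral>t. indicator I t * (g n t * \<phi> t) \<partial>lborel)" for n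
      using sobD(1)[OF s[of n]] p by (auto simp: wd_iff)
    then have "(\<lambda>n. - (\<integral>t. indicator I t * (g n t * \<phi> t) \<partial>lborel)) \<longlonglongrightarrow> (\<integral>t. indicator I t * (F t * deriv \<phi> t) \<partial>lborel)"
      using a by simp
    from LIMSEQ_unique[OF this tendsto_minus[OF b]] show ?thesis .
  qed
  then show ?thesis using loc_int_of_sq[OF m(1) i(1)] loc_int_of_sq[OF m(2) i(2)] i by (auto simp: sob_def wd_iff)
qed

text \<open>The integrands u and U are kept abstract, subject only to a local Lipschitz bound, so
  that one Cauchy--Schwarz argument covers the mass, the p-th powers and the kinetic energy.\<close>

lemma L2_functional_limit:
  fixes f :: "nat \<Rightarrow> real \<Rightarrow> real"
  assumes m: "\<And>n. (\<lambda>t. indicator I t * f n t) \<in> borel_measurable lborel" "(\<lambda>t. indicator I t * F t) \<in> borel_measurable lborel"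
    and i: "\<And>n. integrable lborel (\<lambda>t. indicator I t * (f n t)\<^sup>2)" "integrable lborel (\<lambda>t. indicator I t * (F t)\<^sup>2)"
    and l: "(\<lambda>n. sq I (\<lambda>t. f n t - F t)) \<longlonglongrightarrow> 0" and B: "\<And>n. sq I (f n) \<le> B"
    and u: "\<And>n. integrable lborel (\<lambda>t. indicator I t * u n t)" "integrable lborel (\<lambda>t. indicator I t * U t)"
    and C: "\<And>n t. t \<in> I \<Longrightarrow> \<bar>u n t - U t\<bar> \<le> C * ((\<bar>f n t\<bar> + \<bar>F t\<bar>) * \<bar>f n t - F t\<bar>)"
  shows "(\<lambda>n. \<integral>t. indicator I t * u n t \<partial>lborel) \<longlonglongrightarrow> (\<integral>t. indicator I t * U t \<partial>lborel)"
proof -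
  define a where "a n t = \<bar>indicator I t * f n t\<bar> + \<bar>indicator I t * F t\<bar>" for n t
  define b where "b n t = \<bar>indicator I t * f n t - indicator I t * F t\<bar>" for n t
  have am: "a n \<in> borel_measurable lborel" and bm: "b n \<in> borel_measurable lborel" for n
    unfolding a_def[abs_def] b_def[abs_def] using m(1)[of n] m(2) by measurable
  have fi: "integrable lborel (\<lambda>t. (indicator I t * f n t)\<^sup>2)" "integrable lborel (\<lambda>t. (indicator I t * F t)\<^sup>2)" for n
    using i by (simp_all add: ind_sq)
  have ai: "integrable lborel (\<lambda>t. (a n t)\<^sup>2)" for n
    unfolding a_def by (rule sq_int_add) (use m(1)[of n] m(2) fi in auto)
  have bi: "integrable lborel (\<lambda>t. (b n t)\<^sup>2)" for n
    unfolding b_def power2_abs by (rule sq_int_diff) (use m(1)[of n] m(2) fi in auto)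
  have b2: "(\<integral>t. (b n t)\<^sup>2 \<partial>lborel) = sq I (\<lambda>t. f n t - F t)" for n
    by (simp add: b_def sq_def ind_sq right_diff_distrib[symmetric])
  have a2: "(\<integral>t. (a n t)\<^sup>2 \<partial>lborel) \<le> 2 * B + 2 * sq I F" for n
  proof -
    have "(\<integral>t. (a n t)\<^sup>2 \<partial>lborel) \<le> (\<integral>t. 2 * (indicator I t * f n t)\<^sup>2 + 2 * (indicator I t * F t)\<^sup>2 \<partial>lborel)"
    proof (rule Bochner_Integration.integral_mono[OF ai])
      fix t
      have "0 \<le> (\<bar>indicator I t * f n t\<bar> - \<bar>indicator I t * F t\<bar>)\<^sup>2" by simp
      then show "(a n t)\<^sup>2 \<le> 2 * (indicator I t * f n t)\<^sup>2 + 2 * (indicator I t * F t)\<^sup>2"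
        unfolding a_def power2_diff power2_sum power2_abs by linarith
    qed (use fi in auto)
    also have "\<dots> = 2 * sq I (f n) + 2 * sq I F" using fi(1)[of n] fi(2) by (simp add: ind_sq sq_def)
    finally show ?thesis using B[of n] by linarith
  qed
  have A0: "0 \<le> 2 * B + 2 * sq I F" using a2[of 0] integral_nonneg_AE[of "\<lambda>t. (a 0 t)\<^sup>2" lborel]
    by (meson AE_I2 order_trans zero_le_power2)
  let ?\<Delta> = "\<lambda>n. (\<integral>t. indicator I t * u n t \<partial>lborel) - (\<integral>t. indicator I t * U t \<partial>lborel)"
  have b: "(?\<Delta> n)\<^sup>2 \<le> C\<^sup>2 * (2 * B + 2 * sq I F) * sq I (\<lambda>t. f n t - F t)" for n
  proof -
    have "\<bar>?\<Delta> n\<bar> = \<bar>\<integral>t. indicator I t * u n t - indicator I t * U t \<partial>lborel\<bar>" using u by simp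
    also have "\<dots> \<le> (\<integral>t. \<bar>C\<bar> * (a n t * b n t) \<partial>lborel)"
    proof (rule integral_abs_bound_integral)
      show "integrable lborel (\<lambda>t. \<bar>C\<bar> * (a n t * b n t))" using CS_integral(1)[OF am bm ai bi] by simp
      fix t
      have "C * ((\<bar>f n t\<bar> + \<bar>F t\<bar>) * \<bar>f n t - F t\<bar>) \<le> \<bar>C\<bar> * ((\<bar>f n t\<bar> + \<bar>F t\<bar>) * \<bar>f n t - F t\<bar>)"
        by (intro mult_right_mono) auto
      then show "\<bar>indicator I t * u n t - indicator I t * U t\<bar> \<le> \<bar>C\<bar> * (a n t * b n t)"
        using C[of t n] by (auto simp: a_def b_def indicator_def)
    qed (use u in auto)
    also have "\<dots> = \<bar>C\<bar> * (\<integral>t. a n t * b n t \<partial>lborel)" by simp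
    finally have "\<bar>?\<Delta> n\<bar>\<^sup>2 \<le> (\<bar>C\<bar> * (\<integral>t. a n t * b n t \<partial>lborel))\<^sup>2" by (intro power_mono) auto
    also have "\<dots> = C\<^sup>2 * (\<integral>t. a n t * b n t \<partial>lborel)\<^sup>2" by (simp add: power_mult_distrib)
    also have "\<dots> \<le> C\<^sup>2 * ((\<integral>t. (a n t)\<^sup>2 \<partial>lborel) * (\<integral>t. (b n t)\<^sup>2 \<partial>lborel))"
      by (intro mult_left_mono CS_integral(2)[OF am bm ai bi]) auto
    also have "\<dots> \<le> C\<^sup>2 * ((2 * B + 2 * sq I F) * (\<integral>t. (b n t)\<^sup>2 \<partial>lborel))"
      by (intro mult_left_mono mult_right_mono a2) auto
    finally show ?thesis by (simp add: b2 mult.assoc)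
  qed
  have "(\<lambda>n. (?\<Delta> n)\<^sup>2) \<longlonglongrightarrow> 0"
    by (rule tendsto_sandwich[OF _ _ tendsto_const tendsto_mult_right_zero[OF l, of "C\<^sup>2 * (2 * B + 2 * sq I F)"]])
      (use b in \<open>auto intro!: always_eventually\<close>)
  then have "(\<lambda>n. sqrt ((?\<Delta> n)\<^sup>2)) \<longlonglongrightarrow> sqrt 0" by (rule tendsto_real_sqrt)
  then show ?thesis by (simp add: tendsto_rabs_zero_iff LIM_zero_iff)
qed

lemma powr_diff_le:
  fixes a b M p :: real
  assumes "\<bar>a\<bar> \<le> M" "\<bar>b\<bar> \<le> M" "2 < p"
  shows "\<bar>\<bar>a\<bar> powr p - \<bar>b\<bar> powr p\<bar> \<le> p * M powr (p - 2) * ((\<bar>a\<bar> + \<bar>b\<bar>) * \<bar>a - b\<bar>)"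
proof -
  have main: "y powr p - x powr p \<le> p * M powr (p - 2) * ((x + y) * (y - x))" if "0 \<le> x" "x < y" "y \<le> M" for x y
  proof -
    have "\<exists>z>x. z < y \<and> y powr p - x powr p = (y - x) * (p * z powr (p - 1))"
      using that(1)
    proof (cases "x = 0")
      case False
      then show ?thesis using that assms(3)
        by (intro MVT2) (auto intro!: derivative_eq_intros)
    next
      case True
      have yp: "y powr p = y * y powr (p - 1)" using that powr_add[of y 1 "p - 1"] by simp
      \<comment> \<open>At x = 0 the intermediate point of the mean value theorem is explicit: it
        solves p z^(p-1) = y^(p-1), and lies strictly between 0 and y because p > 1.\<close>
      define z where "z = y * (1 / p) powr (1 / (p - 1))"
      have c1: "0 < (1 / p) powr (1 / (p - 1))" using assms(3) by simp
      have c2: "(1 / p) powr (1 / (p - 1)) < 1 powr (1 / (p - 1))" using assms(3) by (intro powr_less_mono2) auto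
      have "z powr (p - 1) = y powr (p - 1) * (1 / p)" unfolding z_def
        using that assms(3) by (subst powr_mult) (auto simp: powr_powr)
      then have "p * z powr (p - 1) = y powr (p - 1)" using assms(3) by simp
      then show ?thesis using c1 c2 that True yp
        by (intro exI[of _ z]) (auto simp: z_def)
    qed
    then obtain z where z: "x < z" "z < y" "y powr p - x powr p = (y - x) * (p * z powr (p - 1))" by blast
    have "z powr (p - 1) = z powr (p - 2) * z powr 1" by (simp only: powr_add[symmetric]) simp
    also have "\<dots> \<le> M powr (p - 2) * (x + y)"
      using z that assms(3) by (intro mult_mono powr_mono2) auto
    finally have "p * z powr (p - 1) \<le> p * (M powr (p - 2) * (x + y))" using assms(3) by (intro mult_left_mono) auto
    then have "(y - x) * (p * z powr (p - 1)) \<le> (y - x) * (p * (M powr (p - 2) * (x + y)))"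
      using that by (intro mult_left_mono[of "p * z powr (p - 1)"]) auto
    then show ?thesis using z(3) by (simp add: algebra_simps)
  qed
  have mono: "x powr p \<le> y powr p" if "0 \<le> x" "x \<le> y" for x y :: real
    using that assms(3) by (intro powr_mono2) auto
  have "\<bar>\<bar>a\<bar> powr p - \<bar>b\<bar> powr p\<bar> \<le> p * M powr (p - 2) * ((\<bar>a\<bar> + \<bar>b\<bar>) * \<bar>\<bar>a\<bar> - \<bar>b\<bar>\<bar>)"
  proof (cases "\<bar>a\<bar>" "\<bar>b\<bar>" rule: linorder_cases)
    case less
    then show ?thesis using main[of "\<bar>a\<bar>" "\<bar>b\<bar>"] mono[of "\<bar>a\<bar>" "\<bar>b\<bar>"] assms by simp
  next
    case greater
    then show ?thesis using main[of "\<bar>b\<bar>" "\<bar>a\<bar>"] mono[of "\<bar>b\<bar>" "\<bar>a\<bar>"] assms by (simp add: add.commute)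
  qed simp
  also have "\<dots> \<le> p * M powr (p - 2) * ((\<bar>a\<bar> + \<bar>b\<bar>) * \<bar>a - b\<bar>)"
    using assms by (intro mult_left_mono) auto
  finally show ?thesis .
qed

text \<open>Below T the set is bounded, because I lies in the positive axis, and dominated
  convergence applies with the constant (2 M)^2. Above T the tails are uniformly small, and F
  inherits the tail bound by Fatou.\<close>

lemma L2_conv_of_pointwise:
  assumes I: "open I" "I \<subseteq> {0<..}"
    and m: "\<And>n. (\<lambda>t. indicator I t * f n t) \<in> borel_measurable lborel"
    and i: "\<And>n. integrable lborel (\<lambda>t. indicator I t * (f n t)\<^sup>2)" and B: "\<And>n. sq I (f n) \<le> B"
    and M: "\<And>n t. t \<in> I \<Longrightarrow> \<bar>f n t\<bar> \<le> M" and l: "\<And>t. t \<in> I \<Longrightarrow> (\<lambda>n. f n t) \<longlonglongrightarrow> F t"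
    and tail: "\<And>\<epsilon>. \<epsilon> > 0 \<Longrightarrow> \<exists>T. \<forall>\<^sub>F n in sequentially. sq (I \<inter> {T..}) (f n) \<le> \<epsilon>"
  shows "(\<lambda>t. indicator I t * F t) \<in> borel_measurable lborel" "integrable lborel (\<lambda>t. indicator I t * (F t)\<^sup>2)"
    "(\<lambda>n. sq I (\<lambda>t. f n t - F t)) \<longlonglongrightarrow> 0"
proof -
  have lI: "(\<lambda>n. indicator I t * f n t) \<longlonglongrightarrow> indicator I t * F t" for t
    using l[of t] by (cases "t \<in> I") auto
  show mF: "(\<lambda>t. indicator I t * F t) \<in> borel_measurable lborel"
    by (rule borel_measurable_LIMSEQ_real[OF lI m])
  have fi: "integrable lborel (\<lambda>t. (indicator I t * f n t)\<^sup>2)" for n using i by (simp add: ind_sq)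
  have iF': "integrable lborel (\<lambda>t. (indicator I t * F t)\<^sup>2)"
    by (rule fatou_sq(1)[where B = B and h = "\<lambda>n t. indicator I t * f n t", OF m mF fi]) (use B lI in \<open>auto simp: ind_sq sq_def\<close>)
  then show iF: "integrable lborel (\<lambda>t. indicator I t * (F t)\<^sup>2)" by (simp add: ind_sq)
  have MF: "\<bar>F t\<bar> \<le> M" if "t \<in> I" for t
    using tendsto_rabs[OF l[OF that]] M[OF that] by (intro LIMSEQ_le_const2) auto
  have di: "integrable lborel (\<lambda>t. indicator I t * (f n t - F t)\<^sup>2)" for n
    using sq_int_diff[OF m[of n] mF fi iF'] by (simp add: ind_sq right_diff_distrib[symmetric])
  have dm: "(\<lambda>t. indicator I t * (f n t - F t)\<^sup>2) \<in> borel_measurable lborel" for n using di by simp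
  have Ib: "I \<in> sets borel" using I(1) by simp
  show "(\<lambda>n. sq I (\<lambda>t. f n t - F t)) \<longlonglongrightarrow> 0"
  proof (rule LIMSEQ_I)
    fix e :: real assume e: "e > 0"
    then have "e / 8 > 0" by simp
    from tail[OF this] obtain T where T: "\<forall>\<^sub>F n in sequentially. sq (I \<inter> {T..}) (f n) \<le> e / 8" by blast
    have eI: "indicator (I \<inter> {T..}) t * x = indicator {T..} t * (indicator I t * x)" for t and x :: real
      by (auto simp: indicator_def)
    have TF: "sq (I \<inter> {T..}) F \<le> e / 8"
    proof -
      have "(\<integral>t. (indicator {T..} t * (indicator I t * F t))\<^sup>2 \<partial>lborel) \<le> e / 8"
      proof (rule fatou_sq(2))
        show "(\<lambda>t. indicator {T..} t * (indicator I t * f n t)) \<in> borel_measurable lborel"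
          "(\<lambda>t. indicator {T..} t * (indicator I t * F t)) \<in> borel_measurable lborel" for n
          using m[of n] mF by measurable
        show "integrable lborel (\<lambda>t. (indicator {T..} t * (indicator I t * f n t))\<^sup>2)" for n
          unfolding ind_sq by (intro int_indicator_mult i) auto
        show "\<forall>\<^sub>F n in sequentially. (\<integral>t. (indicator {T..} t * (indicator I t * f n t))\<^sup>2 \<partial>lborel) \<le> e / 8"
          using T by (simp add: sq_def eI ind_sq)
        show "AE t in lborel. (\<lambda>n. indicator {T..} t * (indicator I t * f n t)) \<longlonglongrightarrow> indicator {T..} t * (indicator I t * F t)"
          by (intro AE_I2 tendsto_intros lI)
      qed
      then show ?thesis by (simp add: sq_def eI ind_sq)
    qed
    have near: "(\<lambda>n. \<integral>t. indicator {..<T} t * (indicator I t * (f n t - F t)\<^sup>2) \<partial>lborel) \<longlonglongrightarrow> (\<integral>t. 0 \<partial>(lborel::real measure))"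
    proof (rule integral_dominated_convergence[where w = "\<lambda>t. indicator {0..T} t * (2 * M)\<^sup>2"])
      show "integrable lborel (\<lambda>t. indicator {0..T} t * (2 * M)\<^sup>2)"
        using borel_integrable_compact[of "{0..T}" "\<lambda>_. (2 * M)\<^sup>2"] by simp
      show "(\<lambda>t. indicator {..<T} t * (indicator I t * (f n t - F t)\<^sup>2)) \<in> borel_measurable lborel" for n
        using dm[of n] by measurable
      show "AE t in lborel. (\<lambda>n. indicator {..<T} t * (indicator I t * (f n t - F t)\<^sup>2)) \<longlonglongrightarrow> 0"
      proof (rule AE_I2)
        fix t
        show "(\<lambda>n. indicator {..<T} t * (indicator I t * (f n t - F t)\<^sup>2)) \<longlonglongrightarrow> 0"
        proof (cases "t \<in> I")
          case True
          have "(\<lambda>n. indicator {..<T} t * (indicator I t * (f n t - F t)\<^sup>2)) \<longlonglongrightarrow> indicator {..<T} t * (indicator I t * (F t - F t)\<^sup>2)"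
            by (intro tendsto_intros l True)
          then show ?thesis by simp
        qed simp
      qed
      show "AE t in lborel. norm (indicator {..<T} t * (indicator I t * (f n t - F t)\<^sup>2)) \<le> indicator {0..T} t * (2 * M)\<^sup>2" for n
      proof (rule AE_I2)
        fix t
        show "norm (indicator {..<T} t * (indicator I t * (f n t - F t)\<^sup>2)) \<le> indicator {0..T} t * (2 * M)\<^sup>2"
        proof (cases "t \<in> I \<and> t < T")
          case True
          then have "\<bar>f n t - F t\<bar> \<le> \<bar>2 * M\<bar>" using M[of t n] MF[of t] by linarith
          then have "(f n t - F t)\<^sup>2 \<le> (2 * M)\<^sup>2" by (simp only: abs_le_square_iff)
          then show ?thesis using True I(2) by (auto simp: indicator_def)
        qed (auto simp: indicator_def)
      qed
    qed simp
    then have "\<forall>\<^sub>F n in sequentially. (\<integral>t. indicator {..<T} t * (indicator I t * (f n t - F t)\<^sup>2) \<partial>lborel) < e / 4"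
      using e by (intro order_tendstoD(2)) auto
    then have "\<forall>\<^sub>F n in sequentially. sq I (\<lambda>t. f n t - F t) < e"
      using T
    proof eventually_elim
      fix n
      assume a: "(\<integral>t. indicator {..<T} t * (indicator I t * (f n t - F t)\<^sup>2) \<partial>lborel) < e / 4" "sq (I \<inter> {T..}) (f n) \<le> e / 8"
      have i1: "integrable lborel (\<lambda>t. indicator {..<T} t * (indicator I t * (f n t - F t)\<^sup>2))"
        by (intro int_indicator_mult di) auto
      have i2: "integrable lborel (\<lambda>t. indicator (I \<inter> {T..}) t * (f n t)\<^sup>2)" "integrable lborel (\<lambda>t. indicator (I \<inter> {T..}) t * (F t)\<^sup>2)"
        unfolding eI by (intro int_indicator_mult i iF; simp)+
      have "sq I (\<lambda>t. f n t - F t) \<le> (\<integral>t. indicator {..<T} t * (indicator I t * (f n t - F t)\<^sup>2)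
         + 2 * (indicator (I \<inter> {T..}) t * (f n t)\<^sup>2) + 2 * (indicator (I \<inter> {T..}) t * (F t)\<^sup>2) \<partial>lborel)"
        unfolding sq_def
      proof (rule Bochner_Integration.integral_mono[OF di])
        fix t
        have "0 \<le> (f n t + F t)\<^sup>2" by simp
        then have "(f n t - F t)\<^sup>2 \<le> 2 * (f n t)\<^sup>2 + 2 * (F t)\<^sup>2" unfolding power2_diff power2_sum by linarith
        then show "indicator I t * (f n t - F t)\<^sup>2 \<le> indicator {..<T} t * (indicator I t * (f n t - F t)\<^sup>2)
           + 2 * (indicator (I \<inter> {T..}) t * (f n t)\<^sup>2) + 2 * (indicator (I \<inter> {T..}) t * (F t)\<^sup>2)"
          by (auto simp: indicator_def)
      qed (use i1 i2 in auto)
      also have "\<dots> = (\<integral>t. indicator {..<T} t * (indicator I t * (f n t - F t)\<^sup>2) \<partial>lborel) + 2 * sq (I \<inter> {T..}) (f n) + 2 * sq (I \<inter> {T..}) F"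
        using i1 i2 by (simp add: sq_def)
      finally show "sq I (\<lambda>t. f n t - F t) < e" using a TF e by linarith
    qed
    then show "\<exists>N. \<forall>n\<ge>N. norm (sq I (\<lambda>t. f n t - F t) - 0) < e"
      using sq_nonneg[of I] by (auto simp: eventually_sequentially)
  qed
qed

section \<open>Sobolev functions on a metric graph\<close>

lemma wd_cong:
  assumes "wd f g I" "\<And>t. t \<in> I \<Longrightarrow> f t = f' t"
  shows "wd f' g I"
proof -
  have "(\<lambda>t. indicator K t * f t) = (\<lambda>t. indicator K t * f' t)" if "K \<subseteq> I" for K
    using that assms(2) by (auto simp: indicator_def fun_eq_iff)
  then have "locally_integrable_on f' I"
    using assms(1) by (simp add: wd_iff locally_integrable_on_def set_integrable_lborel_iff)
  moreover have "(\<lambda>t. indicator I t * (f t * h t)) = (\<lambda>t. indicator I t * (f' t * h t))" for h :: "real \<Rightarrow> real"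
    using assms(2) by (auto simp: indicator_def fun_eq_iff)
  ultimately show ?thesis using assms(1) by (simp add: wd_iff)
qed

lemma sq_cong: "(\<And>t. t \<in> I \<Longrightarrow> f t = f' t) \<Longrightarrow> sq I f = sq I f'"
  unfolding sq_def by (intro Bochner_Integration.integral_cong) (auto simp: indicator_def)

lemma en_cong: "(\<And>t. t \<in> I \<Longrightarrow> f t = f' t) \<Longrightarrow> (\<And>t. t \<in> I \<Longrightarrow> g t = g' t) \<Longrightarrow> en p I f g = en p I f' g'"
  unfolding en_def by (intro Bochner_Integration.integral_cong) (auto simp: indicator_def)

lemma sob_cong:
  assumes "sob f g I" "\<And>t. t \<in> I \<Longrightarrow> f t = f' t"
  shows "sob f' g I"
proof -
  have "(\<lambda>t. indicator I t * (f t)\<^sup>2) = (\<lambda>t. indicator I t * (f' t)\<^sup>2)"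
    using assms(2) by (auto simp: indicator_def fun_eq_iff)
  then show ?thesis using assms(1) wd_cong[OF _ assms(2)] by (simp add: sob_def)
qed

lemma sob_subset:
  assumes "sob f g I" "J \<subseteq> I" "J \<in> sets borel"
  shows "sob f g J"
proof -
  have "(\<lambda>t. indicator J t * (indicator I t * (u t)\<^sup>2)) = (\<lambda>t. indicator J t * (u t)\<^sup>2)" for u :: "real \<Rightarrow> real"
    using assms(2) by (auto simp: indicator_def fun_eq_iff)
  then show ?thesis
    using wd_subset[OF sobD(1)[OF assms(1)] assms(2)] int_indicator_mult[OF sobD(2)[OF assms(1)] assms(3)]
      int_indicator_mult[OF sobD(3)[OF assms(1)] assms(3)] by (simp add: sob_def)
qed

lemma sob_cmult:
  assumes "sob f g I"
  shows "sob (\<lambda>t. c * f t) (\<lambda>t. c * g t) I"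
proof -
  have "(\<lambda>t. indicator I t * (c * u t)\<^sup>2) = (\<lambda>t. c\<^sup>2 * (indicator I t * (u t)\<^sup>2))" for u :: "real \<Rightarrow> real"
    by (auto simp: power_mult_distrib)
  then show ?thesis using assms wd_cmult[of f g I c] by (simp add: sob_def)
qed

lemma sob_add:
  assumes s: "sob f g I" "sob f' g' I" and I: "open I"
  shows "sob (\<lambda>t. f t + f' t) (\<lambda>t. g t + g' t) I"
proof -
  have "integrable lborel (\<lambda>t. (indicator I t * f t + indicator I t * f' t)\<^sup>2)"
    "integrable lborel (\<lambda>t. (indicator I t * g t + indicator I t * g' t)\<^sup>2)"
    by (intro sq_int_add sob_measurable[OF s(1) I] sob_measurable[OF s(2) I] sob_int_sq[OF s(1)] sob_int_sq[OF s(2)])+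
  then show ?thesis using wd_add[OF sobD(1)[OF s(1)] sobD(1)[OF s(2)]]
    by (simp add: sob_def distrib_left[symmetric] ind_sq)
qed

lemma h1_affine:
  assumes h: "h1 f g" and s: "s = 1 \<or> s = -1"
  shows "h1 (\<lambda>t. f (c + s * t)) (\<lambda>t. s * g (c + s * t))"
proof -
  have s0: "s \<noteq> 0" using s by auto
  have s2: "s\<^sup>2 = 1" using s by (elim disjE) simp_all
  have i: "integrable lborel (\<lambda>t. (u (c + s * t))\<^sup>2)" if "integrable lborel (\<lambda>t. (u t)\<^sup>2)" for u :: "real \<Rightarrow> real"
    by (rule lborel_integrable_real_affine[OF that s0])
  have "integrable lborel (\<lambda>t. (f t)\<^sup>2)" "integrable lborel (\<lambda>t. (g t)\<^sup>2)"
    using sobD(2)[OF h1_sob[OF h]] sobD(3)[OF h1_sob[OF h]] by simp_all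
  note ii = i[OF this(1)] i[OF this(2)]
  have "continuous_on UNIV (\<lambda>t. f (c + s * t))"
  proof (rule continuous_on_compose2[where t = UNIV and g = f])
    show "continuous_on UNIV f" using h by (simp add: h1_def)
    show "continuous_on UNIV (\<lambda>t. c + s * t)" by (intro continuous_intros)
  qed simp
  moreover have "wd (\<lambda>t. f (c + s * t)) (\<lambda>t. s * g (c + s * t)) UNIV"
    using wd_affine[OF sobD(1)[OF h1_sob[OF h]] s, of c] by simp
  moreover have "(\<lambda>t. (s * g (c + s * t))\<^sup>2) = (\<lambda>t. (g (c + s * t))\<^sup>2)"
    by (simp only: power_mult_distrib s2 mult_1)
  ultimately show ?thesis using ii unfolding h1_def sob_def by simp
qed

text \<open>Membership in \<open>H1\<close> with an explicit family g of weak derivatives;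
  \<open>Hp_imp_H1\<close> and \<open>H1_imp_Hp\<close> translate in both directions.\<close>

definition Hp :: "('v, 'e) mgraph \<Rightarrow> (('v, 'e) point \<Rightarrow> real) \<Rightarrow> ('e \<Rightarrow> real \<Rightarrow> real) \<Rightarrow> bool" where
  "Hp G u g \<longleftrightarrow> graph_continuous G u \<and> (\<forall>e\<in>edges G. sob (on_edge G u e) (g e) (open_edge_interval G e))"

definition gmass :: "('v, 'e) mgraph \<Rightarrow> (('v, 'e) point \<Rightarrow> real) \<Rightarrow> real" where "gmass G u = (\<Sum>e\<in>edges G. sq (open_edge_interval G e) (on_edge G u e))"
definition gkin :: "('v, 'e) mgraph \<Rightarrow> ('e \<Rightarrow> real \<Rightarrow> real) \<Rightarrow> real" where "gkin G g = (\<Sum>e\<in>edges G. sq (open_edge_interval G e) (g e))"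
definition gen :: "real \<Rightarrow> ('v, 'e) mgraph \<Rightarrow> (('v, 'e) point \<Rightarrow> real) \<Rightarrow> ('e \<Rightarrow> real \<Rightarrow> real) \<Rightarrow> real" where "gen p G u g = (\<Sum>e\<in>edges G. en p (open_edge_interval G e) (on_edge G u e) (g e))"
definition gpint :: "real \<Rightarrow> ('v, 'e) mgraph \<Rightarrow> (('v, 'e) point \<Rightarrow> real) \<Rightarrow> real" where "gpint p G u = (\<Sum>e\<in>edges G. pint p (open_edge_interval G e) (on_edge G u e))"
definition gver :: "real \<Rightarrow> ('v, 'e) mgraph \<Rightarrow> (('v, 'e) point \<Rightarrow> real) \<Rightarrow> real" where "gver q G u = (\<Sum>v\<in>verts G. \<bar>u (Vertex v)\<bar> powr q)"

lemma gmass_nonneg: "0 \<le> gmass G u" and gkin_nonneg: "0 \<le> gkin G g"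
  unfolding gmass_def gkin_def by (intro sum_nonneg sq_nonneg)+

lemma gver_nonneg: "0 \<le> gver q G u"
  unfolding gver_def by (intro sum_nonneg) auto

lemma gpint_nonneg: "0 \<le> gpint p G u"
  unfolding gpint_def by (intro sum_nonneg pint_nonneg)

lemma graph_integral_sq: "graph_integral G (\<lambda>e t. \<bar>on_edge G u e t\<bar>\<^sup>2) = gmass G u"
  by (simp add: graph_integral_def gmass_def sq_def set_lebesgue_integral_def)

lemma H1_mass_iff: "u \<in> H1_mass G \<mu> \<longleftrightarrow> u \<in> H1 G \<and> gmass G u = \<mu>"
  unfolding H1_mass_def graph_integral_sq by blast

lemma sq_cmult: "sq I (\<lambda>t. c * f t) = c\<^sup>2 * sq I f"
proof -
  have "(\<lambda>t. indicator I t * (c * f t)\<^sup>2) = (\<lambda>t. c\<^sup>2 * (indicator I t * (f t)\<^sup>2))"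
    by (auto simp: power_mult_distrib)
  then show ?thesis by (simp add: sq_def)
qed

lemma abs_powr_mult: "\<bar>c * x\<bar> powr p = \<bar>c\<bar> powr p * \<bar>x\<bar> powr p" for c x p :: real
  unfolding abs_mult by (rule powr_mult)

lemma pint_cmult: "pint p I (\<lambda>t. c * f t) = \<bar>c\<bar> powr p * pint p I f"
proof -
  have "(\<lambda>t. indicator I t * \<bar>c * f t\<bar> powr p) = (\<lambda>t. \<bar>c\<bar> powr p * (indicator I t * \<bar>f t\<bar> powr p))"
    unfolding abs_powr_mult by auto
  then show ?thesis by (simp add: pint_def)
qed

lemma on_edge_cmult: "on_edge G (\<lambda>x. c * u x) e = (\<lambda>t. c * on_edge G u e t)"
  by (simp add: on_edge_def fun_eq_iff)

lemma gmass_cmult: "gmass G (\<lambda>x. c * u x) = c\<^sup>2 * gmass G u"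
  unfolding gmass_def on_edge_cmult sq_cmult sum_distrib_left ..

lemma gkin_cmult: "gkin G (\<lambda>e t. c * g e t) = c\<^sup>2 * gkin G g"
  unfolding gkin_def sq_cmult sum_distrib_left ..

lemma gpint_cmult: "gpint p G (\<lambda>x. c * u x) = \<bar>c\<bar> powr p * gpint p G u"
  unfolding gpint_def on_edge_cmult pint_cmult sum_distrib_left ..

lemma gver_cmult: "gver q G (\<lambda>x. c * u x) = \<bar>c\<bar> powr q * gver q G u"
  unfolding gver_def abs_powr_mult sum_distrib_left ..

context metric_graph
begin

abbreviation "oi \<equiv> open_edge_interval G"
abbreviation "ei \<equiv> edge_interval G"

lemma interval_cases:
  assumes "e \<in> edges G"
  obtains "len G e = \<infinity>" "e \<in> half_lines G" "oi e = {0<..}" "ei e = {0..}"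
  | l where "len G e = ereal l" "e \<in> bounded_edges G" "l > 0" "oi e = {0<..<l}" "ei e = {0..l}"
proof (cases "len G e")
  case (real l)
  then show ?thesis using len_pos[OF assms] assms
    by (intro that(2)[of l]) (auto simp: bounded_edges_def open_edge_interval_def edge_interval_def)
next
  case PInf
  then show ?thesis using assms
    by (intro that(1)) (auto simp: half_lines_def open_edge_interval_def edge_interval_def)
next
  case MInf
  then show ?thesis using len_pos[OF assms] by simp
qed

lemma interval_facts:
  assumes "e \<in> edges G"
  shows "open (oi e)" "convex (oi e)" "oi e \<subseteq> ei e" "ei e \<subseteq> closure (oi e)" "oi e \<subseteq> {0<..}"
    "oi e \<in> sets borel"
proof -
  show *: "open (oi e)" using assms by (cases rule: interval_cases) auto
  show "convex (oi e)" using assms by (cases rule: interval_cases) auto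
  show "oi e \<subseteq> ei e" using assms by (cases rule: interval_cases) auto
  show "ei e \<subseteq> closure (oi e)" using assms by (cases rule: interval_cases) auto
  show "oi e \<subseteq> {0<..}" using assms by (cases rule: interval_cases) auto
  show "oi e \<in> sets borel" using * by simp
qed

text \<open>By \<open>wd_unique\<close> the family g and the chosen \<open>graph_deriv\<close> agree
  almost everywhere on each edge, so they give the same kinetic energy.\<close>

lemma Hp_imp_H1:
  assumes h: "Hp G u g"
  shows "u \<in> H1 G" "graph_integral G (\<lambda>e t. \<bar>graph_deriv G u e t\<bar>\<^sup>2) = gkin G g"
proof -
  have s: "sob (on_edge G u e) (g e) (oi e)" if "e \<in> edges G" for e using h that by (auto simp: Hp_def)
  have w: "wd (on_edge G u e) (graph_deriv G u e) (oi e)" if "e \<in> edges G" for e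
    unfolding graph_deriv_def weak_deriv_def
    by (rule someI[where P = "\<lambda>g. wd (on_edge G u e) g (oi e)"]) (rule sobD(1)[OF s[OF that]])
  have ae: "AE t in lborel. indicator (oi e) t * (graph_deriv G u e t)\<^sup>2 = indicator (oi e) t * (g e t)\<^sup>2" if "e \<in> edges G" for e
    using wd_unique[OF w[OF that] sobD(1)[OF s[OF that]] interval_facts(1)[OF that]]
    by eventually_elim (auto simp: indicator_def)
  have m: "(\<lambda>t. indicator (oi e) t * (graph_deriv G u e t)\<^sup>2) \<in> borel_measurable lborel"
    "(\<lambda>t. indicator (oi e) t * (g e t)\<^sup>2) \<in> borel_measurable lborel" if "e \<in> edges G" for e
  proof -
    have "(\<lambda>t. indicator (oi e) t * graph_deriv G u e t) \<in> borel_measurable lborel"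
      using loc_int_measurable[OF _ interval_facts(1)[OF that]] w[OF that] by (simp add: wd_iff)
    then show "(\<lambda>t. indicator (oi e) t * (graph_deriv G u e t)\<^sup>2) \<in> borel_measurable lborel"
      unfolding ind_sq[symmetric] by measurable
    show "(\<lambda>t. indicator (oi e) t * (g e t)\<^sup>2) \<in> borel_measurable lborel"
      using sobD(3)[OF s[OF that]] by simp
  qed
  have i: "integrable lborel (\<lambda>t. indicator (oi e) t * (graph_deriv G u e t)\<^sup>2)" if "e \<in> edges G" for e
    using integrable_cong_AE[OF m[OF that] ae[OF that]] sobD(3)[OF s[OF that]] by simp
  have eq: "sq (oi e) (graph_deriv G u e) = sq (oi e) (g e)" if "e \<in> edges G" for e
    unfolding sq_def by (rule integral_cong_AE[OF m[OF that] ae[OF that]])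
  show "u \<in> H1 G"
    using h s w i by (auto simp: H1_def Hp_def weakly_differentiable_on_def graph_integrable_def set_integrable_def sob_def)
  have "gkin G (graph_deriv G u) = gkin G g" unfolding gkin_def using eq by simp
  then show "graph_integral G (\<lambda>e t. \<bar>graph_deriv G u e t\<bar>\<^sup>2) = gkin G g"
    by (simp add: graph_integral_def gkin_def sq_def set_lebesgue_integral_def)
qed

lemma H1_imp_Hp:
  assumes "u \<in> H1 G" shows "Hp G u (graph_deriv G u)"
proof -
  have w: "wd (on_edge G u e) (graph_deriv G u e) (oi e)" if "e \<in> edges G" for e
  proof -
    have "\<exists>g. wd (on_edge G u e) g (oi e)"
      using assms that by (auto simp: H1_def weakly_differentiable_on_def)
    then show ?thesis unfolding graph_deriv_def weak_deriv_def by (rule someI_ex)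
  qed
  then show ?thesis using assms
    by (auto simp: Hp_def H1_def graph_integrable_def set_integrable_def sob_def)
qed

lemma Hp_sob: "Hp G u g \<Longrightarrow> e \<in> edges G \<Longrightarrow> sob (on_edge G u e) (g e) (oi e)"
  by (simp add: Hp_def)

section \<open>Uniform bounds on edges and at vertices\<close>

definition dmin where "dmin = (SOME d. 0 < d \<and> (\<forall>e\<in>edges G. ereal (2 * d) \<le> len G e))"

text \<open>The factor two keeps profiles of reach \<open>dmin\<close> at the two ends of an edge
  apart, even on a loop, and leaves every point of an edge inside a subinterval of length
  \<open>dmin\<close>.\<close>

lemma dmin: "0 < dmin" "e \<in> edges G \<Longrightarrow> ereal (2 * dmin) \<le> len G e"
proof -
  have "\<exists>d>0. \<forall>e\<in>A. ereal (2 * d) \<le> len G e" if "finite A" "A \<subseteq> edges G" for A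
    using that
  proof (induction A)
    case (insert e A)
    then obtain d where d: "d > 0" "\<forall>e\<in>A. ereal (2 * d) \<le> len G e" by auto
    have "\<exists>d'>0. ereal (2 * d') \<le> len G e"
    proof (cases "len G e")
      case (real r)
      then show ?thesis using len_pos[of e] insert by (intro exI[of _ "r/2"]) auto
    qed (use len_pos[of e] insert in \<open>auto intro: exI[of _ 1]\<close>)
    then obtain d' where d': "d' > 0" "ereal (2 * d') \<le> len G e" by blast
    have m: "ereal (2 * min d d') \<le> ereal (2 * d)" "ereal (2 * min d d') \<le> ereal (2 * d')" by auto
    have "ereal (2 * min d d') \<le> len G x" if "x \<in> insert e A" for x
      using that d(2) d'(2) order_trans[OF m(1), of "len G x"] order_trans[OF m(2), of "len G x"] by blast
    then show ?case using d(1) d'(1) by (intro exI[of _ "min d d'"]) simp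
  qed (auto intro: exI[of _ 1])
  from this[OF finite_edges order_refl] have "\<exists>d. 0 < d \<and> (\<forall>e\<in>edges G. ereal (2 * d) \<le> len G e)" by auto
  from someI_ex[OF this] show "0 < dmin" "e \<in> edges G \<Longrightarrow> ereal (2 * dmin) \<le> len G e"
    unfolding dmin_def by auto
qed

lemma sum_edges_ge: "e \<in> edges G \<Longrightarrow> (\<And>e. e \<in> edges G \<Longrightarrow> 0 \<le> f e) \<Longrightarrow> f e \<le> (\<Sum>e\<in>edges G. f e)" for f :: "_ \<Rightarrow> real"
  using finite_edges by (intro member_le_sum) auto

lemma edge_holder:
  assumes h: "Hp G u g" and e: "e \<in> edges G" and st: "s \<in> ei e" "t \<in> ei e"
  shows "(on_edge G u e t - on_edge G u e s)\<^sup>2 \<le> \<bar>t - s\<bar> * gkin G g"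
proof -
  have "(on_edge G u e t - on_edge G u e s)\<^sup>2 \<le> \<bar>t - s\<bar> * sq (oi e) (g e)"
    by (rule sob_holder[OF Hp_sob[OF h e] interval_facts(1,2)[OF e] _ interval_facts(3,4)[OF e] st])
      (use h e in \<open>auto simp: Hp_def graph_continuous_def\<close>)
  also have "\<dots> \<le> \<bar>t - s\<bar> * gkin G g"
    unfolding gkin_def using e by (intro mult_left_mono sum_edges_ge[where f = "\<lambda>e. sq (oi e) (g e)"] sq_nonneg) auto
  finally show ?thesis .
qed

text \<open>On a bounded edge a function need not decay, so unlike in \<open>h1_sup\<close> the
  lower-order term with the interval length remains.\<close>

lemma edge_sup4:
  assumes h: "Hp G u g" and e: "e \<in> edges G" and t: "t \<in> ei e"
  shows "(on_edge G u e t)^4 \<le> 16 * gmass G u * gkin G g + 16 * (gmass G u)\<^sup>2 / dmin\<^sup>2"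
proof -
  \<comment> \<open>[a, a + dmin] contains t and stays in the edge: it ends at t if there is room to
    the left, and otherwise starts at the tail.\<close>
  define a where "a = max 0 (t - dmin)"
  have at: "0 \<le> a" "t \<in> {a..a+dmin}" using t dmin(1) by (auto simp: a_def edge_interval_def)
  have al: "ereal (a + dmin) \<le> len G e"
  proof (cases "t \<le> dmin")
    case True
    then have "ereal (a + dmin) \<le> ereal (2 * dmin)" using dmin(1) by (simp add: a_def)
    then show ?thesis using dmin(2)[OF e] by (rule order_trans)
  next
    case False
    then show ?thesis using t by (simp add: a_def edge_interval_def)
  qed
  have sub: "{a..a+dmin} \<subseteq> ei e" "{a<..<a+dmin} \<subseteq> oi e"
  proof -
    show "{a..a+dmin} \<subseteq> ei e"
    proof
      fix x assume "x \<in> {a..a+dmin}"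
      then have "0 \<le> x" and x: "ereal x \<le> ereal (a + dmin)" using at by auto
      then show "x \<in> ei e" using order_trans[OF x al] by (simp add: edge_interval_def)
    qed
    show "{a<..<a+dmin} \<subseteq> oi e"
    proof
      fix x assume "x \<in> {a<..<a+dmin}"
      then have "0 < x" and x: "ereal x < ereal (a + dmin)" using at by auto
      then show "x \<in> oi e" using less_le_trans[OF x al] by (simp add: open_edge_interval_def)
    qed
  qed
  have "(on_edge G u e t)^4 \<le> 16 * sq (oi e) (on_edge G u e) * gkin G g + 16 * (sq (oi e) (on_edge G u e))\<^sup>2 / dmin\<^sup>2"
  proof (rule sup_bound[where a = a])
    show "(on_edge G u e t - on_edge G u e s)\<^sup>2 \<le> \<bar>t - s\<bar> * gkin G g" if "s \<in> {a..a+dmin}" "t \<in> {a..a+dmin}" for s t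
      using edge_holder[OF h e subsetD[OF sub(1) that(1)] subsetD[OF sub(1) that(2)]] .
  qed (use sub at dmin(1) sobD(2)[OF Hp_sob[OF h e]] gkin_nonneg in auto)
  also have "\<dots> \<le> 16 * gmass G u * gkin G g + 16 * (gmass G u)\<^sup>2 / dmin\<^sup>2"
  proof -
    have "sq (oi e) (on_edge G u e) \<le> gmass G u"
      unfolding gmass_def using e by (intro sum_edges_ge[where f = "\<lambda>e. sq (oi e) (on_edge G u e)"] sq_nonneg)
    then show ?thesis using sq_nonneg[of "oi e"] gkin_nonneg[of G g]
      by (intro add_mono mult_right_mono mult_left_mono divide_right_mono power_mono) auto
  qed
  finally show ?thesis .
qed

definition gbd where "gbd u g = (16 * gmass G u * gkin G g + 16 * (gmass G u)\<^sup>2 / dmin\<^sup>2) powr (1/4)"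

lemma edge_bdd:
  assumes h: "Hp G u g" and e: "e \<in> edges G" and t: "t \<in> ei e"
  shows "\<bar>on_edge G u e t\<bar> \<le> gbd u g"
proof -
  let ?x = "on_edge G u e t"
  have "(\<bar>?x\<bar> powr 4) powr (1/4) = \<bar>?x\<bar> powr (4 * (1/4))" by (rule powr_powr)
  then have "\<bar>?x\<bar> = (\<bar>?x\<bar> powr 4) powr (1/4)" by simp
  also have "\<bar>?x\<bar> powr 4 = ?x^4" by (cases "?x = 0") (simp_all add: powr_numeral)
  also have "(?x^4) powr (1/4) \<le> gbd u g" unfolding gbd_def
    by (rule powr_mono2) (use edge_sup4[OF assms] in auto)
  finally show ?thesis .
qed

lemma edge_bdd_open:
  assumes "Hp G u g" "e \<in> edges G" "t \<in> oi e"
  shows "\<bar>on_edge G u e t\<bar> \<le> gbd u g"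
  using edge_bdd[OF assms(1,2)] interval_facts(3)[OF assms(2)] assms(3) by auto

lemma gbd4: "(gbd u g) powr 4 = 16 * gmass G u * gkin G g + 16 * (gmass G u)\<^sup>2 / dmin\<^sup>2"
  unfolding gbd_def using gmass_nonneg[of G u] gkin_nonneg[of G g] by (simp add: powr_powr)

lemma gen_eq:
  assumes h: "Hp G u g" and p: "2 < p"
  shows "gen p G u g = gkin G g / 2 - gpint p G u / p"
proof -
  have "en p (oi e) (on_edge G u e) (g e) = sq (oi e) (g e) / 2 - pint p (oi e) (on_edge G u e) / p" if "e \<in> edges G" for e
    by (rule sob_en(2)[OF Hp_sob[OF h that] interval_facts(1)[OF that] edge_bdd_open[OF h that] p])
  then show ?thesis by (simp add: gen_def gkin_def gpint_def sum_subtractf sum_divide_distrib)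
qed

lemma energy_eq:
  assumes h: "Hp G u g" and p: "2 < p"
  shows "energy p q u G = gen p G u g - gver q G u / q"
  unfolding energy_def gen_eq[OF h p] Hp_imp_H1(2)[OF h]
  by (simp add: graph_integral_def gpint_def pint_def set_lebesgue_integral_def gver_def)

lemma gpint_le:
  assumes h: "Hp G u g" and p: "2 < p"
  shows "gpint p G u \<le> gbd u g powr (p - 2) * gmass G u"
proof -
  have "pint p (oi e) (on_edge G u e) \<le> gbd u g powr (p - 2) * sq (oi e) (on_edge G u e)" if "e \<in> edges G" for e
    by (rule sob_powr(2)[OF Hp_sob[OF h that] interval_facts(1)[OF that] edge_bdd_open[OF h that] p])
  then show ?thesis unfolding gpint_def gmass_def sum_distrib_left by (intro sum_mono) auto
qed

text \<open>Vertex values are controlled only through incident edges. The origin of a half-line has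
  one; any other vertex is joined to that origin by a path, whose first step is a bounded
  edge.\<close>

lemma vertex_on_edge:
  assumes nc: "noncompact_graph G" and v: "v \<in> verts G"
  shows "\<exists>e\<in>edges G. \<exists>t\<in>ei e. edge_point G e t = Vertex v"
proof -
  obtain e0 where e0: "e0 \<in> half_lines G" using nc by (auto simp: noncompact_graph_def)
  have tl: ?thesis if "e \<in> edges G" "tail G e = v" for e
  proof -
    have "0 \<in> ei e" using len_pos[OF that(1)] by (simp add: edge_interval_def zero_ereal_def[symmetric])
    moreover have "edge_point G e 0 = Vertex v" using that by (simp add: edge_point_def)
    ultimately show ?thesis using that(1) by blast
  qed
  have hd: ?thesis if "e \<in> bounded_edges G" "head G e = v" for e
  proof -
    have e: "e \<in> edges G" using that by (simp add: bounded_edges_def)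
    from e show ?thesis
    proof (cases rule: interval_cases)
      case 1
      then show ?thesis using that by (simp add: bounded_edges_def)
    next
      case (2 l)
      then have "l \<in> ei e" "edge_point G e l = Vertex v" using that by (auto simp: edge_point_def)
      then show ?thesis using e by blast
    qed
  qed
  have e0e: "e0 \<in> edges G" using e0 by (simp add: half_lines_def)
  show ?thesis
  proof (cases "tail G e0 = v")
    case False
    have "(v, tail G e0) \<in> (adj G \<union> (adj G)\<inverse>)\<^sup>*" using connected[OF v tail_in_verts[OF e0e]] .
    then obtain w where "(v, w) \<in> adj G \<union> (adj G)\<inverse>" using False by (metis converse_rtranclE)
    then show ?thesis using tl hd by (auto simp: adj_def bounded_edges_def)
  qed (use tl e0e in auto)
qed

lemma vertex_bdd:
  assumes nc: "noncompact_graph G" and h: "Hp G u g" and v: "v \<in> verts G"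
  shows "\<bar>u (Vertex v)\<bar> \<le> gbd u g"
  using vertex_on_edge[OF nc v] edge_bdd[OF h] by (metis on_edge_def)

lemma Hp_cmult:
  assumes h: "Hp G u g"
  shows "Hp G (\<lambda>x. c * u x) (\<lambda>e t. c * g e t)"
proof -
  have "on_edge G (\<lambda>x. c * u x) e = (\<lambda>t. c * on_edge G u e t)" for e by (auto simp: on_edge_def)
  then show ?thesis using h by (auto simp: Hp_def graph_continuous_def intro!: sob_cmult continuous_intros)
qed

lemma Hp_add:
  assumes h: "Hp G u g" "Hp G u' g'"
  shows "Hp G (\<lambda>x. u x + u' x) (\<lambda>e t. g e t + g' e t)"
proof -
  have "on_edge G (\<lambda>x. u x + u' x) e = (\<lambda>t. on_edge G u e t + on_edge G u' e t)" for e by (auto simp: on_edge_def)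
  then show ?thesis using h by (auto simp: Hp_def graph_continuous_def intro!: sob_add continuous_intros interval_facts)
qed

text \<open>Both nonlinear terms are superquadratic.\<close>

lemma scale_up:
  assumes lb: "\<And>w. w \<in> H1_mass G \<mu> \<Longrightarrow> J \<le> energy p q w G"
    and h: "Hp G u g" and p: "2 < p" and q: "0 < q" and m: "0 < gmass G u" "gmass G u \<le> \<mu>"
  defines "k \<equiv> \<mu> / gmass G u"
  shows "J \<le> k * gen p G u g - k powr (q / 2) * gver q G u / q"
proof -
  have k: "k \<ge> 1" using m by (simp add: k_def)
  define c where "c = sqrt k"
  have c: "c\<^sup>2 = k" "c \<ge> 1" using k by (auto simp: c_def)
  have cp: "c powr r = k powr (r / 2)" for r using k by (simp add: c_def powr_half_sqrt[symmetric] powr_powr)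
  note hc = Hp_cmult[OF h, of c]
  have "(\<lambda>x. c * u x) \<in> H1_mass G \<mu>"
    using Hp_imp_H1(1)[OF hc] m by (simp add: H1_mass_iff gmass_cmult c k_def)
  from lb[OF this] have "J \<le> c\<^sup>2 * gkin G g / 2 - c powr p * gpint p G u / p - c powr q * gver q G u / q"
    using c by (simp add: energy_eq[OF hc p] gen_eq[OF hc p] gkin_cmult gpint_cmult gver_cmult)
  moreover have "c powr p * gpint p G u / p \<ge> k * gpint p G u / p"
  proof -
    have "k powr 1 \<le> k powr (p / 2)" using k p by (intro powr_mono) auto
    then show ?thesis using gpint_nonneg[of p G u] p k by (intro divide_right_mono mult_right_mono) (auto simp: cp)
  qed
  ultimately have "J \<le> k * gkin G g / 2 - k * gpint p G u / p - k powr (q / 2) * gver q G u / q"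
    unfolding c(1) cp by linarith
  then show ?thesis unfolding gen_eq[OF h p] by (simp add: right_diff_distrib)
qed

end

section \<open>Transplanting a function on the line to a vertex of degree two\<close>

lemma integral_split_at_0:
  fixes \<Psi> :: "real \<Rightarrow> real"
  assumes i: "integrable lborel \<Psi>"
  shows "(\<integral>s. indicator {0<..} s * \<Psi> s \<partial>lborel) + (\<integral>s. indicator {0<..} s * \<Psi> (- s) \<partial>lborel) = (\<integral>s. \<Psi> s \<partial>lborel)"
proof -
  have m[measurable]: "\<Psi> \<in> borel_measurable borel" using i by simp
  have "(\<integral>s. indicator {..<0} s * \<Psi> s \<partial>lborel) = \<bar>-1\<bar> *\<^sub>R (\<integral>s. indicator {..<0} (0 + -1 * s) * \<Psi> (0 + -1 * s) \<partial>lborel)"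
    by (rule lborel_integral_real_affine) simp
  also have "\<dots> = (\<integral>s. indicator {0<..} s * \<Psi> (- s) \<partial>lborel)"
    by (simp, intro Bochner_Integration.integral_cong) (auto simp: indicator_def)
  finally have "(\<integral>s. indicator {0<..} s * \<Psi> s \<partial>lborel) + (\<integral>s. indicator {0<..} s * \<Psi> (- s) \<partial>lborel)
    = (\<integral>s. indicator {0<..} s * \<Psi> s + indicator {..<0} s * \<Psi> s \<partial>lborel)"
    using int_indicator_mult[OF i, of "{0<..}"] int_indicator_mult[OF i, of "{..<0}"] by simp
  also have "\<dots> = (\<integral>s. \<Psi> s \<partial>lborel)"
  proof (rule integral_cong_AE)
    show "AE s in lborel. indicator {0<..} s * \<Psi> s + indicator {..<0} s * \<Psi> s = \<Psi> s"
      using AE_lborel_singleton[of 0] by eventually_elim (auto simp: indicator_def)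
  qed measurable
  finally show ?thesis .
qed

lemma h1_zero: "h1 (\<lambda>_. 0) (\<lambda>_. 0)"
  by (simp add: h1_def sob_def wd_const)

lemma h1_ed_integrable: "h1 f g \<Longrightarrow> 2 < p \<Longrightarrow> integrable lborel (\<lambda>t. ed p (f t) (g t))"
  using sob_en(1)[OF h1_sob open_UNIV h1_bdd] by simp

context metric_graph
begin

text \<open>The line is folded at 0: W on the positive axis is laid along one edge-end at v, the
  reflected negative part along the other. Continuity at v is the common value W 0, and every other
  vertex receives 0 because W dies within distance \<delta>.\<close>

lemma transplant:
  assumes v: "v \<in> verts G" "vertex_degree G v = 2" and \<delta>: "\<And>e. e \<in> edges G \<Longrightarrow> ereal (2 * \<delta>) \<le> len G e" "\<delta> > 0"
    and W: "h1 W W'" and supp: "\<And>t. \<bar>t\<bar> \<ge> \<delta> \<Longrightarrow> W t = 0 \<and> W' t = 0" and p: "2 < p"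
  shows "\<exists>u g. Hp G u g \<and> gmass G u = mass W \<and> gen p G u g = en p UNIV W W' \<and> gver q G u = \<bar>W 0\<bar> powr q"
proof -
  define T H where "T = {e \<in> edges G. tail G e = v}" and "H = {e \<in> bounded_edges G. head G e = v}"
  have fin: "finite T" "finite H" using finite_edges by (auto simp: T_def H_def bounded_edges_def)
  \<comment> \<open>Edge-ends are edges tagged \<open>False\<close> at the tail and
    \<open>True\<close> at the head. With tags a loop contributes two different ends, so degree two
    always yields two distinct elements x and y.\<close>
  define ends where "ends = (\<lambda>e. (e, False)) ` T \<union> (\<lambda>e. (e, True)) ` H"
  have "card ends = card ((\<lambda>e. (e, False)) ` T) + card ((\<lambda>e. (e, True)) ` H)"
    unfolding ends_def using fin by (intro card_Un_disjoint) auto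
  also have "\<dots> = 2" using v(2) by (simp add: card_image inj_on_def vertex_degree_def T_def H_def)
  finally obtain x y where xy: "ends = {x, y}" "x \<noteq> y" by (auto simp: card_2_iff)
  have endsF: "(e, False) \<in> ends \<longleftrightarrow> e \<in> edges G \<and> tail G e = v"
    and endsT: "(e, True) \<in> ends \<longleftrightarrow> e \<in> bounded_edges G \<and> head G e = v" for e
    by (auto simp: ends_def T_def H_def)
  \<comment> \<open>The contribution of the edge-end n as a function of the distance s from it, zero
    for all ends but x and y. It is kept as a function on the whole line so that calculus on the
    line applies.\<close>
  define b where "b n s = (if n = x then W s else if n = y then W (- s) else 0)" for n s
  define b' where "b' n s = (if n = x then W' s else if n = y then - W' (- s) else 0)" for n s
  have bn: "b n s = 0 \<and> b' n s = 0" if "n \<notin> ends" for n s using that xy by (auto simp: b_def b'_def)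
  have bs: "b n s = 0 \<and> b' n s = 0" if "\<bar>s\<bar> \<ge> \<delta>" for n s
    using that supp[of s] supp[of "-s"] by (auto simp: b_def b'_def)
  have b0: "b n 0 = (if n \<in> ends then W 0 else 0)" for n using xy by (auto simp: b_def)
  have hb: "h1 (b n) (b' n)" for n
  proof -
    consider "n = x" | "n \<noteq> x" "n = y" | "n \<noteq> x" "n \<noteq> y" by blast
    then show ?thesis
    proof cases
      case 1 then show ?thesis using W by (simp add: b_def[abs_def] b'_def[abs_def])
    next
      case 2 then show ?thesis using h1_affine[OF W, of "-1" 0] by (simp add: b_def[abs_def] b'_def[abs_def])
    next
      case 3 then show ?thesis using h1_zero by (simp add: b_def[abs_def] b'_def[abs_def])
    qed
  qed
  \<comment> \<open>On a half-line this is a meaningless default, but there the head contribution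
    \<open>b (e, True)\<close> vanishes identically, since heads of half-lines are not in
    \<open>ends\<close>.\<close>
  define l where "l e = real_of_ereal (len G e)" for e
  define ue where "ue e t = b (e, False) t + b (e, True) (l e + -1 * t)" for e t
  define ge where "ge e t = b' (e, False) t + -1 * b' (e, True) (l e + -1 * t)" for e t
  define u where "u z = (case z of Vertex w \<Rightarrow> (if w = v then W 0 else 0) | Interior e t \<Rightarrow> ue e t)" for z
  have hue: "continuous_on UNIV (ue e)" "sob (ue e) (ge e) UNIV" for e
  proof -
    have a: "h1 (\<lambda>t. b (e, True) (l e + -1 * t)) (\<lambda>t. -1 * b' (e, True) (l e + -1 * t))"
      by (rule h1_affine[OF hb]) simp
    show "continuous_on UNIV (ue e)" unfolding ue_def[abs_def] using a hb[of "(e, False)"]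
      by (intro continuous_on_add) (simp_all add: h1_def)
    show "sob (ue e) (ge e) UNIV" unfolding ue_def[abs_def] ge_def[abs_def]
      by (rule sob_add[OF h1_sob[OF hb] h1_sob[OF a] open_UNIV])
  qed
  have oe: "on_edge G u e t = ue e t" if e: "e \<in> edges G" and t: "t \<in> ei e" for e t
    using e
  proof (cases rule: interval_cases)
    case 1
    then have nb: "e \<notin> bounded_edges G" by (simp add: bounded_edges_def)
    then have "b (e, True) s = 0" for s using bn endsT by blast
    then show ?thesis using 1 e
      by (auto simp: on_edge_def edge_point_def u_def ue_def b0 endsF)
  next
    case (2 r)
    have r: "r \<ge> 2 * \<delta>" "l e = r" using \<delta>(1)[OF e] 2 by (auto simp: l_def)
    consider "t = 0" | "t = r" "t \<noteq> 0" | "t \<noteq> 0" "t \<noteq> r" by blast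
    then show ?thesis
    proof cases
      case 1
      then show ?thesis using e bs[of r "(e, True)"] r \<delta>(2)
        by (auto simp: on_edge_def edge_point_def u_def ue_def b0 endsF)
    next
      case a: 2
      then show ?thesis using e 2 bs[of r "(e, False)"] r \<delta>(2)
        by (auto simp: on_edge_def edge_point_def u_def ue_def b0 endsT)
    next
      case 3
      then show ?thesis using 2 by (auto simp: on_edge_def edge_point_def u_def)
    qed
  qed
  have oo: "on_edge G u e t = ue e t" if "e \<in> edges G" "t \<in> oi e" for e t
    using oe[OF that(1)] that interval_facts(3)[OF that(1)] by blast
  have Hp: "Hp G u ge"
    unfolding Hp_def graph_continuous_def
  proof (intro conjI ballI)
    fix e assume e: "e \<in> edges G"
    show "continuous_on (ei e) (on_edge G u e)"
      using continuous_on_subset[OF hue(1)[of e], of "ei e"] oe[OF e] by (simp cong: continuous_on_cong)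
    show "sob (on_edge G u e) (ge e) (oi e)"
      by (rule sob_cong[OF sob_subset[OF hue(2)]]) (use interval_facts[OF e] oo[OF e] in auto)
  qed
  \<comment> \<open>One identity for a general density gives both mass and energy. Evenness in the
    second argument is required because reflection reverses the sign of the derivative.\<close>
  have key: "(\<Sum>e\<in>edges G. \<integral>t. indicator (oi e) t * \<Phi> (ue e t) (ge e t) \<partial>lborel) = (\<integral>t. \<Phi> (W t) (W' t) \<partial>lborel)"
    if \<Phi>: "\<Phi> 0 0 = 0" "\<And>a b. \<Phi> a (- b) = \<Phi> a b" and i: "integrable lborel (\<lambda>t. \<Phi> (W t) (W' t))"
    for \<Phi> :: "real \<Rightarrow> real \<Rightarrow> real"
  proof -
    define A where "A n = (\<integral>s. indicator {0<..} s * \<Phi> (b n s) (b' n s) \<partial>lborel)" for n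
    have ib: "integrable lborel (\<lambda>s. \<Phi> (b n s) (b' n s))" for n
    proof -
      have "integrable lborel (\<lambda>t. \<Phi> (W (0 + -1 * t)) (W' (0 + -1 * t)))"
        by (rule lborel_integrable_real_affine[OF i]) simp
      then show ?thesis using i \<Phi> by (cases "n = x"; cases "n = y") (auto simp: b_def b'_def)
    qed
    note ib' = int_indicator_mult[OF ib, of "{0<..}", simplified]
    have e: "(\<integral>t. indicator (oi e) t * \<Phi> (ue e t) (ge e t) \<partial>lborel) = A (e, False) + A (e, True)" if e: "e \<in> edges G" for e
    proof -
      define \<Psi> where "\<Psi> s = indicator {0<..} s * \<Phi> (b (e, True) s) (b' (e, True) s)" for s
      have i\<Psi>: "integrable lborel \<Psi>" unfolding \<Psi>_def using ib'[of "(e, True)"] .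
      \<comment> \<open>The tail and head contributions have disjoint supports in the edge since 2
        \<delta> is at most its length; as the density vanishes at (0, 0), it is additive over the
        two.\<close>
      have eq: "(\<lambda>t. indicator (oi e) t * \<Phi> (ue e t) (ge e t)) =
        (\<lambda>t. indicator {0<..} t * \<Phi> (b (e, False) t) (b' (e, False) t) + (if e \<in> bounded_edges G then \<Psi> (l e + -1 * t) else 0))"
      proof
        fix t
        show "indicator (oi e) t * \<Phi> (ue e t) (ge e t) =
          indicator {0<..} t * \<Phi> (b (e, False) t) (b' (e, False) t) + (if e \<in> bounded_edges G then \<Psi> (l e + -1 * t) else 0)"
          using e
        proof (cases rule: interval_cases)
          case 1
          then have nb: "e \<notin> bounded_edges G" by (simp add: bounded_edges_def)
          then have "b (e, True) s = 0 \<and> b' (e, True) s = 0" for s using bn endsT by blast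
          then show ?thesis using 1 nb by (simp add: ue_def ge_def)
        next
          case (2 r)
          have r: "r \<ge> 2 * \<delta>" "l e = r" using \<delta>(1)[OF e] 2 by (auto simp: l_def)
          consider "t \<le> 0" | "0 < t" "t < \<delta>" | "\<delta> \<le> t" "t < r" | "r \<le> t" using \<delta>(2) r by linarith
          then show ?thesis
          proof cases
            case 1
            then show ?thesis using 2 r \<delta>(2) bs[of "r - t" "(e, True)"] \<Phi>(1) by (simp add: \<Psi>_def)
          next
            case a: 2
            then show ?thesis using 2 r \<delta>(2) bs[of "r - t" "(e, True)"] \<Phi>(1) by (simp add: \<Psi>_def ue_def ge_def)
          next
            case 3
            then show ?thesis using 2 r \<delta>(2) bs[of t "(e, False)"] \<Phi> by (simp add: \<Psi>_def ue_def ge_def)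
          next
            case 4
            then show ?thesis using 2 r \<delta>(2) bs[of t "(e, False)"] \<Phi> by (simp add: \<Psi>_def)
          qed
        qed
      qed
      have "(\<integral>t. (if e \<in> bounded_edges G then \<Psi> (l e + -1 * t) else 0) \<partial>lborel) = A (e, True)
         \<and> integrable lborel (\<lambda>t. (if e \<in> bounded_edges G then \<Psi> (l e + -1 * t) else 0))"
      proof (cases "e \<in> bounded_edges G")
        case True
        have "A (e, True) = \<bar>-1\<bar> *\<^sub>R (\<integral>t. \<Psi> (l e + -1 * t) \<partial>lborel)"
          unfolding A_def \<Psi>_def[symmetric] by (rule lborel_integral_real_affine) simp
        moreover have "integrable lborel (\<lambda>t. \<Psi> (l e + -1 * t))"
          by (rule lborel_integrable_real_affine[OF i\<Psi>]) simp
        ultimately show ?thesis using True by simp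
      next
        case False
        then have "b (e, True) s = 0 \<and> b' (e, True) s = 0" for s using bn endsT by blast
        then show ?thesis using False \<Phi>(1) by (simp add: A_def)
      qed
      then show ?thesis unfolding eq A_def[of "(e, False)"] using ib'[of "(e, False)"]
        by (simp add: Bochner_Integration.integral_add)
    qed
    have "(\<Sum>e\<in>edges G. \<integral>t. indicator (oi e) t * \<Phi> (ue e t) (ge e t) \<partial>lborel) = (\<Sum>e\<in>edges G. \<Sum>c\<in>UNIV. A (e, c))"
      by (intro sum.cong refl) (simp add: e UNIV_bool add.commute)
    also have "\<dots> = (\<Sum>n\<in>edges G \<times> UNIV. A n)" by (simp add: sum.cartesian_product)
    also have "\<dots> = (\<Sum>n\<in>ends. A n)"
    proof (rule sum.mono_neutral_right)
      show "finite (edges G \<times> (UNIV :: bool set))" using finite_edges by simp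
      show "ends \<subseteq> edges G \<times> UNIV" by (auto simp: ends_def T_def H_def bounded_edges_def)
      show "\<forall>n\<in>edges G \<times> UNIV - ends. A n = 0" using bn \<Phi>(1) by (auto simp: A_def)
    qed
    also have "\<dots> = A x + A y" using xy by simp
    also have "A x = (\<integral>s. indicator {0<..} s * \<Phi> (W s) (W' s) \<partial>lborel)" by (simp add: A_def b_def b'_def)
    also have "A y = (\<integral>s. indicator {0<..} s * \<Phi> (W (- s)) (W' (- s)) \<partial>lborel)"
      using xy(2) \<Phi>(2) by (simp add: A_def b_def b'_def)
    finally show ?thesis using integral_split_at_0[OF i] by simp
  qed
  have "gmass G u = (\<Sum>e\<in>edges G. \<integral>t. indicator (oi e) t * (ue e t)\<^sup>2 \<partial>lborel)"
    unfolding gmass_def using sq_cong[OF oo] by (simp add: sq_def)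
  also have "\<dots> = mass W" using key[of "\<lambda>a b. a\<^sup>2"] sobD(2)[OF h1_sob[OF W]] by (simp add: sq_def)
  finally have 1: "gmass G u = mass W" .
  have "gen p G u ge = (\<Sum>e\<in>edges G. \<integral>t. indicator (oi e) t * ed p (ue e t) (ge e t) \<partial>lborel)"
    unfolding gen_def using en_cong[OF oo] by (simp add: en_def)
  also have "\<dots> = en p UNIV W W'" using key[of "ed p"] h1_ed_integrable[OF W p] by (simp add: en_def ed_def)
  finally have 2: "gen p G u ge = en p UNIV W W'" .
  have "gver q G u = (\<Sum>w\<in>verts G. if w = v then \<bar>W 0\<bar> powr q else 0)"
    unfolding gver_def by (intro sum.cong refl) (simp add: u_def)
  also have "\<dots> = \<bar>W 0\<bar> powr q" using v(1) finite_verts by simp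
  finally show ?thesis using Hp 1 2 by blast
qed

section \<open>Cutting off the half-lines\<close>

lemma half_line_interval:
  assumes "e \<in> half_lines G" shows "e \<in> edges G" "oi e = {0<..}" "ei e = {0..}" "len G e = \<infinity>"
  using assms by (auto simp: half_lines_def open_edge_interval_def edge_interval_def)

definition outer :: "real \<Rightarrow> (('v, 'e) point \<Rightarrow> real) \<Rightarrow> 'e \<Rightarrow> real \<Rightarrow> real" where
  "outer R u e t = eta R 1 t * on_edge G u e t"

definition outer' :: "real \<Rightarrow> (('v, 'e) point \<Rightarrow> real) \<Rightarrow> ('e \<Rightarrow> real \<Rightarrow> real) \<Rightarrow> 'e \<Rightarrow> real \<Rightarrow> real" where
  "outer' R u g e t = eta' R 1 t * on_edge G u e t + eta R 1 t * g e t"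

lemma outer_zero: "t \<le> R \<Longrightarrow> outer R u e t = 0" "t \<le> R \<Longrightarrow> outer' R u g e t = 0"
  using cut_low[of 1 t R] by (auto simp: outer_def outer'_def)

text \<open>The cutoff vanishes up to R > 0, so the outer part extends by zero across the origin of
  the half-line and becomes a function on the whole line.\<close>

lemma outer_h1:
  assumes h: "Hp G u g" and e: "e \<in> half_lines G" and R: "R > 0"
  shows "h1 (outer R u e) (outer' R u g e)"
    "sq (oi e) (outer R u e) = mass (outer R u e)"
    "en p (oi e) (outer R u e) (outer' R u g e) = en p UNIV (outer R u e) (outer' R u g e)"
    "sob (outer R u e) (outer' R u g e) (oi e)"
proof -
  note e' = half_line_interval[OF e]
  have s: "sob (outer R u e) (outer' R u g e) (oi e)" unfolding outer_def[abs_def] outer'_def[abs_def]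
    using sob_mult_cut(2)[OF Hp_sob[OF h e'(1)] interval_facts(1)[OF e'(1)], of 1 R] by simp
  then show "sob (outer R u e) (outer' R u g e) (oi e)" .
  have z: "outer R u e t = 0" "outer' R u g e t = 0" if "t \<notin> oi e" for t
    using outer_zero[of t R] that R e'(2) by auto
  have eq: "(\<lambda>t. indicator (oi e) t * (outer R u e t)\<^sup>2) = (\<lambda>t. (outer R u e t)\<^sup>2)"
    "(\<lambda>t. indicator (oi e) t * (outer' R u g e t)\<^sup>2) = (\<lambda>t. (outer' R u g e t)\<^sup>2)"
    "(\<lambda>t. indicator (oi e) t * ed p (outer R u e t) (outer' R u g e t)) = (\<lambda>t. ed p (outer R u e t) (outer' R u g e t))" for p
    using z by (auto simp: indicator_def fun_eq_iff ed_def)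
  show "sq (oi e) (outer R u e) = mass (outer R u e)"
    "en p (oi e) (outer R u e) (outer' R u g e) = en p UNIV (outer R u e) (outer' R u g e)"
    by (simp_all add: sq_def en_def eq)
  have w: "wd (outer R u e) (outer' R u g e) UNIV" unfolding outer_def[abs_def] outer'_def[abs_def]
    by (rule wd_mult_C1[OF sobD(1)[OF Hp_sob[OF h e'(1)]] eta_deriv continuous_eta', of "{R..}"])
      (use cut_low[of 1 _ R] e'(2) R in auto)
  have "continuous_on ({0<..} \<union> {..<R}) (outer R u e)"
  proof (rule continuous_on_open_Un)
    have "continuous_on {0<..} (on_edge G u e)"
      using h e' by (auto simp: Hp_def graph_continuous_def intro: continuous_on_subset)
    then show "continuous_on {0<..} (outer R u e)" unfolding outer_def[abs_def]
      by (intro continuous_intros continuous_eta)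
    show "continuous_on {..<R} (outer R u e)"
      using outer_zero(1)[of _ R u e] by (simp cong: continuous_on_cong_simp)
  qed auto
  moreover have "{0<..} \<union> {..<R} = UNIV" using R by auto
  ultimately show "h1 (outer R u e) (outer' R u g e)"
    using w sobD(2)[OF s] sobD(3)[OF s] by (simp add: h1_def sob_def eq)
qed

text \<open>Only half-lines are cut, and \<open>chi\<close> is 1 near the origin as R > 0; bounded
  edges and all vertex values stay untouched. The vertex term therefore goes entirely with the inner
  part.\<close>

lemma graph_cut:
  assumes h: "Hp G u g" and R: "R > 0" and p: "2 < p"
  shows "\<exists>u0 g0. Hp G u0 g0 \<and> (\<forall>v. u0 (Vertex v) = u (Vertex v)) \<and>
    gmass G u = gmass G u0 + (\<Sum>e\<in>half_lines G. mass (outer R u e)) \<and>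
    gen p G u0 g0 + (\<Sum>e\<in>half_lines G. en p UNIV (outer R u e) (outer' R u g e))
      \<le> gen p G u g + (\<Sum>e\<in>half_lines G. cint p 1 (on_edge G u e) (oi e) {R..<R+1})"
proof -
  define c where "c e t = (if e \<in> half_lines G then chi R 1 t else 1)" for e t
  define u0 where "u0 z = (case z of Vertex w \<Rightarrow> u (Vertex w) | Interior e t \<Rightarrow> c e t * u (Interior e t))" for z
  define g0 where "g0 e t = (if e \<in> half_lines G then chi' R 1 t * on_edge G u e t + chi R 1 t * g e t else g e t)" for e t
  have fH: "finite (half_lines G)" "half_lines G \<subseteq> edges G" using finite_edges by (auto simp: half_lines_def)
  have oe: "on_edge G u0 e = (\<lambda>t. c e t * on_edge G u e t)" if "e \<in> edges G" for e
  proof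
    fix t
    show "on_edge G u0 e t = c e t * on_edge G u e t"
      using cut_low(1)[of 1 0 R] R
      by (auto simp: on_edge_def edge_point_def u0_def c_def half_lines_def)
  qed
  have H: "Hp G u0 g0" unfolding Hp_def graph_continuous_def
  proof (intro conjI ballI)
    fix e assume e: "e \<in> edges G"
    show "continuous_on (ei e) (on_edge G u0 e)" unfolding oe[OF e] c_def[abs_def]
      using h e by (cases "e \<in> half_lines G") (auto simp: Hp_def graph_continuous_def intro!: continuous_intros continuous_chi)
    show "sob (on_edge G u0 e) (g0 e) (oi e)"
    proof (cases "e \<in> half_lines G")
      case True
      then show ?thesis unfolding oe[OF e] c_def[abs_def] g0_def[abs_def]
        using sob_mult_cut(1)[OF Hp_sob[OF h e] interval_facts(1)[OF e], of 1 R] by simp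
    next
      case False
      then show ?thesis unfolding oe[OF e] c_def[abs_def] g0_def[abs_def] using Hp_sob[OF h e] by simp
    qed
  qed
  have split: "(\<Sum>e\<in>edges G. a e) = (\<Sum>e\<in>edges G - half_lines G. a e) + (\<Sum>e\<in>half_lines G. a e)" for a :: "'e \<Rightarrow> real"
    by (rule sum.subset_diff[OF fH(2) finite_edges])
  have nh: "on_edge G u0 e = on_edge G u e" "g0 e = g e" if "e \<in> edges G - half_lines G" for e
    using that by (auto simp: oe c_def g0_def)
  have m: "sq (oi e) (on_edge G u e) = sq (oi e) (on_edge G u0 e) + mass (outer R u e)" if "e \<in> half_lines G" for e
  proof -
    have e: "e \<in> edges G" using that fH by auto
    have "on_edge G u0 e = (\<lambda>t. chi R 1 t * on_edge G u e t)" using that by (simp add: oe[OF e] c_def)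
    then show ?thesis using sq_cut[OF Hp_sob[OF h e] interval_facts(1)[OF e], of 1 R] outer_h1(2)[OF h that R]
      by (simp add: outer_def[abs_def])
  qed
  have gm: "gmass G u = gmass G u0 + (\<Sum>e\<in>half_lines G. mass (outer R u e))"
    unfolding gmass_def split by (simp add: nh m sum.distrib)
  have en1: "en p (oi e) (on_edge G u0 e) (g0 e) + en p UNIV (outer R u e) (outer' R u g e)
     \<le> en p (oi e) (on_edge G u e) (g e) + cint p 1 (on_edge G u e) (oi e) {R..<R+1}" if "e \<in> half_lines G" for e
  proof -
    have e: "e \<in> edges G" using that fH by auto
    have "on_edge G u0 e = (\<lambda>t. chi R 1 t * on_edge G u e t)" "g0 e = (\<lambda>t. chi' R 1 t * on_edge G u e t + chi R 1 t * g e t)"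
      using that by (auto simp: oe[OF e] c_def g0_def)
    then show ?thesis using en_cut[OF Hp_sob[OF h e] interval_facts(1)[OF e] edge_bdd_open[OF h e] p zero_less_one, of R]
        outer_h1(3)[OF h that R, of p]
      by (simp add: outer_def[abs_def] outer'_def[abs_def])
  qed
  have "(\<Sum>e\<in>half_lines G. en p (oi e) (on_edge G u0 e) (g0 e) + en p UNIV (outer R u e) (outer' R u g e))
    \<le> (\<Sum>e\<in>half_lines G. en p (oi e) (on_edge G u e) (g e) + cint p 1 (on_edge G u e) (oi e) {R..<R+1})"
    by (intro sum_mono en1)
  then have "gen p G u0 g0 + (\<Sum>e\<in>half_lines G. en p UNIV (outer R u e) (outer' R u g e))
      \<le> gen p G u g + (\<Sum>e\<in>half_lines G. cint p 1 (on_edge G u e) (oi e) {R..<R+1})"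
    unfolding gen_def split by (simp add: nh sum.distrib)
  moreover have "\<forall>v. u0 (Vertex v) = u (Vertex v)" by (simp add: u0_def)
  ultimately show ?thesis using H gm by blast
qed

lemma outer_tail:
  assumes h: "Hp G u g" and e: "e \<in> half_lines G" and R: "R > 0"
  shows "sq (oi e \<inter> {R+1..}) (on_edge G u e) \<le> mass (outer R u e)"
proof -
  note e' = half_line_interval[OF e]
  have "sq (oi e \<inter> {R+1..}) (on_edge G u e) = sq (oi e \<inter> {R+1..}) (outer R u e)"
    by (rule sq_cong) (use cut_high(3)[of 1 R] in \<open>auto simp: outer_def\<close>)
  also have "\<dots> \<le> sq UNIV (outer R u e)"
    by (rule sq_mono_set) (use sobD(2)[OF h1_sob[OF outer_h1(1)[OF h e R]]] e' in auto)
  finally show ?thesis .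
qed

text \<open>Pigeonhole: the N unit strips on each half-line are disjoint, so their errors add up to
  at most the total, and some strip, common to all half-lines, pays at most the average.\<close>

lemma good_radius:
  assumes h: "Hp G u g" and p: "2 < p" and N: "N > 0"
  shows "\<exists>j<N. (\<Sum>e\<in>half_lines G. cint p 1 (on_edge G u e) (oi e) {1 + real j..<1 + real j + 1})
     \<le> (8 + gbd u g powr (p - 2) / p) * gmass G u / real N"
proof (rule ccontr)
  let ?E = "(8 + gbd u g powr (p - 2) / p) * gmass G u"
  let ?c = "\<lambda>j. (\<Sum>e\<in>half_lines G. cint p 1 (on_edge G u e) (oi e) {1 + real j..<1 + real j + 1})"
  assume "\<not> ?thesis"
  then have "(\<Sum>j<N. ?E / real N) < (\<Sum>j<N. ?c j)"
    using N by (intro sum_strict_mono) (auto simp: not_le)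
  then have "?E < (\<Sum>j<N. ?c j)" using N by simp
  also have "\<dots> = (\<Sum>e\<in>half_lines G. \<Sum>j<N. cint p 1 (on_edge G u e) (oi e) {1 + real j..<1 + real j + 1})"
    by (rule sum.swap)
  also have "\<dots> \<le> (\<Sum>e\<in>half_lines G. (8 + gbd u g powr (p - 2) / p) * sq (oi e) (on_edge G u e))"
  proof (rule sum_mono)
    fix e assume e: "e \<in> half_lines G"
    note e' = half_line_interval[OF e]
    note ci = cerr_integrable[OF Hp_sob[OF h e'(1)] interval_facts(1)[OF e'(1)] edge_bdd_open[OF h e'(1)] p, where L = 1]
    have "(\<Sum>j<N. cint p 1 (on_edge G u e) (oi e) {1 + real j..<1 + real j + 1}) = cint p 1 (on_edge G u e) (oi e) {1..<1 + real N * 1}"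
      using cint_sum[of "oi e" p 1 "on_edge G u e" 1 N] ci(1) by simp
    also have "\<dots> \<le> cint p 1 (on_edge G u e) (oi e) UNIV"
      by (rule cint_mono_set(1)) (use ci(1) p in auto)
    also have "\<dots> \<le> (8 + gbd u g powr (p - 2) / p) * sq (oi e) (on_edge G u e)"
      using ci(2)[of UNIV] by simp
    finally show "(\<Sum>j<N. cint p 1 (on_edge G u e) (oi e) {1 + real j..<1 + real j + 1}) \<le> (8 + gbd u g powr (p - 2) / p) * sq (oi e) (on_edge G u e)" .
  qed
  also have "\<dots> \<le> ?E" unfolding gmass_def sum_distrib_left
    by (rule sum_mono2) (use finite_edges p sq_nonneg in \<open>auto simp: half_lines_def intro!: mult_nonneg_nonneg add_nonneg_nonneg\<close>)
  finally show False by simp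
qed

end

section \<open>A compactly supported profile with negative energy\<close>

text \<open>A C^1 bump supported in [-1, 1] in place of the soliton. Only the order of magnitude of
  the negative energy is needed, and compact support lets the rescaled bump fit around the
  vertex.\<close>

definition prof :: "real \<Rightarrow> real" where "prof t = sstep (t + 1) - sstep t"
definition prof' :: "real \<Rightarrow> real" where "prof' t = sstep' (t + 1) - sstep' t"

lemma prof_zero: "\<bar>t\<bar> \<ge> 1 \<Longrightarrow> prof t = 0 \<and> prof' t = 0"
  unfolding prof_def prof'_def
  using sstep_le0[of t] sstep_le0[of "t+1"] sstep_ge1[of t] sstep_ge1[of "t+1"]
    sstep'_le0[of t] sstep'_le0[of "t+1"] sstep'_ge1[of t] sstep'_ge1[of "t+1"]
  by (cases "t \<ge> 1") auto

lemma prof_deriv: "(prof has_real_derivative prof' t) (at t)"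
  unfolding prof_def[abs_def] prof'_def by (auto intro!: derivative_eq_intros)

lemma continuous_prof': "continuous_on A prof'"
  unfolding prof'_def[abs_def]
  by (intro continuous_intros continuous_on_compose2[OF continuous_sstep'[of UNIV]]) auto

lemma continuous_prof: "continuous_on A prof"
  unfolding prof_def[abs_def]
  by (intro continuous_intros continuous_on_compose2[OF continuous_sstep[of UNIV]]) auto

lemma prof_ge_half: "t \<in> {-1/2..0} \<Longrightarrow> prof t \<ge> 1/2"
proof -
  assume t: "t \<in> {-1/2..0}"
  have "sstep (1/2) = 1/2" by (simp add: sstep_def max_def power2_eq_square)
  moreover have "sstep (1/2) \<le> sstep (t + 1)" using t by (intro sstep_mono) auto
  moreover have "sstep t = 0" using t by (intro sstep_le0) auto
  ultimately show ?thesis by (simp add: prof_def)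
qed

lemma integrable_compact_supp:
  fixes F :: "real \<Rightarrow> real"
  assumes "continuous_on UNIV F" "\<And>t. \<bar>t\<bar> \<ge> 1 \<Longrightarrow> F t = 0"
  shows "integrable lborel F"
proof -
  have "integrable lborel (\<lambda>t. indicator {-1..1} t *\<^sub>R F t)"
    by (rule borel_integrable_compact) (use assms in \<open>auto intro: continuous_on_subset\<close>)
  moreover have "(\<lambda>t. indicator {-1..1} t *\<^sub>R F t) = F"
  proof
    fix t show "indicator {-1..1} t *\<^sub>R F t = F t" using assms(2)[of t] by (cases "t \<in> {-1..1}") auto
  qed
  ultimately show ?thesis by simp
qed

lemma prof_integrable:
  "integrable lborel (\<lambda>t. (prof t)\<^sup>2)" "integrable lborel (\<lambda>t. (prof' t)\<^sup>2)"
  "p > 0 \<Longrightarrow> integrable lborel (\<lambda>t. \<bar>prof t\<bar> powr p)"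
  by (rule integrable_compact_supp; use prof_zero in \<open>auto intro!: continuous_intros continuous_on_powr' continuous_prof continuous_prof'\<close>)+

lemma integral_pos_of_lower:
  fixes F :: "real \<Rightarrow> real"
  assumes "integrable lborel F" "\<And>t. 0 \<le> F t" "\<And>t. t \<in> {-1/2..0} \<Longrightarrow> F t \<ge> c" "c > 0"
  shows "0 < (\<integral>t. F t \<partial>lborel)"
proof -
  have "c / 2 = (\<integral>t. indicator {-1/2..0} t * c \<partial>(lborel::real measure))" by simp
  also have "\<dots> \<le> (\<integral>t. F t \<partial>lborel)"
  proof (rule Bochner_Integration.integral_mono[OF _ assms(1)])
    show "integrable lborel (\<lambda>t. indicator {-1/2..0::real} t * c)"
      using borel_integrable_compact[of "{-1/2..0::real}" "\<lambda>_. c"] by simp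
    show "indicator {-1/2..0} t * c \<le> F t" for t using assms(2,3)[of t] by (auto simp: indicator_def)
  qed
  finally show ?thesis using assms(4) by linarith
qed

lemma scaled_profile:
  assumes L: "\<Lambda> > 0" and a: "a > 0" and p: "2 < p"
  defines "W \<equiv> \<lambda>t. a * prof (t / \<Lambda>)" and "W' \<equiv> \<lambda>t. a / \<Lambda> * prof' (t / \<Lambda>)"
  shows "h1 W W'" "\<And>t. \<bar>t\<bar> \<ge> \<Lambda> \<Longrightarrow> W t = 0 \<and> W' t = 0"
    "mass W = a\<^sup>2 * \<Lambda> * (\<integral>t. (prof t)\<^sup>2 \<partial>lborel)"
    "en p UNIV W W' = a\<^sup>2 / \<Lambda> * (\<integral>t. (prof' t)\<^sup>2 \<partial>lborel) / 2 - a powr p * \<Lambda> * (\<integral>t. \<bar>prof t\<bar> powr p \<partial>lborel) / p"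
proof -
  have sc: "integrable lborel (\<lambda>t. F (t / \<Lambda>))" "(\<integral>t. F (t / \<Lambda>) \<partial>lborel) = \<Lambda> * (\<integral>t. F t \<partial>lborel)"
    if "integrable lborel F" for F :: "real \<Rightarrow> real"
  proof -
    show "integrable lborel (\<lambda>t. F (t / \<Lambda>))"
      using lborel_integrable_real_affine[OF that, of "1 / \<Lambda>" 0] L by simp
    have "(\<integral>t. F (t / \<Lambda>) \<partial>lborel) = \<bar>\<Lambda>\<bar> *\<^sub>R (\<integral>x. F ((0 + \<Lambda> * x) / \<Lambda>) \<partial>lborel)"
      by (rule lborel_integral_real_affine) (use L in auto)
    then show "(\<integral>t. F (t / \<Lambda>) \<partial>lborel) = \<Lambda> * (\<integral>t. F t \<partial>lborel)" using L by simp
  qed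
  have p0: "0 < p" using p by simp
  have e: "(\<lambda>t. (W t)\<^sup>2) = (\<lambda>t. a\<^sup>2 * (prof (t / \<Lambda>))\<^sup>2)" "(\<lambda>t. (W' t)\<^sup>2) = (\<lambda>t. (a / \<Lambda>)\<^sup>2 * (prof' (t / \<Lambda>))\<^sup>2)"
    "(\<lambda>t. \<bar>W t\<bar> powr p) = (\<lambda>t. a powr p * \<bar>prof (t / \<Lambda>)\<bar> powr p)"
    using a by (auto simp: W_def W'_def power_mult_distrib abs_powr_mult power_divide)
  have i: "integrable lborel (\<lambda>t. (W t)\<^sup>2)" "integrable lborel (\<lambda>t. (W' t)\<^sup>2)"
    unfolding e using sc(1)[OF prof_integrable(1)] sc(1)[OF prof_integrable(2)] by auto
  have d: "(W has_real_derivative W' t) (at t)" for t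
  proof -
    have "((\<lambda>t. t / \<Lambda>) has_real_derivative 1 / \<Lambda>) (at t)" by (intro DERIV_cdivide DERIV_ident)
    from DERIV_cmult[OF DERIV_chain2[OF prof_deriv this], of a]
    show ?thesis by (simp add: W_def W'_def field_simps)
  qed
  have "continuous_on UNIV W'" unfolding W'_def
    by (intro continuous_intros continuous_on_compose2[OF continuous_prof'[of UNIV]]) (use L in auto)
  with d have "wd W W' UNIV" by (rule wd_C1)
  moreover have "continuous_on UNIV W" using d DERIV_continuous_on by blast
  ultimately show h: "h1 W W'" using i by (simp add: h1_def sob_def)
  show "W t = 0 \<and> W' t = 0" if "\<bar>t\<bar> \<ge> \<Lambda>" for t
    using prof_zero[of "t / \<Lambda>"] that L by (simp add: W_def W'_def)
  show "mass W = a\<^sup>2 * \<Lambda> * (\<integral>t. (prof t)\<^sup>2 \<partial>lborel)"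
    unfolding sq_def using sc(2)[OF prof_integrable(1)] by (simp add: e)
  have "mass W' = a\<^sup>2 / \<Lambda> * (\<integral>t. (prof' t)\<^sup>2 \<partial>lborel)"
  proof -
    have "mass W' = (a / \<Lambda>)\<^sup>2 * (\<Lambda> * (\<integral>t. (prof' t)\<^sup>2 \<partial>lborel))"
      unfolding sq_def using sc(2)[OF prof_integrable(2)] by (simp add: e)
    moreover have "(a / \<Lambda>)\<^sup>2 * \<Lambda> = a\<^sup>2 / \<Lambda>" using L by (simp add: power2_eq_square)
    ultimately show ?thesis by (simp only: mult.assoc[symmetric])
  qed
  moreover have "pint p UNIV W = a powr p * \<Lambda> * (\<integral>t. \<bar>prof t\<bar> powr p \<partial>lborel)"
    unfolding pint_def using sc(2)[OF prof_integrable(3)[OF p0]] by (simp add: e)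
  ultimately show "en p UNIV W W' = a\<^sup>2 / \<Lambda> * (\<integral>t. (prof' t)\<^sup>2 \<partial>lborel) / 2 - a powr p * \<Lambda> * (\<integral>t. \<bar>prof t\<bar> powr p \<partial>lborel) / p"
    using sob_en(2)[OF h1_sob[OF h] open_UNIV h1_bdd[OF h] p] by simp
qed

text \<open>The natural scaling: height $h$, width $h^{-(p-2)/2}$, mass $h^{(6-p)/2}$, energy
  $h^{(p+2)/2}$.\<close>

lemma negative_profile:
  fixes p :: real
  assumes p: "2 < p" "p < 6"
  obtains c0 \<sigma> where "c0 > 0" "\<sigma> > 0"
    "\<And>h. h > 0 \<Longrightarrow> \<exists>W W'. h1 W W' \<and> (\<forall>t. \<bar>t\<bar> \<ge> \<sigma> * h powr (- (p - 2) / 2) \<longrightarrow> W t = 0 \<and> W' t = 0) \<and>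
       mass W = h powr ((6 - p) / 2) \<and> en p UNIV W W' = - (c0 * h powr ((p + 2) / 2))"
proof -
  define m0 where "m0 = (\<integral>t. (prof t)\<^sup>2 \<partial>lborel)"
  define K0 where "K0 = (\<integral>t. (prof' t)\<^sup>2 \<partial>lborel)"
  define P0 where "P0 = (\<integral>t. \<bar>prof t\<bar> powr p \<partial>lborel)"
  have p0: "0 < p" using p by simp
  have m0: "m0 > 0" unfolding m0_def
  proof (rule integral_pos_of_lower[OF prof_integrable(1), of "(1/2)\<^sup>2"])
    show "(1/2)\<^sup>2 \<le> (prof t)\<^sup>2" if "t \<in> {-1/2..0}" for t
      by (rule power_mono[OF prof_ge_half[OF that]]) simp
  qed auto
  have P0: "P0 > 0" unfolding P0_def
  proof (rule integral_pos_of_lower[OF prof_integrable(3)[OF p0], of "(1/2) powr p"])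
    show "(1/2) powr p \<le> \<bar>prof t\<bar> powr p" if "t \<in> {-1/2..0}" for t
      using prof_ge_half[OF that] p by (intro powr_mono2) auto
  qed auto
  have K0: "K0 \<ge> 0" by (simp add: K0_def)
  \<comment> \<open>At fixed mass, stretching by \<sigma> multiplies the kinetic energy by
    \<sigma>^(-2) and the potential energy by \<sigma>^(1-p/2), so their ratio shifts by
    \<sigma>^(3-p/2), with positive exponent as p < 6. X is the ratio beyond which the energy is
    negative; the summand 1 makes this strict.\<close>
  define X where "X = 1 + K0 / (2 * m0) * (p * m0 powr (p / 2) / P0)"
  have X: "X > 0" using K0 m0 P0 p by (auto simp: X_def intro!: add_pos_nonneg mult_nonneg_nonneg divide_nonneg_nonneg)
  define \<sigma> where "\<sigma> = X powr (1 / (3 - p / 2))"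
  have \<sigma>: "\<sigma> > 0" using X by (simp add: \<sigma>_def)
  have \<sigma>X: "\<sigma> powr (3 - p / 2) = X" using X p by (simp add: \<sigma>_def powr_powr)
  define c0 where "c0 = \<sigma> * (\<sigma> * m0) powr (- p / 2) * P0 / p - K0 / (2 * \<sigma>\<^sup>2 * m0)"
  have c0: "c0 > 0"
  proof -
    have "K0 / (2 * m0) < X * P0 / (p * m0 powr (p / 2))"
      using m0 P0 p by (simp add: X_def field_simps)
    also have "X = \<sigma>\<^sup>2 * (\<sigma> * \<sigma> powr (- p / 2))"
    proof -
      have "3 - p / 2 = 2 + (1 + - p / 2)" by simp
      then have "X = \<sigma> powr (2 + (1 + - p / 2))" using \<sigma>X by simp
      also have "\<dots> = \<sigma> powr 2 * (\<sigma> powr 1 * \<sigma> powr (- p / 2))" by (simp only: powr_add)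
      also have "\<dots> = \<sigma>\<^sup>2 * (\<sigma> * \<sigma> powr (- p / 2))" using \<sigma> by simp
      finally show ?thesis .
    qed
    also have "\<sigma>\<^sup>2 * (\<sigma> * \<sigma> powr (- p / 2)) * P0 / (p * m0 powr (p / 2)) = \<sigma>\<^sup>2 * (\<sigma> * (\<sigma> * m0) powr (- p / 2) * P0 / p)"
      using \<sigma> m0 by (simp add: powr_mult powr_minus field_simps)
    finally have lt: "K0 / (2 * m0) < \<sigma>\<^sup>2 * (\<sigma> * (\<sigma> * m0) powr (- p / 2) * P0 / p)" .
    have s2: "\<sigma>\<^sup>2 > 0" using \<sigma> by simp
    have "K0 / (2 * m0) / \<sigma>\<^sup>2 < \<sigma> * (\<sigma> * m0) powr (- p / 2) * P0 / p"
      using divide_strict_right_mono[OF lt s2] s2 by (simp only: nonzero_mult_div_cancel_left less_imp_neq[symmetric] not_False_eq_True)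
    moreover have "K0 / (2 * m0) / \<sigma>\<^sup>2 = K0 / (2 * \<sigma>\<^sup>2 * m0)" by simp
    ultimately show ?thesis by (simp only: c0_def diff_gt_0_iff_gt)
  qed
  have "\<exists>W W'. h1 W W' \<and> (\<forall>t. \<bar>t\<bar> \<ge> \<sigma> * h powr (- (p - 2) / 2) \<longrightarrow> W t = 0 \<and> W' t = 0) \<and>
       mass W = h powr ((6 - p) / 2) \<and> en p UNIV W W' = - (c0 * h powr ((p + 2) / 2))" if h: "h > 0" for h
  proof -
    \<comment> \<open>L is the natural width at height h. The actual width is \<sigma> L, and the
      amplitude a below is fixed by requiring the mass h^2 L.\<close>
    define L where "L = h powr (- (p - 2) / 2)"
    define a where "a = h * (\<sigma> * m0) powr (- 1 / 2)"
    have L: "\<sigma> * L > 0" using \<sigma> h by (simp add: L_def)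
    have a: "a > 0" using h \<sigma> m0 by (simp add: a_def)
    have sm: "((\<sigma> * m0) powr (- 1 / 2))\<^sup>2 = 1 / (\<sigma> * m0)"
    proof -
      have "((\<sigma> * m0) powr (- 1 / 2))\<^sup>2 = (\<sigma> * m0) powr (- 1 / 2 + - 1 / 2)" by (simp only: powr_add power2_eq_square)
      also have "- 1 / 2 + - 1 / 2 = (- 1 :: real)" by simp
      also have "(\<sigma> * m0) powr - 1 = 1 / (\<sigma> * m0)" using \<sigma> m0 by (simp add: powr_minus_divide)
      finally show ?thesis .
    qed
    have h2: "h\<^sup>2 = h powr 2" using h by simp
    have a2: "a\<^sup>2 = h\<^sup>2 / (\<sigma> * m0)" unfolding a_def power_mult_distrib sm by simp
    have ap: "a powr p = h powr p * (\<sigma> * m0) powr (- p / 2)"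
      using h \<sigma> m0 by (simp add: a_def powr_mult powr_powr)
    note sp = scaled_profile[OF L a p(1)]
    have hL: "h\<^sup>2 * L = h powr ((6 - p) / 2)" "h\<^sup>2 / L = h powr ((p + 2) / 2)" "h powr p * L = h powr ((p + 2) / 2)"
    proof -
      have "h\<^sup>2 * L = h powr (2 + - (p - 2) / 2)" by (simp only: powr_add h2 L_def)
      also have "2 + - (p - 2) / 2 = (6 - p) / 2" by (simp add: field_simps)
      finally show "h\<^sup>2 * L = h powr ((6 - p) / 2)" .
      have "h\<^sup>2 / L = h powr (2 - - (p - 2) / 2)" by (simp only: powr_diff h2 L_def)
      also have "2 - - (p - 2) / 2 = (p + 2) / 2" by (simp add: field_simps)
      finally show "h\<^sup>2 / L = h powr ((p + 2) / 2)" .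
      have "h powr p * L = h powr (p + - (p - 2) / 2)" by (simp only: powr_add L_def)
      also have "p + - (p - 2) / 2 = (p + 2) / 2" by (simp add: field_simps)
      finally show "h powr p * L = h powr ((p + 2) / 2)" .
    qed
    have "a\<^sup>2 * (\<sigma> * L) * m0 = h powr ((6 - p) / 2)"
      unfolding a2 hL(1)[symmetric] using \<sigma> m0 by simp
    moreover have "a\<^sup>2 / (\<sigma> * L) * K0 / 2 - a powr p * (\<sigma> * L) * P0 / p = - (c0 * h powr ((p + 2) / 2))"
    proof -
      have "a\<^sup>2 / (\<sigma> * L) = (h\<^sup>2 / L) / (\<sigma>\<^sup>2 * m0)" unfolding a2 by (simp add: power2_eq_square)
      moreover have "a powr p * (\<sigma> * L) = (h powr p * L) * (\<sigma> * (\<sigma> * m0) powr (- p / 2))" unfolding ap by simp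
      ultimately show ?thesis by (simp only: hL c0_def) (simp add: algebra_simps)
    qed
    ultimately show ?thesis using sp unfolding m0_def[symmetric] K0_def[symmetric] P0_def[symmetric] L_def[symmetric]
      by (intro exI conjI allI impI) auto
  qed
  then show ?thesis using that[of c0 \<sigma>] c0 \<sigma> by blast
qed

section \<open>Coercivity of the energy at fixed mass\<close>

lemma young_powr:
  fixes a \<epsilon> :: real
  assumes "0 < a" "a < 4" "\<epsilon> > 0"
  shows "\<exists>C\<ge>0. \<forall>x\<ge>0. x powr a \<le> \<epsilon> * x powr 4 + C"
proof -
  \<comment> \<open>The threshold at which \<epsilon> x^4 overtakes x^a; below it the constant x0^a
    suffices.\<close>
  define x0 where "x0 = (1 / \<epsilon>) powr (1 / (4 - a))"
  have x0: "x0 > 0" using assms by (simp add: x0_def)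
  have "x powr a \<le> \<epsilon> * x powr 4 + x0 powr a" if "x \<ge> 0" for x
  proof (cases "x \<ge> x0")
    case True
    have "1 / \<epsilon> = x0 powr (4 - a)" using assms by (simp add: x0_def powr_powr)
    also have "\<dots> \<le> x powr (4 - a)" using True x0 assms by (intro powr_mono2) auto
    finally have "1 \<le> \<epsilon> * x powr (4 - a)" using assms by (simp add: field_simps)
    then have "1 * x powr a \<le> \<epsilon> * x powr (4 - a) * x powr a" by (intro mult_right_mono) auto
    also have "\<dots> = \<epsilon> * x powr 4" by (simp add: powr_add[symmetric] mult.assoc)
    finally show ?thesis by (simp add: add_increasing2)
  next
    case False
    then have "x powr a \<le> x0 powr a" using that assms by (intro powr_mono2) auto
    then show ?thesis using assms by (simp add: add_increasing)
  qed
  then show ?thesis by (intro exI[of _ "x0 powr a"]) auto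
qed

context metric_graph
begin

text \<open>The nonlinear terms are bounded by the powers p - 2 and q of the sup bound, both below
  4, while its fourth power is affine in the kinetic energy. Each term may absorb one eighth of the
  kinetic energy, which leaves 1/2 - 1/8 - 1/8 = 1/4.\<close>

lemma coercive:
  assumes nc: "noncompact_graph G" and p: "2 < p" "p < 6" and q: "2 < q" "q < 4" and \<mu>: "\<mu> > 0"
  shows "\<exists>C. \<forall>u g. Hp G u g \<longrightarrow> gmass G u = \<mu> \<longrightarrow> gkin G g / 4 - C \<le> energy p q u G"
proof -
  define n where "n = real (card (verts G))"
  \<comment> \<open>Solves (\<mu> / p) \<epsilon>1 16 \<mu> = 1/8; \<open>\<epsilon>2\<close> plays
    the same part for the vertex term. There n + 1 instead of n avoids a zero denominator, at the
    cost of a factor n / (n + 1) below 1.\<close>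
  define \<epsilon>1 where "\<epsilon>1 = p / (128 * \<mu>\<^sup>2)"
  define \<epsilon>2 where "\<epsilon>2 = q / (8 * (n + 1) * (16 * \<mu>))"
  have n0: "n \<ge> 0" by (simp add: n_def)
  have pos: "\<epsilon>1 > 0" "\<epsilon>2 > 0" using p q \<mu> n0 by (auto simp: \<epsilon>1_def \<epsilon>2_def)
  obtain C1 where C1: "C1 \<ge> 0" "\<And>x. x \<ge> 0 \<Longrightarrow> x powr (p - 2) \<le> \<epsilon>1 * x powr 4 + C1"
    using young_powr[of "p - 2" \<epsilon>1] p pos by auto
  obtain C2 where C2: "C2 \<ge> 0" "\<And>x. x \<ge> 0 \<Longrightarrow> x powr q \<le> \<epsilon>2 * x powr 4 + C2"
    using young_powr[of q \<epsilon>2] q pos by auto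
  define D where "D = 16 * \<mu>\<^sup>2 / dmin\<^sup>2"
  define C where "C = \<mu> / p * (\<epsilon>1 * D + C1) + n / q * (\<epsilon>2 * D + C2)"
  have "gkin G g / 4 - C \<le> energy p q u G" if h: "Hp G u g" and m: "gmass G u = \<mu>" for u g
  proof -
    define x where "x = gbd u g"
    define K where "K = gkin G g"
    have K: "K \<ge> 0" by (simp add: K_def gkin_nonneg)
    have x: "x \<ge> 0" "x powr 4 = 16 * \<mu> * K + D"
      using gbd4[of u g] m by (auto simp: x_def gbd_def K_def D_def)
    have "gpint p G u / p \<le> x powr (p - 2) * \<mu> / p"
      using gpint_le[OF h p(1)] p m by (intro divide_right_mono) (auto simp: x_def)
    also have "\<dots> = \<mu> / p * x powr (p - 2)" by simp
    also have "\<dots> \<le> \<mu> / p * (\<epsilon>1 * (16 * \<mu> * K + D) + C1)"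
      using C1(2)[OF x(1)] x(2) p \<mu> by (intro mult_left_mono) auto
    also have "\<dots> = K / 8 + \<mu> / p * (\<epsilon>1 * D + C1)"
      using p \<mu> by (simp add: \<epsilon>1_def field_simps power2_eq_square)
    finally have 1: "gpint p G u / p \<le> K / 8 + \<mu> / p * (\<epsilon>1 * D + C1)" .
    have "gver q G u \<le> (\<Sum>v\<in>verts G. x powr q)"
      unfolding gver_def x_def using vertex_bdd[OF nc h] q by (intro sum_mono powr_mono2) auto
    then have "gver q G u / q \<le> n * x powr q / q" using q by (intro divide_right_mono) (auto simp: n_def)
    also have "\<dots> = n / q * x powr q" by simp
    also have "\<dots> \<le> n / q * (\<epsilon>2 * (16 * \<mu> * K + D) + C2)"
      using C2(2)[OF x(1)] x(2) q n0 by (intro mult_left_mono) auto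
    also have "\<dots> = K / 8 * (n / (n + 1)) + n / q * (\<epsilon>2 * D + C2)"
    proof -
      have "\<epsilon>2 * (16 * \<mu>) = q / (8 * (n + 1))" unfolding \<epsilon>2_def using \<mu> by (simp only: times_divide_eq_left) simp
      then have "n / q * (\<epsilon>2 * (16 * \<mu>) * K) = K / 8 * (n / (n + 1))" using q by simp
      moreover have "n / q * (\<epsilon>2 * (16 * \<mu> * K + D) + C2) = n / q * (\<epsilon>2 * (16 * \<mu>) * K) + n / q * (\<epsilon>2 * D + C2)"
        by (simp only: distrib_left mult.assoc)
      ultimately show ?thesis by linarith
    qed
    also have "\<dots> \<le> K / 8 * 1 + n / q * (\<epsilon>2 * D + C2)"
    proof -
      have "n / (n + 1) \<le> 1" using n0 by simp
      from mult_left_mono[OF this, of "K / 8"] K show ?thesis by simp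
    qed
    finally have 2: "gver q G u / q \<le> K / 8 + n / q * (\<epsilon>2 * D + C2)" by simp
    have "energy p q u G = K / 2 - gpint p G u / p - gver q G u / q"
      using energy_eq[OF h p(1)] gen_eq[OF h p(1)] by (simp add: K_def)
    then show ?thesis using 1 2 unfolding C_def K_def[symmetric] by linarith
  qed
  then show ?thesis by blast
qed

section \<open>The energy gap for functions living on the half-lines\<close>

lemma affine_invariance:
  assumes "h1 f g"
  shows "mass (\<lambda>t. f (c + 1 * t)) = mass f" "en p UNIV (\<lambda>t. f (c + 1 * t)) (\<lambda>t. 1 * g (c + 1 * t)) = en p UNIV f g"
proof -
  have "(\<integral>t. \<Phi> t \<partial>lborel) = (\<integral>t. \<Phi> (c + t) \<partial>lborel)" for \<Phi> :: "real \<Rightarrow> real"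
    using lborel_integral_real_affine[of 1 \<Phi> c] by simp
  from this[of "\<lambda>t. (f t)\<^sup>2"] this[of "\<lambda>t. ed p (f t) (g t)"]
  show "mass (\<lambda>t. f (c + 1 * t)) = mass f" "en p UNIV (\<lambda>t. f (c + 1 * t)) (\<lambda>t. 1 * g (c + 1 * t)) = en p UNIV f g"
    by (simp_all add: sq_def en_def)
qed

text \<open>A function concentrated in a short window gains by being moved to the vertex of degree two
  and centred at its maximum, unless it is too flat to have energy near $J$.\<close>

lemma window_gap:
  assumes v: "v \<in> verts G" "vertex_degree G v = 2" and p: "2 < p" "p < 6" and q: "2 < q" and \<mu>: "\<mu> > 0"
    and lb: "\<And>w. w \<in> H1_mass G \<mu> \<Longrightarrow> J \<le> energy p q w G"
    and h0: "h0 > 0" and S: "S \<le> J + h0 powr q / q" "S \<le> - (\<mu> * h0 powr (p - 2) / p)"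
    and z: "h1 z z'" and supp: "\<And>t. t \<notin> {x..x + dmin / 2} \<Longrightarrow> z t = 0 \<and> z' t = 0" and m: "mass z \<le> \<mu>"
  shows "S / \<mu> * mass z \<le> en p UNIV z z'"
proof (cases "mass z = 0")
  case True
  then show ?thesis using h1_energy_lower[OF z p] by simp
next
  case False
  then have mp: "mass z > 0" using sq_nonneg[of UNIV z] by linarith
  have cz: "continuous_on UNIV z" using z by (simp add: h1_def)
  have "continuous_on {x..x + dmin / 2} (\<lambda>t. \<bar>z t\<bar>)"
    by (intro continuous_on_rabs continuous_on_subset[OF cz]) simp
  moreover have "{x..x + dmin / 2} \<noteq> {}" using dmin(1) by simp
  ultimately obtain x0 where x0: "x0 \<in> {x..x + dmin / 2}" "\<And>t. t \<in> {x..x + dmin / 2} \<Longrightarrow> \<bar>z t\<bar> \<le> \<bar>z x0\<bar>"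
    using continuous_attains_sup[of "{x..x + dmin / 2}" "\<lambda>t. \<bar>z t\<bar>"] by (metis compact_Icc)
  define M where "M = \<bar>z x0\<bar>"
  have M: "\<bar>z t\<bar> \<le> M" for t
    using x0(2)[of t] supp[of t] by (cases "t \<in> {x..x + dmin / 2}") (auto simp: M_def)
  define k where "k = \<mu> / mass z"
  have k: "k \<ge> 1" using m mp by (simp add: k_def)
  have sk: "S / k = S / \<mu> * mass z" by (simp add: k_def)
  show ?thesis
  \<comment> \<open>\<open>sqrt k * M\<close> is the maximum after rescaling to mass \<mu>, and that
    is the height which the vertex term sees.\<close>
  proof (cases "sqrt k * M \<ge> h0")
    case True
    let ?W = "\<lambda>t. z (x0 + 1 * t)" and ?W' = "\<lambda>t. 1 * z' (x0 + 1 * t)"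
    have "h1 ?W ?W'" by (rule h1_affine[OF z]) simp
    moreover have "?W t = 0 \<and> ?W' t = 0" if "\<bar>t\<bar> \<ge> dmin" for t
    proof -
      \<comment> \<open>Recentring at a point of the window keeps the support within
        \<open>dmin / 2\<close> of 0, so the piece fits around the vertex wherever its maximum
        lies.\<close>
      have "x0 + 1 * t \<notin> {x..x + dmin / 2}" using that x0(1) dmin(1) by (cases "t \<ge> 0") auto
      from supp[OF this] show ?thesis by simp
    qed
    ultimately have "\<exists>u g. Hp G u g \<and> gmass G u = mass ?W \<and> gen p G u g = en p UNIV ?W ?W' \<and> gver q G u = \<bar>?W 0\<bar> powr q"
      using transplant[OF v dmin(2) dmin(1) _ _ p(1), of ?W ?W' q] by blast
    then obtain u g where ug: "Hp G u g" "gmass G u = mass z" "gen p G u g = en p UNIV z z'" "gver q G u = M powr q"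
      unfolding affine_invariance[OF z] by (auto simp: M_def)
    have "J \<le> k * en p UNIV z z' - k powr (q / 2) * M powr q / q"
      unfolding k_def ug(2-4)[symmetric] by (rule scale_up[OF lb ug(1) p(1)]) (use q ug mp m in auto)
    moreover have "h0 powr q \<le> k powr (q / 2) * M powr q"
    proof -
      have "h0 powr q \<le> (sqrt k * M) powr q" using True h0 q by (intro powr_mono2) auto
      also have "\<dots> = k powr (q / 2) * M powr q"
        using k by (simp add: powr_mult powr_half_sqrt[symmetric] powr_powr)
      finally show ?thesis .
    qed
    then have "h0 powr q / q \<le> k powr (q / 2) * M powr q / q" using q by (intro divide_right_mono) auto
    ultimately have "S \<le> k * en p UNIV z z'" using S(1) by linarith
    then have "S / k \<le> en p UNIV z z'" using k by (simp add: pos_divide_le_eq mult.commute)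
    then show ?thesis unfolding sk .
  next
    case False
    \<comment> \<open>The flat case uses no vertex: a low maximum limits the potential energy, and
      the second bound on S states that this is already too little.\<close>
    have "1 * M \<le> sqrt k * M" using k by (intro mult_right_mono) (auto simp: M_def)
    then have Mh: "M \<le> h0" using False by linarith
    have "pint p UNIV z / p \<le> M powr (p - 2) * mass z / p"
      using sob_powr(2)[OF h1_sob[OF z] open_UNIV M p(1)] p by (intro divide_right_mono) auto
    also have "\<dots> \<le> h0 powr (p - 2) * mass z / p"
      using Mh p mp by (intro divide_right_mono mult_right_mono powr_mono2) (auto simp: M_def)
    finally have "- (h0 powr (p - 2) * mass z / p) \<le> en p UNIV z z'"
      using sob_en(2)[OF h1_sob[OF z] open_UNIV M p(1)] sq_nonneg[of UNIV z'] by simp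
    moreover have "S / k \<le> - (\<mu> * h0 powr (p - 2) / p) / k" using S(2) k by (intro divide_right_mono) auto
    moreover have "- (\<mu> * h0 powr (p - 2) / p) / k = - (h0 powr (p - 2) * mass z / p)"
      using \<mu> by (simp add: k_def)
    ultimately show ?thesis unfolding sk by linarith
  qed
qed

text \<open>The gap is produced for every lower bound J of the energies; the threshold
  \<open>\<mu>0\<close> does not depend on J. It suffices to know that J lies below the energy of
  the transplanted profile.\<close>

lemma half_line_gap:
  assumes v: "v \<in> verts G" "vertex_degree G v = 2" and p: "2 < p" "p < 6" and q: "2 < q" "q < 4"
  shows "\<exists>\<mu>0>0. \<forall>\<mu>\<ge>\<mu>0. H1_mass G \<mu> \<noteq> {} \<and>
    (\<forall>J. (\<forall>w\<in>H1_mass G \<mu>. J \<le> energy p q w G) \<longrightarrow>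
      (\<exists>\<gamma>>0. \<forall>f g. h1 f g \<longrightarrow> (\<forall>t<0. f t = 0 \<and> g t = 0) \<longrightarrow> mass f \<le> \<mu> \<longrightarrow> (J + \<gamma>) / \<mu> * mass f \<le> en p UNIV f g))"
proof -
  obtain c0 \<sigma> where c0: "c0 > 0" "\<sigma> > 0"
    "\<And>h. h > 0 \<Longrightarrow> \<exists>W W'. h1 W W' \<and> (\<forall>t. \<bar>t\<bar> \<ge> \<sigma> * h powr (- (p - 2) / 2) \<longrightarrow> W t = 0 \<and> W' t = 0) \<and>
       mass W = h powr ((6 - p) / 2) \<and> en p UNIV W W' = - (c0 * h powr ((p + 2) / 2))"
    using negative_profile[OF p] by blast
  \<comment> \<open>Pieces lower than \<kappa> h count as flat: \<mu> (\<kappa> h)^(p-2) / p is then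
    exactly half of the energy c0 h^((p+2)/2) gained by the profile.\<close>
  define \<kappa> where "\<kappa> = (p * c0 / 2) powr (1 / (p - 2))"
  have \<kappa>: "\<kappa> > 0" "\<kappa> powr (p - 2) = p * c0 / 2" using p c0 by (auto simp: \<kappa>_def powr_powr)
  define d where "d = dmin / 2"
  have d: "d > 0" using dmin(1) by (simp add: d_def)
  \<comment> \<open>C1 h^(p-2) is the cutting cost per unit mass before averaging. Averaging over N
    positions with 1/N <= 4 L / d turns it into the total cost C2 h^2.\<close>
  define C1 where "C1 = 8 + 16 powr ((p - 2) / (6 - p)) / p"
  define C2 where "C2 = 4 * C1 / d"
  define A where "A = \<kappa> powr q / q"
  have pos: "A > 0" "c0 / 2 > 0" using \<kappa> q c0 by (auto simp: A_def)
  have ex: "- (p - 2) / 2 < 0" "q - 2 > 0" "(p + 2) / 2 - 2 > 0" using p q by auto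
  have lim0: "((\<lambda>h::real. c * h powr (- (p - 2) / 2)) \<longlongrightarrow> 0) at_top" for c
    by (intro tendsto_mult_right_zero tendsto_neg_powr ex(1) filterlim_ident)
  \<comment> \<open>The requirements on h: the profile fits around the vertex, a window holds at
    least four strip widths, and both gains, of order h^q and h^((p+2)/2), exceed the cutting cost
    C2 h^2.\<close>
  have "\<forall>\<^sub>F h in at_top. \<sigma> * h powr (- (p - 2) / 2) < dmin" by (rule order_tendstoD(2)[OF lim0 dmin(1)])
  moreover have "\<forall>\<^sub>F h in at_top. 4 * h powr (- (p - 2) / 2) < d" by (rule order_tendstoD(2)[OF lim0 d])
  moreover have pt: "filterlim (\<lambda>h::real. h powr r) at_top at_top" if "r > 0" for r
    using that by real_asymp
  have "\<forall>\<^sub>F h in at_top. h powr (q - 2) > C2 / A"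
    using pt[OF ex(2)] unfolding filterlim_at_top_dense by blast
  moreover have "\<forall>\<^sub>F h in at_top. h powr ((p + 2) / 2 - 2) > C2 / (c0 / 2)"
    using pt[OF ex(3)] unfolding filterlim_at_top_dense by blast
  moreover have "\<forall>\<^sub>F h in at_top. h > (0::real)" by (rule eventually_gt_at_top)
  ultimately have "\<forall>\<^sub>F h in at_top. \<sigma> * h powr (- (p - 2) / 2) < dmin \<and> 4 * h powr (- (p - 2) / 2) < d \<and>
    h powr (q - 2) > C2 / A \<and> h powr ((p + 2) / 2 - 2) > C2 / (c0 / 2) \<and> h > 0"
    by eventually_elim auto
  then obtain h1' where h1': "\<And>h. h \<ge> h1' \<Longrightarrow> \<sigma> * h powr (- (p - 2) / 2) < dmin \<and> 4 * h powr (- (p - 2) / 2) < d \<and>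
    h powr (q - 2) > C2 / A \<and> h powr ((p + 2) / 2 - 2) > C2 / (c0 / 2) \<and> h > 0"
    unfolding eventually_at_top_linorder by blast
  define hm where "hm = max 1 h1'"
  have main: "H1_mass G \<mu> \<noteq> {} \<and>
    (\<forall>J. (\<forall>w\<in>H1_mass G \<mu>. J \<le> energy p q w G) \<longrightarrow>
      (\<exists>\<gamma>>0. \<forall>f g. h1 f g \<longrightarrow> (\<forall>t<0. f t = 0 \<and> g t = 0) \<longrightarrow> mass f \<le> \<mu> \<longrightarrow> (J + \<gamma>) / \<mu> * mass f \<le> en p UNIV f g))"
    if \<mu>: "\<mu> \<ge> hm powr ((6 - p) / 2)" for \<mu>
  proof -
    \<comment> \<open>The height at which the natural scaling gives mass \<mu>.\<close>
    define h where "h = \<mu> powr (2 / (6 - p))"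
    have hm: "hm \<ge> 1" "hm \<ge> h1'" by (auto simp: hm_def)
    then have \<mu>p: "\<mu> > 0" using \<mu> less_le_trans[of 0 "hm powr ((6 - p) / 2)" \<mu>] by simp
    have "(6 - p) / 2 * (2 / (6 - p)) = 1" using p by simp
    then have "hm = (hm powr ((6 - p) / 2)) powr (2 / (6 - p))" using hm by (simp only: powr_powr) simp
    also have "\<dots> \<le> h" unfolding h_def using \<mu> p by (intro powr_mono2) auto
    finally have hh: "h \<ge> h1'" using hm by linarith
    note H = h1'[OF hh]
    have hp: "h > 0" using H by simp
    have "2 / (6 - p) * ((6 - p) / 2) = 1" using p by simp
    then have \<mu>h: "\<mu> = h powr ((6 - p) / 2)" unfolding h_def using \<mu>p by (simp only: powr_powr) simp
    define L where "L = h powr (- (p - 2) / 2)"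
    have L: "L > 0" "\<sigma> * L < dmin" "4 * L < d" using H hp by (auto simp: L_def)
    obtain W W' where W: "h1 W W'" "\<And>t. \<bar>t\<bar> \<ge> \<sigma> * L \<Longrightarrow> W t = 0 \<and> W' t = 0"
      "mass W = \<mu>" "en p UNIV W W' = - (c0 * h powr ((p + 2) / 2))"
      using c0(3)[OF hp] unfolding L_def[symmetric] \<mu>h[symmetric] by blast
    have "\<exists>u g. Hp G u g \<and> gmass G u = mass W \<and> gen p G u g = en p UNIV W W' \<and> gver q G u = \<bar>W 0\<bar> powr q"
      by (rule transplant[OF v dmin(2) dmin(1) W(1) _ p(1)]) (use W(2) L in auto)
    then obtain u g where ug: "Hp G u g" "gmass G u = \<mu>" "gen p G u g = - (c0 * h powr ((p + 2) / 2))"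
      using W by auto
    have uH: "u \<in> H1_mass G \<mu>" using Hp_imp_H1(1)[OF ug(1)] ug(2) by (simp add: H1_mass_iff)
    have eu: "energy p q u G \<le> - (c0 * h powr ((p + 2) / 2))"
      using energy_eq[OF ug(1) p(1), of q] ug(3) gver_nonneg[of q G u] q by simp
    have "\<exists>\<gamma>>0. \<forall>f g. h1 f g \<longrightarrow> (\<forall>t<0. f t = 0 \<and> g t = 0) \<longrightarrow> mass f \<le> \<mu> \<longrightarrow> (J + \<gamma>) / \<mu> * mass f \<le> en p UNIV f g"
      if lb: "\<forall>w\<in>H1_mass G \<mu>. J \<le> energy p q w G" for J
    proof -
      have J: "J \<le> - (c0 * h powr ((p + 2) / 2))" using lb uH eu by force
      \<comment> \<open>The first entry is the vertex gain of a tall window; the second keeps S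
        below the energy level that flat windows cannot reach, given that J is at most -c0
        h^((p+2)/2). Subtracting the cutting cost from this gap leaves \<gamma>.\<close>
      define gap where "gap = min (A * h powr q) (c0 / 2 * h powr ((p + 2) / 2))"
      define S where "S = J + gap"
      define \<gamma> where "\<gamma> = gap - C2 * h\<^sup>2"
      have C1p: "C1 > 0" using p by (auto simp: C1_def intro!: add_pos_nonneg)
      have C2p: "C2 > 0" using C1p d by (simp add: C2_def)
      have hq: "h powr q = h powr (q - 2) * h\<^sup>2" "h powr ((p + 2) / 2) = h powr ((p + 2) / 2 - 2) * h\<^sup>2"
      proof -
        have "h powr x = h powr (x - 2) * h\<^sup>2" for x
        proof -
          have "h powr (x - 2 + 2) = h powr (x - 2) * h powr 2" by (rule powr_add)
          then show ?thesis using hp by simp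
        qed
        then show "h powr q = h powr (q - 2) * h\<^sup>2" "h powr ((p + 2) / 2) = h powr ((p + 2) / 2 - 2) * h\<^sup>2" by blast+
      qed
      have "C2 < A * h powr (q - 2)" "C2 < c0 / 2 * h powr ((p + 2) / 2 - 2)"
        using H pos by (simp_all add: pos_divide_less_eq mult.commute)
      then have "C2 * h\<^sup>2 < A * h powr (q - 2) * h\<^sup>2" "C2 * h\<^sup>2 < c0 / 2 * h powr ((p + 2) / 2 - 2) * h\<^sup>2"
        using hp by (auto intro!: mult_strict_right_mono)
      then have \<gamma>: "\<gamma> > 0" unfolding \<gamma>_def gap_def hq by (simp add: mult.assoc)
      have Sle: "S \<le> - (c0 / 2 * h powr ((p + 2) / 2))" using J by (simp add: S_def gap_def min_def field_simps)
      then have S0: "S < 0" using c0 hp by (smt (verit) mult_pos_pos powr_gt_zero half_gt_zero)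
      have \<mu>hp: "\<mu> * h powr (p - 2) = h powr ((p + 2) / 2)"
      proof -
        have "\<mu> * h powr (p - 2) = h powr ((6 - p) / 2 + (p - 2))" unfolding \<mu>h by (simp only: powr_add)
        also have "(6 - p) / 2 + (p - 2) = (p + 2) / 2" by (simp add: field_simps)
        finally show ?thesis .
      qed
      have win: "S / \<mu> * mass z \<le> en p UNIV z z'"
        if z: "h1 z z'" "\<And>t. t \<notin> {x..x + d} \<Longrightarrow> z t = 0 \<and> z' t = 0" "mass z \<le> \<mu>" for z z' x
      proof (rule window_gap[OF v p q(1) \<mu>p, of J "\<kappa> * h"])
        show "S \<le> J + (\<kappa> * h) powr q / q" using \<kappa> hp q by (simp add: S_def gap_def A_def powr_mult)
        have "\<mu> * (\<kappa> * h) powr (p - 2) / p = \<kappa> powr (p - 2) / p * (\<mu> * h powr (p - 2))" using \<kappa> hp by (simp add: powr_mult)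
        also have "\<dots> = c0 / 2 * h powr ((p + 2) / 2)" unfolding \<mu>hp \<kappa>(2) using p by simp
        finally show "S \<le> - (\<mu> * (\<kappa> * h) powr (p - 2) / p)" using Sle by simp
      qed (use lb \<kappa> hp z in \<open>auto simp: d_def\<close>)
      \<comment> \<open>With this a, the lower bound of \<open>h1_energy_lower\<close> meets S /
        \<mu> per unit mass precisely up to the mass m1 defined next.\<close>
      define a where "a = p * (- S) / \<mu>"
      have a: "a > 0" unfolding a_def using S0 p \<mu>p by (intro divide_pos_pos mult_pos_pos) auto
      define m1 where "m1 = sqrt (a powr ((6 - p) / (p - 2)) / 16)"
      have m1: "m1 > 0" using a by (simp add: m1_def)
      have tail: "S / \<mu> * mass z \<le> en p UNIV z z'" if z: "h1 z z'" "mass z \<le> m1" for z z'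
      proof -
        have "(mass z)\<^sup>2 \<le> m1\<^sup>2" using z(2) sq_nonneg[of UNIV z] by (intro power_mono) auto
        also have "m1\<^sup>2 = a powr ((6 - p) / (p - 2)) / 16" using a by (simp add: m1_def)
        finally have "16 * (mass z)\<^sup>2 \<le> a powr ((6 - p) / (p - 2))" by simp
        then have "(16 * (mass z)\<^sup>2) powr ((p - 2) / (6 - p)) \<le> (a powr ((6 - p) / (p - 2))) powr ((p - 2) / (6 - p))"
          using p by (intro powr_mono2) auto
        also have "\<dots> = a" using p a by (simp add: powr_powr)
        finally have "(16 * (mass z)\<^sup>2) powr ((p - 2) / (6 - p)) * mass z / p \<le> a * mass z / p"
          using p sq_nonneg[of UNIV z] by (intro divide_right_mono mult_right_mono) auto
        also have "\<dots> = - (S / \<mu> * mass z)" using p by (simp add: a_def)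
        finally show ?thesis using h1_energy_lower[OF z(1) p] by linarith
      qed
      \<comment> \<open>About half as many strips as fit into a window: then (N + 1) L <= d, while 4
        L < d makes N at least d / (4 L) in spite of the rounding.\<close>
      define N where "N = nat \<lfloor>d / (2 * L)\<rfloor>"
      have N1: "real N \<le> d / (2 * L)" "real N \<ge> d / (2 * L) - 1"
        using d L by (auto simp: N_def)
      have N2: "real N \<ge> d / (4 * L)"
      proof -
        have "1 \<le> d / (4 * L)" using L by (simp add: field_simps)
        moreover have "d / (2 * L) = d / (4 * L) + d / (4 * L)" by (simp add: field_simps)
        ultimately show ?thesis using N1(2) by linarith
      qed
      have Np: "N > 0" using N2 d L by (smt (verit) divide_pos_pos of_nat_0 of_nat_0_less_iff)
      have Nd: "(real N + 1) * L \<le> d"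
      proof -
        have "real N * L \<le> d / (2 * L) * L" using N1(1) L by (intro mult_right_mono) auto
        then show ?thesis using L by (simp add: algebra_simps)
      qed
      have iN: "1 / real N \<le> 4 * L / d" using N2 L d Np by (simp add: field_simps)
      have fin: "(J + \<gamma>) / \<mu> * mass f \<le> en p UNIV f g"
        if f: "h1 f g" "\<forall>t<0. f t = 0 \<and> g t = 0" "mass f \<le> \<mu>" for f g
      proof (cases "en p UNIV f g < 0")
        case True
        \<comment> \<open>Negative energy gives a sup bound of order h, since \<mu>^2 = h^(6-p); so
          the potential part of the cutting cost scales like its kinetic part 8 / L^2.\<close>
        define B where "B = (16 * \<mu>\<^sup>2) powr (1 / (6 - p))"
        have B: "\<bar>f t\<bar> \<le> B" for t
        proof -
          have "\<bar>f t\<bar> \<le> (16 * (mass f)\<^sup>2) powr (1 / (6 - p))" by (rule h1_neg_energy_bound[OF f(1) p True])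
          also have "\<dots> \<le> B" unfolding B_def using p f(3) sq_nonneg[of UNIV f]
            by (intro powr_mono2 mult_left_mono power_mono) auto
          finally show ?thesis .
        qed
        have "\<mu>\<^sup>2 = h powr (6 - p)"
        proof -
          have "\<mu>\<^sup>2 = h powr ((6 - p) / 2 + (6 - p) / 2)" unfolding \<mu>h by (simp only: powr_add power2_eq_square)
          also have "(6 - p) / 2 + (6 - p) / 2 = 6 - p" by simp
          finally show ?thesis .
        qed
        then have "B powr (p - 2) = 16 powr ((p - 2) / (6 - p)) * h powr (p - 2)"
          using p hp by (simp add: B_def powr_powr powr_mult)
        moreover have "8 / L\<^sup>2 = 8 * h powr (p - 2)"
        proof -
          have "L\<^sup>2 = h powr (- (p - 2) / 2 + - (p - 2) / 2)" unfolding L_def by (simp only: powr_add power2_eq_square)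
          also have "- (p - 2) / 2 + - (p - 2) / 2 = - (p - 2)" by (simp add: field_simps)
          finally show ?thesis using hp by (simp add: powr_minus_divide del: minus_diff_eq)
        qed
        ultimately have C: "8 / L\<^sup>2 + B powr (p - 2) / p = C1 * h powr (p - 2)" by (simp add: C1_def algebra_simps)
        have w: "S / \<mu> * mass f \<le> en p UNIV f g + (8 / L\<^sup>2 + B powr (p - 2) / p) * mass f / real N"
        proof (rule windowed_energy[OF p(1) L(1) Np Nd m1 win tail f(1) _ f(3) B])
          show "f t = 0 \<and> g t = 0" if "t < 0" for t using f(2) that by blast
        qed auto
        have "(C1 * h powr (p - 2) * mass f) * (1 / real N) \<le> (C1 * h powr (p - 2) * mass f) * (4 * L / d)"
          using iN C1p sq_nonneg[of UNIV f] by (intro mult_left_mono) auto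
        also have "\<dots> = C2 * (\<mu> * h powr (p - 2) * L) / \<mu> * mass f" using \<mu>p by (simp add: C2_def)
        also have "\<mu> * h powr (p - 2) * L = h\<^sup>2"
        proof -
          have "\<mu> * h powr (p - 2) * L = h powr ((p + 2) / 2 + - (p - 2) / 2)" unfolding \<mu>hp L_def by (simp only: powr_add)
          also have "(p + 2) / 2 + - (p - 2) / 2 = 2" by (simp add: field_simps)
          finally show ?thesis using hp by simp
        qed
        finally have "S / \<mu> * mass f - C2 * h\<^sup>2 / \<mu> * mass f \<le> en p UNIV f g" using w unfolding C by simp
        moreover have "(J + \<gamma>) / \<mu> * mass f = S / \<mu> * mass f - C2 * h\<^sup>2 / \<mu> * mass f"
          by (simp add: \<gamma>_def S_def add_divide_distrib diff_divide_distrib algebra_simps)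
        ultimately show ?thesis by linarith
      next
        case False
        have "C2 * h\<^sup>2 \<ge> 0" using C2p by simp
        then have "J + \<gamma> \<le> 0" using S0 by (simp add: \<gamma>_def S_def)
        then have "(J + \<gamma>) / \<mu> * mass f \<le> 0"
          using \<mu>p sq_nonneg[of UNIV f] by (intro mult_nonpos_nonneg divide_nonpos_pos) auto
        then show ?thesis using False by linarith
      qed
      show ?thesis using \<gamma> fin by blast
    qed
    then show ?thesis using uH by blast
  qed
  have hmp: "0 < hm powr ((6 - p) / 2)" by (simp add: hm_def)
  show ?thesis
    by (rule exI, rule conjI, rule hmp, rule allI, rule impI, rule main, assumption)
qed

text \<open>Cutting at a good radius and comparing both parts with $J$ shows that nearly minimal
  functions carry little mass far out on the half-lines.\<close>

lemma tightness:
  assumes nc: "noncompact_graph G" and p: "2 < p" and q: "2 < q" and \<mu>: "\<mu> > 0" and \<gamma>: "\<gamma> > 0"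
    and lb: "\<And>w. w \<in> H1_mass G \<mu> \<Longrightarrow> J \<le> energy p q w G"
    and gap: "\<And>f g. h1 f g \<Longrightarrow> (\<And>t. t < 0 \<Longrightarrow> f t = 0 \<and> g t = 0) \<Longrightarrow> mass f \<le> \<mu> \<Longrightarrow> (J + \<gamma>) / \<mu> * mass f \<le> en p UNIV f g"
    and h: "Hp G u g" and m: "gmass G u = \<mu>" and N: "N > 0" and e: "e \<in> half_lines G"
  shows "sq (oi e \<inter> {real N + 1..}) (on_edge G u e)
    \<le> \<mu> / \<gamma> * (energy p q u G - J + (8 + gbd u g powr (p - 2) / p) * \<mu> / real N)"
proof -
  obtain j where j: "j < N" "(\<Sum>e\<in>half_lines G. cint p 1 (on_edge G u e) (oi e) {1 + real j..<1 + real j + 1})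
     \<le> (8 + gbd u g powr (p - 2) / p) * \<mu> / real N"
    using good_radius[OF h p N] m by auto
  let ?err = "(8 + gbd u g powr (p - 2) / p) * \<mu> / real N"
  define R where "R = 1 + real j"
  have R: "R > 0" by (simp add: R_def)
  obtain u0 g0 where c: "Hp G u0 g0" "\<And>v. u0 (Vertex v) = u (Vertex v)"
    "\<mu> = gmass G u0 + (\<Sum>e\<in>half_lines G. mass (outer R u e))"
    "gen p G u0 g0 + (\<Sum>e\<in>half_lines G. en p UNIV (outer R u e) (outer' R u g e)) \<le> gen p G u g + ?err"
    using graph_cut[OF h R p] j(2) m unfolding R_def[symmetric] by force
  define mo where "mo = (\<Sum>e\<in>half_lines G. mass (outer R u e))"
  have fH: "finite (half_lines G)" using finite_edges by (auto simp: half_lines_def)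
  have mo: "mass (outer R u e) \<le> mo" if "e \<in> half_lines G" for e
    unfolding mo_def using that fH sq_nonneg by (intro member_le_sum) auto
  have mo\<mu>: "mo \<le> \<mu>" using c(3) gmass_nonneg[of G u0] by (simp add: mo_def)
  have gv: "gver q G u0 = gver q G u" using c(2) by (simp add: gver_def)
  have "(J + \<gamma>) / \<mu> * mo \<le> (\<Sum>e\<in>half_lines G. en p UNIV (outer R u e) (outer' R u g e))"
    unfolding mo_def sum_distrib_left
  proof (rule sum_mono)
    fix e assume e: "e \<in> half_lines G"
    show "(J + \<gamma>) / \<mu> * mass (outer R u e) \<le> en p UNIV (outer R u e) (outer' R u g e)"
      by (rule gap[OF outer_h1(1)[OF h e R]]) (use outer_zero[of _ R] R mo[OF e] mo\<mu> in auto)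
  qed
  \<comment> \<open>The inner part, rescaled to mass \<mu>, has energy at least J; superlinearity
    turns this into a share of J proportional to its own mass. With zero mass the sup bound is 0,
    and all nonlinear terms vanish.\<close>
  moreover have "J / \<mu> * gmass G u0 \<le> gen p G u0 g0 - gver q G u0 / q"
  proof (cases "gmass G u0 = 0")
    case True
    have "gbd u0 g0 = 0" using True by (simp add: gbd_def)
    then have "gver q G u0 = 0" "gpint p G u0 \<le> 0"
      using vertex_bdd[OF nc c(1)] gpint_le[OF c(1) p] True by (auto simp: gver_def)
    moreover from this have "gpint p G u0 = 0" using gpint_nonneg[of p G u0] by linarith
    ultimately show ?thesis using gen_eq[OF c(1) p] gkin_nonneg[of G g0] True by simp
  next
    case False
    then have m0: "gmass G u0 > 0" using gmass_nonneg[of G u0] by linarith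
    have m1: "gmass G u0 \<le> \<mu>" using c(3) sq_nonneg by (simp add: sum_nonneg)
    define k where "k = \<mu> / gmass G u0"
    have k: "k \<ge> 1" using m0 m1 by (simp add: k_def)
    have "J \<le> k * gen p G u0 g0 - k powr (q / 2) * gver q G u0 / q"
      unfolding k_def by (rule scale_up[OF lb c(1) p]) (use q m0 m1 in auto)
    also have "\<dots> \<le> k * gen p G u0 g0 - k * gver q G u0 / q"
    proof -
      have "k powr 1 \<le> k powr (q / 2)" using k q by (intro powr_mono) auto
      then have "k * gver q G u0 / q \<le> k powr (q / 2) * gver q G u0 / q"
        using k q gver_nonneg[of q G u0] by (intro divide_right_mono mult_right_mono) auto
      then show ?thesis by simp
    qed
    finally have "J \<le> k * (gen p G u0 g0 - gver q G u0 / q)" by (simp add: right_diff_distrib)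
    then have "J / k \<le> gen p G u0 g0 - gver q G u0 / q" using k by (simp add: pos_divide_le_eq mult.commute)
    then show ?thesis by (simp add: k_def)
  qed
  ultimately have "J / \<mu> * gmass G u0 + (J + \<gamma>) / \<mu> * mo \<le> energy p q u G + ?err"
    using c(4) energy_eq[OF h p, of q] unfolding gv by linarith
  \<comment> \<open>The shares of J recombine since the masses add up to \<mu>. What is left is the
    surplus (\<gamma> / \<mu>) \<open>mo\<close>, to be paid from the energy excess and the cutting
    error.\<close>
  moreover have "J / \<mu> * gmass G u0 + (J + \<gamma>) / \<mu> * mo = J + \<gamma> / \<mu> * mo"
  proof -
    have "gmass G u0 = \<mu> - mo" using c(3) by (simp add: mo_def)
    then show ?thesis using \<mu> by (simp only:) (simp add: field_simps)
  qed
  ultimately have "\<gamma> / \<mu> * mo \<le> energy p q u G - J + ?err" by linarith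
  then have "\<mu> / \<gamma> * (\<gamma> / \<mu> * mo) \<le> \<mu> / \<gamma> * (energy p q u G - J + ?err)"
    using \<mu> \<gamma> by (intro mult_left_mono) auto
  then have mob: "mo \<le> \<mu> / \<gamma> * (energy p q u G - J + ?err)" using \<mu> \<gamma> by simp
  have "sq (oi e \<inter> {real N + 1..}) (on_edge G u e) \<le> sq (oi e \<inter> {R + 1..}) (on_edge G u e)"
  proof (rule sq_mono_set)
    have "(\<lambda>t. indicator (oi e \<inter> {R + 1..}) t * (on_edge G u e t)\<^sup>2) = (\<lambda>t. indicator {R + 1..} t * (indicator (oi e) t * (on_edge G u e t)\<^sup>2))"
      by (rule ext) (simp add: indicator_inter_arith mult_ac)
    then show "integrable lborel (\<lambda>t. indicator (oi e \<inter> {R + 1..}) t * (on_edge G u e t)\<^sup>2)"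
      using int_indicator_mult[OF sobD(2)[OF Hp_sob[OF h half_line_interval(1)[OF e]]], of "{R + 1..}"] by simp
    show "oi e \<inter> {real N + 1..} \<subseteq> oi e \<inter> {R + 1..}" using j(1) by (auto simp: R_def)
    show "oi e \<inter> {real N + 1..} \<in> sets borel" using half_line_interval(2)[OF e] by auto
  qed
  also have "\<dots> \<le> mass (outer R u e)" by (rule outer_tail[OF h e R])
  also have "\<dots> \<le> mo" by (rule mo[OF e])
  finally show ?thesis using mob by linarith
qed

end

section \<open>Compactness of minimising sequences\<close>

lemma sq_midpoint:
  assumes m: "(\<lambda>t. indicator I t * f t) \<in> borel_measurable lborel" "(\<lambda>t. indicator I t * g t) \<in> borel_measurable lborel"
    and i: "integrable lborel (\<lambda>t. indicator I t * (f t)\<^sup>2)" "integrable lborel (\<lambda>t. indicator I t * (g t)\<^sup>2)"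
  shows "sq I (\<lambda>t. 1/2 * f t + 1/2 * g t) = sq I f / 2 + sq I g / 2 - sq I (\<lambda>t. f t - g t) / 4"
proof -
  have "integrable lborel (\<lambda>t. (indicator I t * f t - indicator I t * g t)\<^sup>2)"
    by (rule sq_int_diff) (use m i in \<open>simp_all add: ind_sq\<close>)
  then have d: "integrable lborel (\<lambda>t. indicator I t * (f t - g t)\<^sup>2)"
    by (simp add: right_diff_distrib[symmetric] ind_sq)
  have "(\<lambda>t. indicator I t * (1/2 * f t + 1/2 * g t)\<^sup>2) =
    (\<lambda>t. (indicator I t * (f t)\<^sup>2) / 2 + (indicator I t * (g t)\<^sup>2) / 2 - (indicator I t * (f t - g t)\<^sup>2) / 4)"
    by (auto simp: power2_eq_square field_simps)
  then show ?thesis unfolding sq_def using i d by simp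
qed

context metric_graph
begin

text \<open>Nothing is assumed about a derivative of U, so the lemma can be used before U is known
  to be a Sobolev function, and again for the midpoints.\<close>

lemma functional_limits:
  assumes h: "\<And>n. Hp G (w n) (gw n)" and p: "2 < p" and q: "0 < q"
    and M: "\<And>n e t. e \<in> edges G \<Longrightarrow> t \<in> oi e \<Longrightarrow> \<bar>on_edge G (w n) e t\<bar> \<le> M"
    and B: "\<And>n. gmass G (w n) \<le> B"
    and mU: "\<And>e. e \<in> edges G \<Longrightarrow> (\<lambda>t. indicator (oi e) t * on_edge G U e t) \<in> borel_measurable lborel"
    and iU: "\<And>e. e \<in> edges G \<Longrightarrow> integrable lborel (\<lambda>t. indicator (oi e) t * (on_edge G U e t)\<^sup>2)"
    and MU: "\<And>e t. e \<in> edges G \<Longrightarrow> t \<in> oi e \<Longrightarrow> \<bar>on_edge G U e t\<bar> \<le> M"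
    and l: "\<And>e. e \<in> edges G \<Longrightarrow> (\<lambda>n. sq (oi e) (\<lambda>t. on_edge G (w n) e t - on_edge G U e t)) \<longlonglongrightarrow> 0"
    and lv: "\<And>v. v \<in> verts G \<Longrightarrow> (\<lambda>n. w n (Vertex v)) \<longlonglongrightarrow> U (Vertex v)"
  shows "(\<lambda>n. gmass G (w n)) \<longlonglongrightarrow> gmass G U" "(\<lambda>n. gpint p G (w n)) \<longlonglongrightarrow> gpint p G U"
    "(\<lambda>n. gver q G (w n)) \<longlonglongrightarrow> gver q G U"
proof -
  have Be: "sq (oi e) (on_edge G (w n) e) \<le> B" if "e \<in> edges G" for e n
    using sum_edges_ge[OF that, of "\<lambda>e. sq (oi e) (on_edge G (w n) e)"] sq_nonneg B[of n] by (force simp: gmass_def)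
  have m: "(\<lambda>t. indicator (oi e) t * on_edge G (w n) e t) \<in> borel_measurable lborel" if "e \<in> edges G" for e n
    by (rule sob_measurable(1)[OF Hp_sob[OF h that] interval_facts(1)[OF that]])
  have i: "integrable lborel (\<lambda>t. indicator (oi e) t * (on_edge G (w n) e t)\<^sup>2)" if "e \<in> edges G" for e n
    by (rule sobD(2)[OF Hp_sob[OF h that]])
  have "(\<lambda>n. sq (oi e) (on_edge G (w n) e)) \<longlonglongrightarrow> sq (oi e) (on_edge G U e)" if e: "e \<in> edges G" for e
    unfolding sq_def
  proof (rule L2_functional_limit[OF m[OF e] mU[OF e] i[OF e] iU[OF e] l[OF e] Be[OF e] i[OF e] iU[OF e], where C = 1])
    fix n t
    have "(on_edge G (w n) e t)\<^sup>2 - (on_edge G U e t)\<^sup>2 = (on_edge G (w n) e t + on_edge G U e t) * (on_edge G (w n) e t - on_edge G U e t)"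
      by (simp add: power2_eq_square algebra_simps)
    then show "\<bar>(on_edge G (w n) e t)\<^sup>2 - (on_edge G U e t)\<^sup>2\<bar> \<le> 1 * ((\<bar>on_edge G (w n) e t\<bar> + \<bar>on_edge G U e t\<bar>) * \<bar>on_edge G (w n) e t - on_edge G U e t\<bar>)"
      using abs_triangle_ineq[of "on_edge G (w n) e t" "on_edge G U e t"] by (simp add: abs_mult mult_right_mono)
  qed
  then show "(\<lambda>n. gmass G (w n)) \<longlonglongrightarrow> gmass G U" unfolding gmass_def by (intro tendsto_sum)
  have "(\<lambda>n. pint p (oi e) (on_edge G (w n) e)) \<longlonglongrightarrow> pint p (oi e) (on_edge G U e)" if e: "e \<in> edges G" for e
    unfolding pint_def
  proof (rule L2_functional_limit[OF m[OF e] mU[OF e] i[OF e] iU[OF e] l[OF e] Be[OF e], where C = "p * M powr (p - 2)"])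
    show "integrable lborel (\<lambda>t. indicator (oi e) t * \<bar>on_edge G (w n) e t\<bar> powr p)" for n
      by (rule powr_integrable(1)[OF m[OF e] i[OF e] M[OF e] p])
    show "integrable lborel (\<lambda>t. indicator (oi e) t * \<bar>on_edge G U e t\<bar> powr p)"
      by (rule powr_integrable(1)[OF mU[OF e] iU[OF e] MU[OF e] p])
  qed (rule powr_diff_le[OF M[OF e] MU[OF e] p])
  then show "(\<lambda>n. gpint p G (w n)) \<longlonglongrightarrow> gpint p G U" unfolding gpint_def by (intro tendsto_sum)
  show "(\<lambda>n. gver q G (w n)) \<longlonglongrightarrow> gver q G U" unfolding gver_def
    by (intro tendsto_sum tendsto_powr' tendsto_rabs lv tendsto_const) (use q in auto)
qed

text \<open>An Arzela--Ascoli argument: a diagonal subsequence converges at all rational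
  coordinates, and the uniform Hoelder bound from the kinetic energy carries the Cauchy property to
  every point of every edge.\<close>

lemma pointwise_subsequence:
  assumes h: "\<And>n. Hp G (u n) (g n)" and K: "\<And>n. gkin G (g n) \<le> K"
    and M: "\<And>n e t. e \<in> edges G \<Longrightarrow> t \<in> ei e \<Longrightarrow> \<bar>on_edge G (u n) e t\<bar> \<le> M"
  shows "\<exists>k :: nat \<Rightarrow> nat. strict_mono k \<and> (\<forall>e\<in>edges G. \<forall>t\<in>ei e. convergent (\<lambda>n. on_edge G (u (k n)) e t))"
proof -
  define S where "S = (SIGMA e:edges G. ei e \<inter> \<rat>)"
  have K0: "K \<ge> 0" using K[of 0] gkin_nonneg[of G "g 0"] by linarith
  have "countable S" unfolding S_def
    by (intro countable_SIGMA countable_finite[OF finite_edges] countable_Int2 countable_rat)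
  then obtain k where k: "strict_mono (k :: nat \<Rightarrow> nat)" "\<And>x. x \<in> S \<Longrightarrow> \<exists>l. (\<lambda>n. on_edge G (u (k n)) (fst x) (snd x)) \<longlonglongrightarrow> l"
    by (rule function_convergent_subsequence[of S "\<lambda>n x. on_edge G (u n) (fst x) (snd x)" M]) (use M in \<open>auto simp: S_def\<close>)
  have "convergent (\<lambda>n. on_edge G (u (k n)) e t)" if e: "e \<in> edges G" and t: "t \<in> ei e" for e t
  proof -
    have "Cauchy (\<lambda>n. on_edge G (u (k n)) e t)"
    proof (rule metric_CauchyI)
      fix \<epsilon> :: real assume \<epsilon>: "\<epsilon> > 0"
      \<comment> \<open>By the Hoelder bound, points closer than \<delta> have values closer than
        \<epsilon>/3. The rational r below is taken at or to the left of t, which keeps it in the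
        edge.\<close>
      define \<delta> where "\<delta> = (\<epsilon> / 3)\<^sup>2 / (K + 1)"
      have \<delta>: "\<delta> > 0" using \<epsilon> K0 by (simp add: \<delta>_def)
      obtain r where r: "r \<in> ei e" "r \<in> \<rat>" "\<bar>r - t\<bar> < \<delta>"
      proof (cases "t = 0")
        case True
        then show ?thesis using that[of 0] t \<delta> by simp
      next
        case False
        then have "max 0 (t - \<delta>) < t" using t \<delta> by (auto simp: edge_interval_def)
        then obtain r where r: "r \<in> \<rat>" "max 0 (t - \<delta>) < r" "r < t" using Rats_dense_in_real by blast
        moreover have "ereal r \<le> ereal t" "ereal t \<le> len G e" using r t by (auto simp: edge_interval_def)
        then have "ereal r \<le> len G e" by (rule order_trans)
        ultimately show ?thesis using that[of r] by (auto simp: edge_interval_def)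
      qed
      have near: "\<bar>on_edge G (u n) e t - on_edge G (u n) e r\<bar> < \<epsilon> / 3" for n
      proof -
        have "(on_edge G (u n) e t - on_edge G (u n) e r)\<^sup>2 \<le> \<bar>t - r\<bar> * gkin G (g n)" by (rule edge_holder[OF h e r(1) t])
        also have "\<dots> \<le> \<bar>t - r\<bar> * (K + 1)" using K[of n] by (intro mult_left_mono) auto
        also have "\<dots> < \<delta> * (K + 1)" using r(3) K0 by (intro mult_strict_right_mono) auto
        also have "\<dots> = (\<epsilon> / 3)\<^sup>2" using K0 by (simp add: \<delta>_def)
        finally have "\<bar>on_edge G (u n) e t - on_edge G (u n) e r\<bar>\<^sup>2 < (\<epsilon> / 3)\<^sup>2" by simp
        then show ?thesis by (rule power2_less_imp_less) (use \<epsilon> in simp)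
      qed
      have "(e, r) \<in> S" using e r by (simp add: S_def)
      from k(2)[OF this] have "Cauchy (\<lambda>n. on_edge G (u (k n)) e r)" by (auto intro: LIMSEQ_imp_Cauchy)
      then obtain N where N: "\<And>m n. m \<ge> N \<Longrightarrow> n \<ge> N \<Longrightarrow> \<bar>on_edge G (u (k m)) e r - on_edge G (u (k n)) e r\<bar> < \<epsilon> / 3"
        using \<epsilon> unfolding Cauchy_def dist_real_def by (meson divide_pos_pos zero_less_numeral)
      have "\<bar>on_edge G (u (k m)) e t - on_edge G (u (k n)) e t\<bar> < \<epsilon>" if "m \<ge> N" "n \<ge> N" for m n
        using N[OF that] near[of "k m"] near[of "k n"] by linarith
      then show "\<exists>N. \<forall>m\<ge>N. \<forall>n\<ge>N. dist (on_edge G (u (k m)) e t) (on_edge G (u (k n)) e t) < \<epsilon>"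
        unfolding dist_real_def by blast
    qed
    then show ?thesis by (simp add: Cauchy_convergent)
  qed
  then show ?thesis using k(1) by blast
qed

text \<open>Once the functions converge in $L^2$, the midpoints of a minimising sequence are admissible up
  to a negligible loss of mass, so the parallelogram law forces the derivatives to converge as well.\<close>

lemma derivs_Cauchy:
  assumes h: "\<And>n. Hp G (u n) (g n)" and p: "2 < p" and q: "2 < q" and \<mu>: "\<mu> > 0" and m: "\<And>n. gmass G (u n) = \<mu>"
    and lb: "\<And>w. w \<in> H1_mass G \<mu> \<Longrightarrow> J \<le> energy p q w G" and lim: "(\<lambda>n. energy p q (u n) G) \<longlonglongrightarrow> J"
    and M: "\<And>n e t. e \<in> edges G \<Longrightarrow> t \<in> oi e \<Longrightarrow> \<bar>on_edge G (u n) e t\<bar> \<le> M"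
    and mU: "\<And>e. e \<in> edges G \<Longrightarrow> (\<lambda>t. indicator (oi e) t * on_edge G U e t) \<in> borel_measurable lborel"
    and iU: "\<And>e. e \<in> edges G \<Longrightarrow> integrable lborel (\<lambda>t. indicator (oi e) t * (on_edge G U e t)\<^sup>2)"
    and MU: "\<And>e t. e \<in> edges G \<Longrightarrow> t \<in> oi e \<Longrightarrow> \<bar>on_edge G U e t\<bar> \<le> M"
    and l: "\<And>e. e \<in> edges G \<Longrightarrow> (\<lambda>n. sq (oi e) (\<lambda>t. on_edge G (u n) e t - on_edge G U e t)) \<longlonglongrightarrow> 0"
    and lv: "\<And>v. v \<in> verts G \<Longrightarrow> (\<lambda>n. u n (Vertex v)) \<longlonglongrightarrow> U (Vertex v)"
    and mass: "gmass G U = \<mu>" and \<epsilon>: "\<epsilon> > 0"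
  shows "\<exists>N. \<forall>m\<ge>N. \<forall>n\<ge>N. (\<Sum>e\<in>edges G. sq (oi e) (\<lambda>t. g m e t - g n e t)) \<le> \<epsilon>"
proof (rule ccontr)
  define dk where "dk a b = (\<Sum>e\<in>edges G. sq (oi e) (\<lambda>t. g a e t - g b e t))" for a b
  assume "\<not> ?thesis"
  then have "\<forall>N. \<exists>ab. fst ab \<ge> N \<and> snd ab \<ge> N \<and> dk (fst ab) (snd ab) > \<epsilon>"
    unfolding dk_def[symmetric] by (simp add: not_le)
  then obtain ab where ab: "\<And>N. fst (ab N) \<ge> N \<and> snd (ab N) \<ge> N \<and> dk (fst (ab N)) (snd (ab N)) > \<epsilon>"
    by metis
  define a b where "a N = fst (ab N)" and "b N = snd (ab N)" for N
  have ab: "a N \<ge> N" "b N \<ge> N" "dk (a N) (b N) > \<epsilon>" for N using ab[of N] by (auto simp: a_def b_def)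
  have fa: "filterlim a at_top sequentially" "filterlim b at_top sequentially"
    by (rule filterlim_at_top_mono[OF filterlim_ident]; use ab in auto)+
  define w where "w N = (\<lambda>x. 1/2 * u (a N) x + 1/2 * u (b N) x)" for N
  define gw where "gw N = (\<lambda>e t. 1/2 * g (a N) e t + 1/2 * g (b N) e t)" for N
  have hw: "Hp G (w N) (gw N)" for N unfolding w_def gw_def by (intro Hp_add Hp_cmult h)
  have ow: "on_edge G (w N) e = (\<lambda>t. 1/2 * on_edge G (u (a N)) e t + 1/2 * on_edge G (u (b N)) e t)" for N e
    by (simp add: w_def on_edge_def fun_eq_iff)
  have mu: "(\<lambda>t. indicator (oi e) t * on_edge G (u n) e t) \<in> borel_measurable lborel"
    "(\<lambda>t. indicator (oi e) t * g n e t) \<in> borel_measurable lborel"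
    "integrable lborel (\<lambda>t. indicator (oi e) t * (on_edge G (u n) e t)\<^sup>2)"
    "integrable lborel (\<lambda>t. indicator (oi e) t * (g n e t)\<^sup>2)" if "e \<in> edges G" for e n
    using sob_measurable[OF Hp_sob[OF h that] interval_facts(1)[OF that]] sobD[OF Hp_sob[OF h that]] by auto
  have kw: "gkin G (gw N) = gkin G (g (a N)) / 2 + gkin G (g (b N)) / 2 - dk (a N) (b N) / 4" for N
  proof -
    have "gkin G (gw N) = (\<Sum>e\<in>edges G. sq (oi e) (g (a N) e) / 2 + sq (oi e) (g (b N) e) / 2 - sq (oi e) (\<lambda>t. g (a N) e t - g (b N) e t) / 4)"
      unfolding gkin_def gw_def using sq_midpoint[OF mu(2) mu(2) mu(4) mu(4)] by (intro sum.cong) auto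
    then show ?thesis by (simp add: gkin_def dk_def sum.distrib sum_subtractf sum_divide_distrib)
  qed
  have mw: "gmass G (w N) \<le> \<mu>" for N
  proof -
    have "gmass G (w N) \<le> (\<Sum>e\<in>edges G. sq (oi e) (on_edge G (u (a N)) e) / 2 + sq (oi e) (on_edge G (u (b N)) e) / 2)"
      unfolding gmass_def ow
    proof (rule sum_mono)
      fix e assume e: "e \<in> edges G"
      show "sq (oi e) (\<lambda>t. 1/2 * on_edge G (u (a N)) e t + 1/2 * on_edge G (u (b N)) e t) \<le> sq (oi e) (on_edge G (u (a N)) e) / 2 + sq (oi e) (on_edge G (u (b N)) e) / 2"
        using sq_midpoint[OF mu(1)[OF e] mu(1)[OF e] mu(3)[OF e] mu(3)[OF e], of "a N" "b N"]
          sq_nonneg[of "oi e" "\<lambda>t. on_edge G (u (a N)) e t - on_edge G (u (b N)) e t"] by linarith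
    qed
    also have "\<dots> = gmass G (u (a N)) / 2 + gmass G (u (b N)) / 2" by (simp add: gmass_def sum.distrib sum_divide_distrib)
    finally show ?thesis by (simp add: m)
  qed
  have Mw: "\<bar>on_edge G (w N) e t\<bar> \<le> M" if "e \<in> edges G" "t \<in> oi e" for N e t
    using M[OF that, of "a N"] M[OF that, of "b N"] by (simp add: ow)
  have lw: "(\<lambda>N. sq (oi e) (\<lambda>t. on_edge G (w N) e t - on_edge G U e t)) \<longlonglongrightarrow> 0" if e: "e \<in> edges G" for e
  proof (rule tendsto_sandwich[OF _ _ tendsto_const])
    show "\<forall>\<^sub>F N in sequentially. 0 \<le> sq (oi e) (\<lambda>t. on_edge G (w N) e t - on_edge G U e t)" by (simp add: sq_nonneg)
    show "\<forall>\<^sub>F N in sequentially. sq (oi e) (\<lambda>t. on_edge G (w N) e t - on_edge G U e t) \<le>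
        sq (oi e) (\<lambda>t. on_edge G (u (a N)) e t - on_edge G U e t) / 2 + sq (oi e) (\<lambda>t. on_edge G (u (b N)) e t - on_edge G U e t) / 2"
    proof (rule always_eventually, rule allI)
      fix N
      have dm: "(\<lambda>t. indicator (oi e) t * (on_edge G (u n) e t - on_edge G U e t)) \<in> borel_measurable lborel" for n
        using borel_measurable_diff[OF mu(1)[OF e, of n] mU[OF e]] by (simp add: right_diff_distrib)
      have "integrable lborel (\<lambda>t. (indicator (oi e) t * on_edge G (u n) e t - indicator (oi e) t * on_edge G U e t)\<^sup>2)" for n
        by (rule sq_int_diff) (use mu[OF e] mU[OF e] iU[OF e] in \<open>simp_all add: ind_sq\<close>)
      then have di: "integrable lborel (\<lambda>t. indicator (oi e) t * (on_edge G (u n) e t - on_edge G U e t)\<^sup>2)" for n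
        by (simp add: right_diff_distrib[symmetric] ind_sq)
      have "(\<lambda>t. on_edge G (w N) e t - on_edge G U e t) = (\<lambda>t. 1/2 * (on_edge G (u (a N)) e t - on_edge G U e t) + 1/2 * (on_edge G (u (b N)) e t - on_edge G U e t))"
        by (auto simp: ow field_simps)
      then show "sq (oi e) (\<lambda>t. on_edge G (w N) e t - on_edge G U e t) \<le>
        sq (oi e) (\<lambda>t. on_edge G (u (a N)) e t - on_edge G U e t) / 2 + sq (oi e) (\<lambda>t. on_edge G (u (b N)) e t - on_edge G U e t) / 2"
        using sq_midpoint[OF dm dm di di, of "a N" "b N"]
          sq_nonneg[of "oi e" "\<lambda>t. (on_edge G (u (a N)) e t - on_edge G U e t) - (on_edge G (u (b N)) e t - on_edge G U e t)"] by simp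
    qed
    have "(\<lambda>N. sq (oi e) (\<lambda>t. on_edge G (u (a N)) e t - on_edge G U e t)) \<longlonglongrightarrow> 0"
      "(\<lambda>N. sq (oi e) (\<lambda>t. on_edge G (u (b N)) e t - on_edge G U e t)) \<longlonglongrightarrow> 0"
      by (rule filterlim_compose[OF l[OF e] fa(1)], rule filterlim_compose[OF l[OF e] fa(2)])
    then show "(\<lambda>N. sq (oi e) (\<lambda>t. on_edge G (u (a N)) e t - on_edge G U e t) / 2 + sq (oi e) (\<lambda>t. on_edge G (u (b N)) e t - on_edge G U e t) / 2) \<longlonglongrightarrow> 0"
      by (auto intro!: tendsto_eq_intros)
  qed
  have lvw: "(\<lambda>N. w N (Vertex v)) \<longlonglongrightarrow> U (Vertex v)" if "v \<in> verts G" for v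
  proof -
    have "(\<lambda>N. 1/2 * u (a N) (Vertex v) + 1/2 * u (b N) (Vertex v)) \<longlonglongrightarrow> 1/2 * U (Vertex v) + 1/2 * U (Vertex v)"
      by (intro tendsto_intros filterlim_compose[OF lv[OF that] fa(1)] filterlim_compose[OF lv[OF that] fa(2)])
    then show ?thesis by (simp add: w_def)
  qed
  have q0: "0 < q" using q by simp
  have mle: "gmass G (u n) \<le> \<mu>" for n using m by simp
  note lims = functional_limits[OF h p q0 M mle mU iU MU l lv]
  note limsw = functional_limits[OF hw p q0 Mw mw mU iU MU lw lvw]
  define P where "P z = gpint p G z / p + gver q G z / q" for z
  have en: "energy p q z G = gkin G gz / 2 - P z" if "Hp G z gz" for z gz
    using energy_eq[OF that p, of q] gen_eq[OF that p] by (simp add: P_def)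
  have lP: "(\<lambda>n. P (u n)) \<longlonglongrightarrow> P U" "(\<lambda>n. P (w n)) \<longlonglongrightarrow> P U"
    unfolding P_def using lims(2,3) limsw(2,3) p q by (auto intro!: tendsto_intros)
  have ev: "\<forall>\<^sub>F N in sequentially. gmass G (w N) > 0" using limsw(1) \<mu> mass by (intro order_tendstoD(1)) auto
  \<comment> \<open>The midpoint loses a quarter of the derivative distance in \<open>gkin\<close>,
    hence more than \<epsilon>/8 in energy. Its energy is at least its mass share of J, so the
    right-hand side must pay for the loss; yet it tends to 0, because masses and nonlinear terms
    converge.\<close>
  have "\<forall>\<^sub>F N in sequentially. \<epsilon> / 8 \<le> energy p q (u (a N)) G / 2 + energy p q (u (b N)) G / 2 - gmass G (w N) / \<mu> * J
      + (P (u (a N)) / 2 + P (u (b N)) / 2 - P (w N))"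
    using ev
  proof eventually_elim
    fix N assume pos: "gmass G (w N) > 0"
    define k where "k = \<mu> / gmass G (w N)"
    have k: "k \<ge> 1" using pos mw[of N] by (simp add: k_def)
    have "J \<le> k * gen p G (w N) (gw N) - k powr (q / 2) * gver q G (w N) / q"
      unfolding k_def by (rule scale_up[OF lb hw p]) (use q pos mw in auto)
    also have "\<dots> \<le> k * gen p G (w N) (gw N) - k * gver q G (w N) / q"
    proof -
      have "k powr 1 \<le> k powr (q / 2)" using k q by (intro powr_mono) auto
      then have "k * gver q G (w N) / q \<le> k powr (q / 2) * gver q G (w N) / q"
        using k q gver_nonneg[of q G "w N"] by (intro divide_right_mono mult_right_mono) auto
      then show ?thesis by simp
    qed
    also have "\<dots> = k * energy p q (w N) G" using energy_eq[OF hw p, of q] by (simp add: right_diff_distrib)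
    finally have "J / k \<le> energy p q (w N) G" using k by (simp add: pos_divide_le_eq mult.commute)
    then have "gmass G (w N) / \<mu> * J \<le> energy p q (w N) G" by (simp add: k_def mult.commute)
    then show "\<epsilon> / 8 \<le> energy p q (u (a N)) G / 2 + energy p q (u (b N)) G / 2 - gmass G (w N) / \<mu> * J
      + (P (u (a N)) / 2 + P (u (b N)) / 2 - P (w N))"
      using kw[of N] ab(3)[of N] en[OF hw, of N] en[OF h, of "a N"] en[OF h, of "b N"] by linarith
  qed
  moreover have "(\<lambda>N. energy p q (u (a N)) G / 2 + energy p q (u (b N)) G / 2 - gmass G (w N) / \<mu> * J
      + (P (u (a N)) / 2 + P (u (b N)) / 2 - P (w N))) \<longlonglongrightarrow> J / 2 + J / 2 - gmass G U / \<mu> * J + (P U / 2 + P U / 2 - P U)"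
    using \<mu> by (intro tendsto_intros limsw(1) lP(2) filterlim_compose[OF lim fa(1)] filterlim_compose[OF lim fa(2)]
        filterlim_compose[OF lP(1) fa(1)] filterlim_compose[OF lP(1) fa(2)]) auto
  ultimately have "\<epsilon> / 8 \<le> J / 2 + J / 2 - gmass G U / \<mu> * J + (P U / 2 + P U / 2 - P U)"
    by (intro tendsto_lowerbound) auto
  then show False using \<epsilon> \<mu> mass by simp
qed

text \<open>Lower semicontinuity is not invoked: functions and derivatives converge strongly, so
  every term of the energy converges and the limit attains J.\<close>

lemma minimiser_exists:
  assumes nc: "noncompact_graph G" and p: "2 < p" "p < 6" and q: "2 < q" "q < 4" and \<mu>: "\<mu> > 0" and \<gamma>: "\<gamma> > 0"
    and lb: "\<And>w. w \<in> H1_mass G \<mu> \<Longrightarrow> J \<le> energy p q w G"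
    and inf: "\<And>\<epsilon>. \<epsilon> > 0 \<Longrightarrow> \<exists>w\<in>H1_mass G \<mu>. energy p q w G < J + \<epsilon>"
    and gap: "\<And>f g. h1 f g \<Longrightarrow> (\<And>t. t < 0 \<Longrightarrow> f t = 0 \<and> g t = 0) \<Longrightarrow> mass f \<le> \<mu> \<Longrightarrow> (J + \<gamma>) / \<mu> * mass f \<le> en p UNIV f g"
  shows "\<exists>U\<in>H1_mass G \<mu>. energy p q U G = J"
proof -
  have "\<forall>n. \<exists>w. w \<in> H1_mass G \<mu> \<and> energy p q w G < J + 1 / (real n + 1)"
  proof
    fix n
    show "\<exists>w. w \<in> H1_mass G \<mu> \<and> energy p q w G < J + 1 / (real n + 1)"
      using inf[of "1 / (real n + 1)"] by auto
  qed
  then obtain z where z: "\<And>n. z n \<in> H1_mass G \<mu>" "\<And>n. energy p q (z n) G < J + 1 / (real n + 1)" by metis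
  define gz where "gz n = graph_deriv G (z n)" for n
  have hz: "Hp G (z n) (gz n)" for n unfolding gz_def using z(1)[of n] by (intro H1_imp_Hp) (simp add: H1_mass_iff)
  have mz: "gmass G (z n) = \<mu>" for n using z(1)[of n] by (simp add: H1_mass_iff)
  obtain C where C: "\<And>u g. Hp G u g \<Longrightarrow> gmass G u = \<mu> \<Longrightarrow> gkin G g / 4 - C \<le> energy p q u G"
    using coercive[OF nc p q \<mu>] by blast
  define K where "K = 4 * J + 4 + 4 * C"
  have Kz: "gkin G (gz n) \<le> K" for n
  proof -
    have "1 / (real n + 1) \<le> 1" by simp
    then have "energy p q (z n) G < J + 1" using less_le_trans[OF z(2)[of n], of "J + 1"] by simp
    then show ?thesis using C[OF hz mz, of n] unfolding K_def by linarith
  qed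
  have K0: "K \<ge> 0" using Kz[of 0] gkin_nonneg[of G "gz 0"] by linarith
  define M where "M = (16 * \<mu> * K + 16 * \<mu>\<^sup>2 / dmin\<^sup>2) powr (1/4)"
  have gM: "gbd (z n) (gz n) \<le> M" for n unfolding gbd_def M_def mz
    using Kz[of n] \<mu> gkin_nonneg[of G "gz n"] by (intro powr_mono2 add_right_mono mult_left_mono) auto
  have M: "\<bar>on_edge G (z n) e t\<bar> \<le> M" if "e \<in> edges G" "t \<in> ei e" for n e t
    using edge_bdd[OF hz that, of n] gM[of n] by linarith
  obtain k :: "nat \<Rightarrow> nat" where k: "strict_mono k"
    "\<forall>e\<in>edges G. \<forall>t\<in>ei e. convergent (\<lambda>n. on_edge G (z (k n)) e t)"
    using pointwise_subsequence[where u = z and g = gz, OF hz Kz M] by auto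
  define u where "u n = z (k n)" for n
  define g where "g n = gz (k n)" for n
  have h: "Hp G (u n) (g n)" and m: "gmass G (u n) = \<mu>" and Ku: "gkin G (g n) \<le> K" and gMu: "gbd (u n) (g n) \<le> M"
    and uH: "u n \<in> H1_mass G \<mu>" for n
    using hz mz Kz gM z(1) by (simp_all add: u_def g_def)
  have lim: "(\<lambda>n. energy p q (u n) G) \<longlonglongrightarrow> J"
  proof (rule tendsto_sandwich[OF _ _ tendsto_const])
    show "\<forall>\<^sub>F n in sequentially. J \<le> energy p q (u n) G" using lb[OF uH] by simp
    show "\<forall>\<^sub>F n in sequentially. energy p q (u n) G \<le> J + 1 / (real n + 1)"
    proof (rule always_eventually, rule allI)
      fix n
      have "1 / (real (k n) + 1) \<le> 1 / (real n + 1)" using seq_suble[OF k(1), of n] by (intro frac_le) auto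
      then show "energy p q (u n) G \<le> J + 1 / (real n + 1)" using z(2)[of "k n"] by (simp add: u_def)
    qed
    have "(\<lambda>n. 1 / (real n + 1)) \<longlonglongrightarrow> 0" by real_asymp
    from tendsto_add[OF tendsto_const this] show "(\<lambda>n. J + 1 / (real n + 1)) \<longlonglongrightarrow> J" by simp
  qed
  \<comment> \<open>One limit on the type of points serves all edges at once, so the edges meeting
    at a vertex share its limit value automatically.\<close>
  define U where "U x = lim (\<lambda>n. u n x)" for x
  have pU: "(\<lambda>n. on_edge G (u n) e t) \<longlonglongrightarrow> on_edge G U e t" if "e \<in> edges G" "t \<in> ei e" for e t
    using bspec[OF bspec[OF k(2) that(1)] that(2)] by (simp add: on_edge_def u_def U_def convergent_LIMSEQ_iff)
  have lv: "(\<lambda>n. u n (Vertex v)) \<longlonglongrightarrow> U (Vertex v)" if v: "v \<in> verts G" for v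
  proof -
    obtain e t where "e \<in> edges G" "t \<in> ei e" "edge_point G e t = Vertex v" using vertex_on_edge[OF nc v] by blast
    then show ?thesis using pU[of e t] by (simp add: on_edge_def)
  qed
  have Mu: "\<bar>on_edge G (u n) e t\<bar> \<le> M" if "e \<in> edges G" "t \<in> ei e" for n e t
    using M[OF that] by (simp add: u_def)
  have MU: "\<bar>on_edge G U e t\<bar> \<le> M" if "e \<in> edges G" "t \<in> ei e" for e t
    by (rule LIMSEQ_le_const2[OF tendsto_rabs[OF pU[OF that]]]) (use Mu[OF that] in auto)
  have oe: "t \<in> ei e" if "e \<in> edges G" "t \<in> oi e" for e t using interval_facts(3)[OF that(1)] that(2) by blast
  have Be: "sq (oi e) (on_edge G (u n) e) \<le> \<mu>" if "e \<in> edges G" for e n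
    using sum_edges_ge[OF that, of "\<lambda>e. sq (oi e) (on_edge G (u n) e)"] sq_nonneg m[of n] by (force simp: gmass_def)
  have tail: "\<exists>T. \<forall>\<^sub>F n in sequentially. sq (oi e \<inter> {T..}) (on_edge G (u n) e) \<le> \<epsilon>" if e: "e \<in> edges G" and \<epsilon>: "\<epsilon> > 0" for e \<epsilon>
    using e
  proof (cases rule: interval_cases)
    case (2 l)
    then have "oi e \<inter> {l..} = {}" by auto
    then have "sq (oi e \<inter> {l..}) f \<le> \<epsilon>" for f using \<epsilon> by (simp add: sq_def)
    then show ?thesis by (intro exI[of _ l] always_eventually allI)
  next
    case 1
    define E where "E = (8 + M powr (p - 2) / p) * \<mu>"
    have E: "E \<ge> 0" using p \<mu> by (auto simp: E_def intro!: mult_nonneg_nonneg add_nonneg_nonneg)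
    have s: "\<epsilon> * \<gamma> / (2 * \<mu>) > 0" using \<epsilon> \<gamma> \<mu> by simp
    \<comment> \<open>\<open>tightness\<close> multiplies by \<mu> / \<gamma> the sum of energy
      excess and cutting error; each is made at most \<epsilon> \<gamma> / (2 \<mu>), the error by
      the choice of N and the excess by large n.\<close>
    obtain N where N: "real N > E / (\<epsilon> * \<gamma> / (2 * \<mu>))" using reals_Archimedean2 by blast
    then have Np: "N > 0" using E s by (metis divide_nonneg_pos gr0I not_less of_nat_0)
    have EN: "E / real N < \<epsilon> * \<gamma> / (2 * \<mu>)"
    proof -
      have "E < real N * (\<epsilon> * \<gamma> / (2 * \<mu>))" using N s by (simp only: pos_divide_less_eq)
      then show ?thesis using Np by (simp only: pos_divide_less_eq of_nat_0_less_iff mult.commute)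
    qed
    have "\<forall>\<^sub>F n in sequentially. energy p q (u n) G < J + \<epsilon> * \<gamma> / (2 * \<mu>)"
      by (rule order_tendstoD(2)[OF lim]) (use s in linarith)
    then have "\<forall>\<^sub>F n in sequentially. sq (oi e \<inter> {real N + 1..}) (on_edge G (u n) e) \<le> \<epsilon>"
    proof eventually_elim
      fix n assume en: "energy p q (u n) G < J + \<epsilon> * \<gamma> / (2 * \<mu>)"
      have "(8 + gbd (u n) (g n) powr (p - 2) / p) * \<mu> / real N \<le> E / real N" unfolding E_def
        using gMu[of n] p \<mu> by (intro divide_right_mono mult_right_mono add_left_mono powr_mono2) (auto simp: gbd_def)
      then have b: "energy p q (u n) G - J + (8 + gbd (u n) (g n) powr (p - 2) / p) * \<mu> / real N \<le> \<epsilon> * \<gamma> / (2 * \<mu>) + \<epsilon> * \<gamma> / (2 * \<mu>)"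
        using en EN by linarith
      have "sq (oi e \<inter> {real N + 1..}) (on_edge G (u n) e)
          \<le> \<mu> / \<gamma> * (energy p q (u n) G - J + (8 + gbd (u n) (g n) powr (p - 2) / p) * \<mu> / real N)"
        by (rule tightness[OF nc p(1) q(1) \<mu> \<gamma> lb gap h m Np 1(2)])
      also have "\<dots> \<le> \<mu> / \<gamma> * (\<epsilon> * \<gamma> / (2 * \<mu>) + \<epsilon> * \<gamma> / (2 * \<mu>))"
        using b \<mu> \<gamma> by (intro mult_left_mono) auto
      also have "\<dots> = \<epsilon>" using \<mu> \<gamma> by (simp add: field_simps)
      finally show "sq (oi e \<inter> {real N + 1..}) (on_edge G (u n) e) \<le> \<epsilon>" .
    qed
    then show ?thesis by blast
  qed
  have mu: "(\<lambda>t. indicator (oi e) t * on_edge G (u n) e t) \<in> borel_measurable lborel"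
    "integrable lborel (\<lambda>t. indicator (oi e) t * (on_edge G (u n) e t)\<^sup>2)"
    "(\<lambda>t. indicator (oi e) t * g n e t) \<in> borel_measurable lborel"
    "integrable lborel (\<lambda>t. indicator (oi e) t * (g n e t)\<^sup>2)" if "e \<in> edges G" for e n
    using sob_measurable[OF Hp_sob[OF h that] interval_facts(1)[OF that]] sobD[OF Hp_sob[OF h that]] by auto
  have conv: "(\<lambda>t. indicator (oi e) t * on_edge G U e t) \<in> borel_measurable lborel"
    "integrable lborel (\<lambda>t. indicator (oi e) t * (on_edge G U e t)\<^sup>2)"
    "(\<lambda>n. sq (oi e) (\<lambda>t. on_edge G (u n) e t - on_edge G U e t)) \<longlonglongrightarrow> 0" if e: "e \<in> edges G" for e
    using L2_conv_of_pointwise[OF interval_facts(1,5)[OF e] mu(1)[OF e] mu(2)[OF e] Be[OF e] Mu[OF e oe[OF e]] pU[OF e oe[OF e]] tail[OF e]]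
    by auto
  have q0: "0 < q" using q by simp
  have mle: "gmass G (u n) \<le> \<mu>" for n using m by simp
  note lims = functional_limits[OF h p(1) q0 Mu[OF _ oe] mle conv(1) conv(2) MU[OF _ oe] conv(3) lv]
  have mU: "gmass G U = \<mu>" using LIMSEQ_unique[OF lims(1)] m by simp
  have Cau: "\<exists>N. \<forall>m\<ge>N. \<forall>n\<ge>N. (\<Sum>e\<in>edges G. sq (oi e) (\<lambda>t. g m e t - g n e t)) \<le> \<epsilon>" if "\<epsilon> > 0" for \<epsilon>
    by (rule derivs_Cauchy[OF h p(1) q(1) \<mu> m lb lim Mu[OF _ oe] conv(1) conv(2) MU[OF _ oe] conv(3) lv mU that])
  \<comment> \<open>Completeness was shown on the whole line, so the derivatives are cut off by the
    indicator of the edge. Bundling the properties of the limit allows a single choice over all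
    edges.\<close>
  define Q where "Q e F \<longleftrightarrow> F \<in> borel_measurable lborel \<and> integrable lborel (\<lambda>t. (F t)\<^sup>2) \<and>
      (\<lambda>n. \<integral>t. (indicator (oi e) t * g n e t - F t)\<^sup>2 \<partial>lborel) \<longlonglongrightarrow> 0 \<and>
      (\<forall>n. integrable lborel (\<lambda>t. (indicator (oi e) t * g n e t - F t)\<^sup>2))" for e F
  have "\<exists>F. Q e F" if e: "e \<in> edges G" for e
  proof -
    have i: "integrable lborel (\<lambda>t. (indicator (oi e) t * g n e t)\<^sup>2)" for n using mu(4)[OF e] by (simp add: ind_sq)
    have c: "\<exists>N. \<forall>m\<ge>N. \<forall>n\<ge>N. (\<integral>t. (indicator (oi e) t * g m e t - indicator (oi e) t * g n e t)\<^sup>2 \<partial>lborel) \<le> \<epsilon>" if \<epsilon>: "\<epsilon> > 0" for \<epsilon>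
    proof -
      obtain N where N: "\<And>m n. m \<ge> N \<Longrightarrow> n \<ge> N \<Longrightarrow> (\<Sum>e\<in>edges G. sq (oi e) (\<lambda>t. g m e t - g n e t)) \<le> \<epsilon>" using Cau[OF \<epsilon>] by blast
      have "(\<integral>t. (indicator (oi e) t * g m e t - indicator (oi e) t * g n e t)\<^sup>2 \<partial>lborel) \<le> \<epsilon>" if "m \<ge> N" "n \<ge> N" for m n
        using N[OF that] sum_edges_ge[OF e, of "\<lambda>e. sq (oi e) (\<lambda>t. g m e t - g n e t)"] sq_nonneg
        by (force simp: right_diff_distrib[symmetric] ind_sq sq_def)
      then show ?thesis by blast
    qed
    show ?thesis
    proof (rule L2_complete[of "\<lambda>n t. indicator (oi e) t * g n e t", OF mu(3)[OF e] i c])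
      fix F
      assume F: "F \<in> borel_measurable lborel" "integrable lborel (\<lambda>t. (F t)\<^sup>2)"
        "\<And>n. integrable lborel (\<lambda>t. (indicator (oi e) t * g n e t - F t)\<^sup>2)"
        "(\<lambda>n. \<integral>t. (indicator (oi e) t * g n e t - F t)\<^sup>2 \<partial>lborel) \<longlonglongrightarrow> 0"
      show ?thesis unfolding Q_def by (intro exI[of _ F] conjI allI F)
    qed
  qed
  then have "\<forall>e\<in>edges G. \<exists>F. Q e F" by blast
  then obtain F where FQ: "\<forall>e\<in>edges G. Q e (F e)" using bchoice by blast
  have F: "F e \<in> borel_measurable lborel" "integrable lborel (\<lambda>t. (F e t)\<^sup>2)"
    "(\<lambda>n. \<integral>t. (indicator (oi e) t * g n e t - F e t)\<^sup>2 \<partial>lborel) \<longlonglongrightarrow> 0"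
    "integrable lborel (\<lambda>t. (indicator (oi e) t * g n e t - F e t)\<^sup>2)" if "e \<in> edges G" for e n
    using bspec[OF FQ that] unfolding Q_def by blast+
  have Fi: "(\<lambda>t. indicator (oi e) t * F e t) \<in> borel_measurable lborel"
    "integrable lborel (\<lambda>t. indicator (oi e) t * (F e t)\<^sup>2)" if e: "e \<in> edges G" for e
    using F(1)[OF e] int_indicator_mult[OF F(2)[OF e] interval_facts(6)[OF e]] interval_facts(6)[OF e] by measurable
  have lF: "(\<lambda>n. sq (oi e) (\<lambda>t. g n e t - F e t)) \<longlonglongrightarrow> 0" if e: "e \<in> edges G" for e
  proof (rule tendsto_sandwich[OF _ _ tendsto_const F(3)[OF e]])
    show "\<forall>\<^sub>F n in sequentially. 0 \<le> sq (oi e) (\<lambda>t. g n e t - F e t)" by (simp add: sq_nonneg)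
    show "\<forall>\<^sub>F n in sequentially. sq (oi e) (\<lambda>t. g n e t - F e t) \<le> (\<integral>t. (indicator (oi e) t * g n e t - F e t)\<^sup>2 \<partial>lborel)"
    proof (rule always_eventually, rule allI)
      fix n
      have eq: "(\<lambda>t. indicator (oi e) t * (g n e t - F e t)\<^sup>2) = (\<lambda>t. indicator (oi e) t * (indicator (oi e) t * g n e t - F e t)\<^sup>2)"
        by (rule ext) (simp add: indicator_def)
      show "sq (oi e) (\<lambda>t. g n e t - F e t) \<le> (\<integral>t. (indicator (oi e) t * g n e t - F e t)\<^sup>2 \<partial>lborel)"
        unfolding sq_def eq
        by (rule Bochner_Integration.integral_mono[OF int_indicator_mult[OF F(4)[OF e] interval_facts(6)[OF e]] F(4)[OF e]])
          (simp add: indicator_def)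
    qed
  qed
  have hU: "Hp G U F" unfolding Hp_def graph_continuous_def
  proof (intro conjI ballI)
    fix e assume e: "e \<in> edges G"
    show "sob (on_edge G U e) (F e) (oi e)"
      by (rule sob_limit[OF Hp_sob[OF h e] interval_facts(1)[OF e] conv(1)[OF e] Fi(1)[OF e] conv(2)[OF e] Fi(2)[OF e] conv(3)[OF e] lF[OF e]])
    \<comment> \<open>The Hoelder bound with the uniform constant K survives the pointwise limit,
      which makes U continuous up to the endpoints of the edge.\<close>
    have hol: "(on_edge G U e t - on_edge G U e s)\<^sup>2 \<le> \<bar>t - s\<bar> * K" if "s \<in> ei e" "t \<in> ei e" for s t
    proof (rule LIMSEQ_le_const2)
      show "(\<lambda>n. (on_edge G (u n) e t - on_edge G (u n) e s)\<^sup>2) \<longlonglongrightarrow> (on_edge G U e t - on_edge G U e s)\<^sup>2"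
        by (intro tendsto_intros pU e that)
      have "(on_edge G (u n) e t - on_edge G (u n) e s)\<^sup>2 \<le> \<bar>t - s\<bar> * K" for n
        using edge_holder[OF h e that, of n] mult_left_mono[OF Ku[of n], of "\<bar>t - s\<bar>"] by linarith
      then show "\<exists>N. \<forall>n\<ge>N. (on_edge G (u n) e t - on_edge G (u n) e s)\<^sup>2 \<le> \<bar>t - s\<bar> * K" by blast
    qed
    show "continuous_on (ei e) (on_edge G U e)"
      unfolding continuous_on_iff
    proof (intro ballI allI impI)
      fix s \<epsilon> :: real assume s: "s \<in> ei e" and \<epsilon>: "\<epsilon> > 0"
      have "dist (on_edge G U e t) (on_edge G U e s) < \<epsilon>" if t: "t \<in> ei e" "dist t s < \<epsilon>\<^sup>2 / (K + 1)" for t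
      proof -
        have "(on_edge G U e t - on_edge G U e s)\<^sup>2 \<le> \<bar>t - s\<bar> * (K + 1)"
          using hol[OF s t(1)] mult_left_mono[of K "K + 1" "\<bar>t - s\<bar>"] by linarith
        also have "\<dots> < \<epsilon>\<^sup>2" using t(2) K0 by (simp add: dist_real_def pos_less_divide_eq)
        finally have "\<bar>on_edge G U e t - on_edge G U e s\<bar>\<^sup>2 < \<epsilon>\<^sup>2" by simp
        then show ?thesis unfolding dist_real_def by (rule power2_less_imp_less) (use \<epsilon> in simp)
      qed
      moreover have "\<epsilon>\<^sup>2 / (K + 1) > 0" using \<epsilon> K0 by simp
      ultimately show "\<exists>d>0. \<forall>t\<in>ei e. dist t s < d \<longrightarrow> dist (on_edge G U e t) (on_edge G U e s) < \<epsilon>" by blast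
    qed
  qed
  have "(\<lambda>n. sq (oi e) (g n e)) \<longlonglongrightarrow> sq (oi e) (F e)" if e: "e \<in> edges G" for e
    unfolding sq_def
  proof (rule L2_functional_limit[OF mu(3)[OF e] Fi(1)[OF e] mu(4)[OF e] Fi(2)[OF e] lF[OF e] _ mu(4)[OF e] Fi(2)[OF e], where C = 1 and B = K])
    fix n
    show "sq (oi e) (g n e) \<le> K"
      using sum_edges_ge[OF e, of "\<lambda>e. sq (oi e) (g n e)"] sq_nonneg Ku[of n] by (force simp: gkin_def)
    fix t
    have "(g n e t)\<^sup>2 - (F e t)\<^sup>2 = (g n e t + F e t) * (g n e t - F e t)" by (simp add: power2_eq_square algebra_simps)
    then show "\<bar>(g n e t)\<^sup>2 - (F e t)\<^sup>2\<bar> \<le> 1 * ((\<bar>g n e t\<bar> + \<bar>F e t\<bar>) * \<bar>g n e t - F e t\<bar>)"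
      using abs_triangle_ineq[of "g n e t" "F e t"] by (simp add: abs_mult mult_right_mono)
  qed
  then have lk: "(\<lambda>n. gkin G (g n)) \<longlonglongrightarrow> gkin G F" unfolding gkin_def by (intro tendsto_sum)
  have "(\<lambda>n. gkin G (g n) / 2 - gpint p G (u n) / p - gver q G (u n) / q) \<longlonglongrightarrow> gkin G F / 2 - gpint p G U / p - gver q G U / q"
    using p q by (intro tendsto_intros lk lims(2,3)) auto
  then have "(\<lambda>n. energy p q (u n) G) \<longlonglongrightarrow> energy p q U G"
    by (simp add: energy_eq[OF h p(1)] gen_eq[OF h p(1)] energy_eq[OF hU p(1)] gen_eq[OF hU p(1)])
  then have "energy p q U G = J" using lim LIMSEQ_unique by blast
  moreover have "U \<in> H1_mass G \<mu>" using Hp_imp_H1(1)[OF hU] mU by (simp add: H1_mass_iff)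
  ultimately show ?thesis by blast
qed

text \<open>Coercivity bounds the energies below and \<open>half_line_gap\<close> supplies an
  admissible function, so the infimum is a real number J to which the gap applies; only at the end
  is it identified with the infimum in the extended reals.\<close>

lemma ground_state_exists:
  assumes nc: "noncompact_graph G" and p: "2 < p" "p < 6" and q: "2 < q" "q < 4"
    and v: "v \<in> verts G" "vertex_degree G v = 2"
  shows "\<exists>\<mu>\<^sub>0>0. \<forall>\<mu>\<ge>\<mu>\<^sub>0. \<exists>u. ground_state p q \<mu> G u"
proof -
  obtain \<mu>0 where \<mu>0: "\<mu>0 > 0" "\<And>\<mu>. \<mu> \<ge> \<mu>0 \<Longrightarrow> H1_mass G \<mu> \<noteq> {} \<and>
    (\<forall>J. (\<forall>w\<in>H1_mass G \<mu>. J \<le> energy p q w G) \<longrightarrow>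
      (\<exists>\<gamma>>0. \<forall>f g. h1 f g \<longrightarrow> (\<forall>t<0. f t = 0 \<and> g t = 0) \<longrightarrow> mass f \<le> \<mu> \<longrightarrow> (J + \<gamma>) / \<mu> * mass f \<le> en p UNIV f g))"
    using half_line_gap[OF v p q] by blast
  have "\<exists>u. ground_state p q \<mu> G u" if \<mu>: "\<mu> \<ge> \<mu>0" for \<mu>
  proof -
    have \<mu>p: "\<mu> > 0" using \<mu> \<mu>0(1) by linarith
    let ?E = "(\<lambda>w. energy p q w G) ` H1_mass G \<mu>"
    define J where "J = Inf ?E"
    obtain C where C: "\<And>u g. Hp G u g \<Longrightarrow> gmass G u = \<mu> \<Longrightarrow> gkin G g / 4 - C \<le> energy p q u G"
      using coercive[OF nc p q \<mu>p] by blast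
    have "- C \<le> energy p q w G" if "w \<in> H1_mass G \<mu>" for w
      using C[OF H1_imp_Hp, of w] that gkin_nonneg[of G "graph_deriv G w"] by (simp add: H1_mass_iff)
    then have bdd: "bdd_below ?E" by (auto simp: bdd_below_def)
    have ne: "?E \<noteq> {}" using \<mu>0(2)[OF \<mu>] by simp
    have lb: "J \<le> energy p q w G" if "w \<in> H1_mass G \<mu>" for w
      unfolding J_def using that bdd by (intro cInf_lower) auto
    have inf: "\<exists>w\<in>H1_mass G \<mu>. energy p q w G < J + \<epsilon>" if "\<epsilon> > 0" for \<epsilon>
      using cInf_lessD[OF ne, of "J + \<epsilon>"] that by (auto simp: J_def)
    obtain \<gamma> where \<gamma>: "\<gamma> > 0" "\<And>f g. h1 f g \<Longrightarrow> (\<And>t. t < 0 \<Longrightarrow> f t = 0 \<and> g t = 0) \<Longrightarrow> mass f \<le> \<mu> \<Longrightarrow> (J + \<gamma>) / \<mu> * mass f \<le> en p UNIV f g"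
      using \<mu>0(2)[OF \<mu>] lb by blast
    obtain U where U: "U \<in> H1_mass G \<mu>" "energy p q U G = J"
      using minimiser_exists[OF nc p q \<mu>p \<gamma>(1) lb inf \<gamma>(2)] by blast
    have "ereal (energy p q U G) = (INF w \<in> H1_mass G \<mu>. ereal (energy p q w G))"
    proof (rule antisym)
      show "ereal (energy p q U G) \<le> (INF w \<in> H1_mass G \<mu>. ereal (energy p q w G))"
        by (rule INF_greatest) (use lb U in auto)
      show "(INF w \<in> H1_mass G \<mu>. ereal (energy p q w G)) \<le> ereal (energy p q U G)"
        by (rule INF_lower[OF U(1)])
    qed
    then show ?thesis using U(1) unfolding ground_state_def by blast
  qed
  then show ?thesis using \<mu>0(1) by blast
qed

end

theorem theorem1p2:
  fixes p q :: real and G :: "('v, 'e) mgraph"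
  assumes "2 < p" "p < 6" "2 < q" "q < 4"
    and "metric_graph G"
    and "noncompact_graph G"
    and "\<exists>v \<in> verts G. vertex_degree G v = 2"
  shows "\<exists>\<mu>\<^sub>0 > 0. \<forall>\<mu> \<ge> \<mu>\<^sub>0. \<exists>u. ground_state p q \<mu> G u"
  using assms metric_graph.ground_state_exists[of G p q] by blast

end
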